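(* Let $d\ge2$ and $f,g_1,\dots,g_n\in\mathcal{R}_d$. Suppose $f=g_1+\dots+g_n$ is a regular splitting of $f$. Let $s_i=\dim_KR_{d-1}(g_i)$ for every $i$. Let $s=\sum_{i=1}^ns_i$, and define $$\nu_{nk}=(n-1)\binom{r}{k+1}+\binom{r-s}{k+1}-\sum_{i=1}^n\binom{r-s_i}{k+1}.$$ Denote by $\hat\beta^f_{kj}$ and $\hat\beta^{g_i}_{kj}$ the shifted graded Betti numbers of $R/\mathrm{ann}_R(f)$ and $R/\mathrm{ann}_R(g_i)$, respectively. Then $$\hat\beta^f_{kj}=\sum_{i=1}^n\hat\beta^{g_i}_{kj}+\nu_{nk}\,\delta_{1j}+\nu_{n,r-k}\,\delta_{d-1,j}$$ for all $0<j<d$ and all $k\in\mathbb{Z}$. Here $\delta_{ii}=1$ for all $i$ and $\delta_{ij}=0$ for all $i\ne j$.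
   Context: $K$ is a field, $r\ge 1$, $R=K[\partial_1,\dots,\partial_r]$ is a polynomial ring with the standard grading, and $\mathcal{R}=K[x_1,\dots,x_r]^{DP}=\bigoplus_{d\ge0}\mathcal{R}_d$ is the divided power ring: $\mathcal{R}_d$ has $K$-basis $x^{(\alpha)}=\prod_i x_i^{(\alpha_i)}$, $|\alpha|=d$, with multiplication generated by $x_i^{(a)}x_i^{(b)}=\binom{a+b}{a}x_i^{(a+b)}$. $R$ acts on $\mathcal{R}$ by $\partial^\beta(x^{(\alpha)})=x^{(\alpha-\beta)}$ (zero if some $\alpha_i<\beta_i$). $\mathrm{ann}_R(f)=\{D\in R:Df=0\}$ and $R_e(f)=\{Df:D\in R_e\}$. A regular splitting of $f\in\mathcal{R}_d$ of length $n$ is an expression $f=g_1+\dots+g_n$ with nonzero $g_i\in\mathcal{R}_d$ such that $R_{d-1}(g_i)\cap\sum_{j\ne i}R_{d-1}(g_j)=0$ in $\mathcal{R}_1$ for all $i$. The shifted graded Betti numbers $\hat\beta_{ij}$ of a graded quotient $R/I$ are defined by the graded minimal free resolution of $R/I$ having $i$-th term $\bigoplus_{j\ge0}\hat\beta_{ij}R(-i-j)$ (and $\hat\beta_{ij}=0$ for $i<0$ or $i>r$). Convention: $\binom ab=0$ for $b<0$ and for $b>a$. *)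

theory Defs
  imports Complex_Main "HOL-Library.Poly_Mapping" "HOL-Library.Set_Algebras" "HOL-Library.Cardinality"
begin

(* The r variables are indexed by a finite type 'v, so r = CARD('v) >= 1. *)

type_synonym ('v, 'k) poly_ring = "('v \<Rightarrow>\<^sub>0 nat) \<Rightarrow>\<^sub>0 'k"

(* The basis element x^(\<alpha>) is "single \<alpha> 1".  Only the graded K-vector space structure of the
   divided power ring and the action of the polynomial ring on it are used below; the product
   that Poly_Mapping puts on this type is not the divided power product. *)

type_synonym ('v, 'k) div_pow = "('v \<Rightarrow>\<^sub>0 nat) \<Rightarrow>\<^sub>0 'k"

(* Used both for K acting on polynomials and divided powers, and for R acting on free R-modules. *)

definition smul :: "'c::comm_ring_1 \<Rightarrow> ('b \<Rightarrow>\<^sub>0 'c) \<Rightarrow> ('b \<Rightarrow>\<^sub>0 'c)" where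
  "smul c u = Poly_Mapping.map ((*) c) u"

lemma lookup_smul [simp]: "Poly_Mapping.lookup (smul c u) x = c * Poly_Mapping.lookup u x"
  by (simp add: smul_def Poly_Mapping.map.rep_eq when_def)

lemma module_smul: "module (smul :: 'c::comm_ring_1 \<Rightarrow> ('b \<Rightarrow>\<^sub>0 'c) \<Rightarrow> _)"
  by standard (auto intro!: poly_mapping_eqI simp: lookup_add algebra_simps)

lemma vector_space_smul: "vector_space (smul :: 'k::field \<Rightarrow> ('b \<Rightarrow>\<^sub>0 'k) \<Rightarrow> _)"
  by standard (auto intro!: poly_mapping_eqI simp: lookup_add algebra_simps)

definition mdeg :: "('v::finite \<Rightarrow>\<^sub>0 nat) \<Rightarrow> nat" where
  "mdeg \<alpha> = (\<Sum>v\<in>UNIV. Poly_Mapping.lookup \<alpha> v)"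

definition homog :: "nat \<Rightarrow> (('v::finite \<Rightarrow>\<^sub>0 nat) \<Rightarrow>\<^sub>0 'k::zero) set" where
  "homog e = {p. \<forall>\<alpha>\<in>Poly_Mapping.keys p. mdeg \<alpha> = e}"

(* Bilinear extension of \<partial>^\<beta> x^(\<alpha>) = x^(\<alpha> - \<beta>).  The divisibility condition is spelled out because
   the order of Poly_Mapping is lexicographic, not pointwise. *)

definition contract :: "('v::finite, 'k::field) poly_ring \<Rightarrow> ('v, 'k) div_pow \<Rightarrow> ('v, 'k) div_pow" where
  "contract D f = (\<Sum>\<beta>\<in>Poly_Mapping.keys D. \<Sum>\<alpha>\<in>Poly_Mapping.keys f.
     if \<forall>v. Poly_Mapping.lookup \<beta> v \<le> Poly_Mapping.lookup \<alpha> v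
     then Poly_Mapping.single (\<alpha> - \<beta>) (Poly_Mapping.lookup D \<beta> * Poly_Mapping.lookup f \<alpha>)
     else 0)"

lemma contract_single:
  "contract (Poly_Mapping.single \<beta> 1) (Poly_Mapping.single \<alpha> 1 :: ('v::finite, 'k::field) div_pow) =
     (if \<forall>v. Poly_Mapping.lookup \<beta> v \<le> Poly_Mapping.lookup \<alpha> v
      then Poly_Mapping.single (\<alpha> - \<beta>) 1 else 0)"
  by (auto simp: contract_def split: if_splits intro!: sum.neutral)

definition ann :: "('v::finite, 'k::field) div_pow \<Rightarrow> ('v, 'k) poly_ring set" where
  "ann f = {D. contract D f = 0}"

definition derivs :: "nat \<Rightarrow> ('v::finite, 'k::field) div_pow \<Rightarrow> ('v, 'k) div_pow set" where
  "derivs e f = (\<lambda>D. contract D f) ` homog e"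

(* The sum on the right is the Minkowski sum of sets from Set_Algebras, hence the sum of subspaces. *)

definition regular_splitting ::
  "nat \<Rightarrow> nat \<Rightarrow> ('v::finite, 'k::field) div_pow \<Rightarrow> (nat \<Rightarrow> ('v, 'k) div_pow) \<Rightarrow> bool" where
  "regular_splitting d n f g \<longleftrightarrow>
     f \<in> homog d \<and>
     (\<forall>i\<in>{1..n}. g i \<in> homog d \<and> g i \<noteq> 0) \<and>
     f = (\<Sum>i=1..n. g i) \<and>
     (\<forall>i\<in>{1..n}. derivs (d - 1) (g i) \<inter> (\<Sum>j\<in>{1..n} - {i}. derivs (d - 1) (g j)) = {0})"

(* All free modules are realised inside one R-module with basis indexed by nat * nat.
   For c :: nat => nat, "free_mod c" is the free module with c j basis elements (j, 0), ..., (j, c j - 1)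
   for every j.  In homological position i the basis element (j, m) has degree i + j, so that
   "free_mod c" is the direct sum of the modules R(-i-j)^(c j), and "free_mod_deg i c e" is its
   component of degree e. *)

type_synonym ('v, 'k) fmod = "(nat \<times> nat) \<Rightarrow>\<^sub>0 ('v, 'k) poly_ring"

definition free_mod :: "(nat \<Rightarrow> nat) \<Rightarrow> ('v::finite, 'k::field) fmod set" where
  "free_mod c = {u. \<forall>(j, m)\<in>Poly_Mapping.keys u. m < c j}"

definition free_mod_deg :: "nat \<Rightarrow> (nat \<Rightarrow> nat) \<Rightarrow> nat \<Rightarrow> ('v::finite, 'k::field) fmod set" where
  "free_mod_deg i c e =
     {u\<in>free_mod c. \<forall>(j, m)\<in>Poly_Mapping.keys u.
        \<forall>\<alpha>\<in>Poly_Mapping.keys (Poly_Mapping.lookup u (j, m)). mdeg \<alpha> + (i + j) = e}"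

(* F_i = free_mod (b i), \<phi> i : F_(i+1) -> F_i, and F_0 -> R/I is the map u |-> \<epsilon> u + I; every graded
   map F_0 -> R/I has such a lift \<epsilon>, F_0 being free.  Only the restrictions of \<phi> i and \<epsilon> to
   F_(i+1) and F_0 matter; any R-linear map on these extends to the ambient module by zero on the
   other basis elements.  The last clause is minimality: the image of \<phi> i lies in m F_i, where m is the
   ideal of polynomials without constant term. *)

definition minimal_free_resolution ::
  "('v::finite, 'k::field) poly_ring set \<Rightarrow> (nat \<Rightarrow> nat \<Rightarrow> nat) \<Rightarrow>
   (nat \<Rightarrow> ('v, 'k) fmod \<Rightarrow> ('v, 'k) fmod) \<Rightarrow> (('v, 'k) fmod \<Rightarrow> ('v, 'k) poly_ring) \<Rightarrow> bool" where
  "minimal_free_resolution I b \<phi> \<epsilon> \<longleftrightarrow>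
     module_hom smul (*) \<epsilon> \<and>
     (\<forall>e. \<epsilon> ` free_mod_deg 0 (b 0) e \<subseteq> homog e) \<and>
     (\<forall>i. module_hom smul smul (\<phi> i)) \<and>
     (\<forall>i e. \<phi> i ` free_mod_deg (Suc i) (b (Suc i)) e \<subseteq> free_mod_deg i (b i) e) \<and>
     (\<forall>p. \<exists>u\<in>free_mod (b 0). p - \<epsilon> u \<in> I) \<and>
     {u\<in>free_mod (b 0). \<epsilon> u \<in> I} = \<phi> 0 ` free_mod (b 1) \<and>
     (\<forall>i. {u\<in>free_mod (b (Suc i)). \<phi> i u = 0} = \<phi> (Suc i) ` free_mod (b (Suc (Suc i)))) \<and>
     (\<forall>i. \<forall>u\<in>free_mod (b (Suc i)). \<forall>x.
        Poly_Mapping.lookup (Poly_Mapping.lookup (\<phi> i u) x) 0 = 0)"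

(* The minimal resolution of R/I is unique up to isomorphism, so its ranks are well defined. *)

definition shifted_betti :: "('v::finite, 'k::field) poly_ring set \<Rightarrow> int \<Rightarrow> nat \<Rightarrow> nat" where
  "shifted_betti I i j =
     (if i < 0 \<or> i > int CARD('v) then 0
      else (THE b. \<exists>\<phi> \<epsilon>. minimal_free_resolution I b \<phi> \<epsilon>) (nat i) j)"

(* The convention "0 unless 0 <= b <= a" also covers negative arguments. *)

definition binom :: "int \<Rightarrow> int \<Rightarrow> int" where
  "binom a b = (if b < 0 \<or> b > a then 0 else int (nat a choose nat b))"

definition nu :: "nat \<Rightarrow> nat \<Rightarrow> (nat \<Rightarrow> nat) \<Rightarrow> int \<Rightarrow> int" where
  "nu r n s k = (int n - 1) * binom (int r) (k + 1)
     + binom (int r - (\<Sum>i=1..n. int (s i))) (k + 1)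
     - (\<Sum>i=1..n. binom (int r - int (s i)) (k + 1))"

end

theory Submission
  imports Defs "HOL-Library.Function_Algebras"
begin

text \<open>The algebra \<open>R/ann f\<close> is the graded module \<open>R f\<close> of all \<open>D f\<close>, with \<open>R\<^sub>e f\<close> as its
component of degree \<open>e\<close>. Its shifted Betti number at \<open>(k, j)\<close> is the dimension of the homology of
\<open>\<Lambda>\<^bsup>k+1\<^esup> \<otimes> R\<^bsub>j-1\<^esub> f \<longrightarrow> \<Lambda>\<^bsup>k\<^esup> \<otimes> R\<^bsub>j\<^esub> f \<longrightarrow> \<Lambda>\<^bsup>k-1\<^esup> \<otimes> R\<^bsub>j+1\<^esub> f\<close>
in the Koszul complex of the variables acting on \<open>R f\<close> (\<open>shifted_betti_eq_koszul_dim\<close>). The reason is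
that the variables form a regular sequence on \<open>R\<close>, so the Koszul complex of a free module is exact in
positive homological degree (\<open>koszul_exact\<close>); hence passing from a module to the syzygies in a minimal
resolution shifts Koszul homology by one step (\<open>koszul_dim_shift_minimal\<close>), and after \<open>k\<close> steps only the
number of generators of the \<open>k\<close>-th syzygy module is left. The same works for any \<open>r\<close> linear forms that
span \<open>R\<^sub>1\<close>, so the Koszul complex may be computed in convenient coordinates.

In a regular splitting the spaces of linear derivatives \<open>R\<^bsub>d-1\<^esub> g\<^sub>i\<close> are independent. Every linear form can
therefore be changed to one that acts on \<open>g\<^sub>i\<close> in the same way and kills all other \<open>g\<^sub>l\<close>
(\<open>separating_form\<close>), and this gives \<open>R\<^sub>e f = \<Oplus>\<^sub>i R\<^sub>e g\<^sub>i\<close> for \<open>0 < e < d\<close> (\<open>derivs_int_f\<close>,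
\<open>derivs_int_indep\<close>). The homology at \<open>R\<^sub>j f\<close> involves only the degrees \<open>j-1\<close>, \<open>j\<close> and \<open>j+1\<close>, so it is the
direct sum of the homologies for the \<open>g\<^sub>i\<close> unless \<open>j = 1\<close> or \<open>j = d-1\<close>. In these two cases degree \<open>0\<close> or
degree \<open>d\<close> enters, where each of \<open>R f\<close> and the \<open>R g\<^sub>i\<close> has dimension one.

The correction terms measure the rank of the differential out of degree \<open>0\<close>, respectively into degree
\<open>d\<close>. For a single nonzero form \<open>h\<close> with \<open>s = dim R\<^bsub>d-1\<^esub> h\<close> these ranks are found with linear forms adapted
to \<open>R\<^bsub>d-1\<^esub> h\<close>: \<open>s\<close> of them act on \<open>h\<close> independently and the other \<open>r - s\<close> kill it. A chain
\<open>\<Sum>\<^sub>T a\<^sub>T h e\<^sub>T\<close> of degree \<open>0\<close> is then a cycle iff \<open>a\<^sub>T = 0\<close> for every \<open>T\<close> that meets the first group, and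
the boundaries in degree \<open>d\<close> are spanned by the \<open>e\<^sub>T\<close> for which \<open>T\<close> does not contain the first group.
Counting sets gives binomial coefficients (\<open>koszul_ends\<close>, \<open>rank_at_ends\<close>), and the difference between the
sum of the ranks for the \<open>g\<^sub>i\<close> and the rank for \<open>f\<close> is \<open>\<nu>\<close> (\<open>nu_bottom\<close>, \<open>nu_top\<close>).\<close>

section \<open>Finite-dimensional subspaces\<close>

text \<open>The ambient spaces of polynomials, free modules and chains are infinite-dimensional, but all graded pieces
have finite dimension. So bases and dimensions are used for finite-dimensional subspaces only.\<close>
locale vec_space = vector_space
begin

definition fin_dim :: "'b set \<Rightarrow> bool" where
  "fin_dim S \<longleftrightarrow> (\<exists>B. finite B \<and> S \<subseteq> span B)"

lemma fin_dim_subset: "fin_dim T \<Longrightarrow> S \<subseteq> T \<Longrightarrow> fin_dim S"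
  unfolding fin_dim_def by blast

lemma fin_dim_basis:
  assumes "fin_dim S" "subspace S"
  obtains B where "finite B" "independent B" "B \<subseteq> S" "span B = S" "card B = dim S"
proof -
  obtain B where B: "B \<subseteq> S" "independent B" "S \<subseteq> span B" "card B = dim S"
    using basis_exists by blast
  obtain B0 where "finite B0" "S \<subseteq> span B0" using assms(1) by (auto simp: fin_dim_def)
  then have "finite B" using independent_span_bound[of B0 B] B(1,2) by auto
  moreover have "span B = S" using B assms(2) span_minimal by blast
  ultimately show ?thesis using B that by blast
qed

lemma fin_dim_independent_finite:
  assumes "fin_dim S" "independent B" "B \<subseteq> S"
  shows "finite B"
  using assms independent_span_bound unfolding fin_dim_def by (meson order_trans)

lemma dim_mono_fin_dim:
  assumes "fin_dim T" "S \<subseteq> T" "subspace T"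
  shows "dim S \<le> dim T"
proof -
  obtain B where "finite B" "span B = T" "card B = dim T"
    using fin_dim_basis[OF assms(1,3)] by blast
  then show ?thesis using assms(2) dim_le_card[of S B] by simp
qed

lemma independent_Un_trivial_Int:
  assumes "subspace S" "subspace T" "S \<inter> T \<subseteq> {0}"
    and A: "finite A" "independent A" "A \<subseteq> S" and B: "finite B" "independent B" "B \<subseteq> T"
  shows "A \<inter> B = {}" "independent (A \<union> B)"
proof -
  have disj: "A \<inter> B = {}"
  proof (rule ccontr)
    assume "A \<inter> B \<noteq> {}"
    then obtain x where x: "x \<in> A" "x \<in> B" by blast
    then have "x = 0" using assms(3) A(3) B(3) by blast
    then show False using x A dependent_zero by blast
  qed
  have ind: "independent (A \<union> B)"
    unfolding independent_explicit_finite_subsets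
  proof (intro allI impI ballI)
    fix U u v
    assume U: "U \<subseteq> A \<union> B" "finite U" "(\<Sum>v\<in>U. u v *s v) = 0" and v: "v \<in> U"
    have "(\<Sum>v\<in>U. u v *s v) = (\<Sum>v\<in>U\<inter>A. u v *s v) + (\<Sum>v\<in>U\<inter>B. u v *s v)"
    proof -
      have "U = (U \<inter> A) \<union> (U \<inter> B)" using U by blast
      moreover have "(U \<inter> A) \<inter> (U \<inter> B) = {}" using disj by blast
      ultimately show ?thesis using U(2) sum.union_disjoint[of "U\<inter>A" "U\<inter>B" "\<lambda>v. u v *s v"] by simp
    qed
    then have e: "(\<Sum>v\<in>U\<inter>A. u v *s v) = - (\<Sum>v\<in>U\<inter>B. u v *s v)" 
      using U by (simp add: eq_neg_iff_add_eq_0)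
    have 1: "(\<Sum>v\<in>U\<inter>A. u v *s v) \<in> S" using A assms(1)
      by (auto intro!: subspace_sum subspace_scale)
    have 2: "(\<Sum>v\<in>U\<inter>B. u v *s v) \<in> T" using B assms(2)
      by (auto intro!: subspace_sum subspace_scale)
    have 3: "(\<Sum>v\<in>U\<inter>A. u v *s v) \<in> T" using e 2 assms(2) subspace_neg by simp
    have z: "(\<Sum>v\<in>U\<inter>A. u v *s v) = 0" using 1 3 assms(3) by blast
    then have z': "(\<Sum>v\<in>U\<inter>B. u v *s v) = 0" using e by simp
    show "u v = 0"
    proof (cases "v \<in> A")
      case True
      then show ?thesis using independentD[OF A(2) _ _ z] v U(2) by simp
    next
      case False
      then have "v \<in> B" using U v by blast
      then show ?thesis using independentD[OF B(2) _ _ z'] v U(2) by simp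
    qed
  qed
  show "A \<inter> B = {}" by (rule disj)
  show "independent (A \<union> B)" by (rule ind)
qed

lemma dim_plus_trivial_Int:
  assumes "subspace S" "subspace T" "fin_dim S" "fin_dim T" "S \<inter> T \<subseteq> {0}"
  shows "dim {x + y |x y. x \<in> S \<and> y \<in> T} = dim S + dim T"
proof -
  obtain A where A: "finite A" "independent A" "A \<subseteq> S" "span A = S" "card A = dim S"
    using fin_dim_basis[OF assms(3,1)] by blast
  obtain B where B: "finite B" "independent B" "B \<subseteq> T" "span B = T" "card B = dim T"
    using fin_dim_basis[OF assms(4,2)] by blast
  note disj = independent_Un_trivial_Int(1)[OF assms(1,2,5) A(1-3) B(1-3)]
  note ind = independent_Un_trivial_Int(2)[OF assms(1,2,5) A(1-3) B(1-3)]
  have "{x + y |x y. x \<in> S \<and> y \<in> T} = span (A \<union> B)"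
    using A B span_Un by auto
  then have "dim {x + y |x y. x \<in> S \<and> y \<in> T} = card (A \<union> B)"
    using dim_span_eq_card_independent ind by simp
  then show ?thesis using A B disj by (simp add: card_Un_disjoint)
qed

text \<open>The sum of the subspaces \<open>N i\<close> is direct.\<close>
definition indep_family :: "'i set \<Rightarrow> ('i \<Rightarrow> 'b set) \<Rightarrow> bool" where
  "indep_family I N \<longleftrightarrow> (\<forall>y. (\<forall>i\<in>I. y i \<in> N i) \<longrightarrow> (\<Sum>i\<in>I. y i) = 0 \<longrightarrow> (\<forall>i\<in>I. y i = 0))"

definition sum_family :: "'i set \<Rightarrow> ('i \<Rightarrow> 'b set) \<Rightarrow> 'b set" where
  "sum_family I N = {\<Sum>i\<in>I. y i |y. \<forall>i\<in>I. y i \<in> N i}"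

lemma indep_familyD:
  "indep_family I N \<Longrightarrow> (\<And>i. i \<in> I \<Longrightarrow> y i \<in> N i) \<Longrightarrow> (\<Sum>i\<in>I. y i) = 0 \<Longrightarrow> i \<in> I \<Longrightarrow> y i = 0"
  unfolding indep_family_def by blast

lemma sum_family_insert:
  assumes "finite I" "a \<notin> I"
  shows "sum_family (insert a I) N = {x + y |x y. x \<in> N a \<and> y \<in> sum_family I N}" (is "?L = ?R")
proof
  show "?L \<subseteq> ?R" using assms unfolding sum_family_def by auto
  show "?R \<subseteq> ?L"
  proof
    fix z assume "z \<in> ?R"
    then obtain x y where z: "z = x + (\<Sum>i\<in>I. y i)" "x \<in> N a" "\<forall>i\<in>I. y i \<in> N i"
      unfolding sum_family_def by blast
    have "z = (\<Sum>i\<in>insert a I. (y(a := x)) i)"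
      using assms z by (simp add: sum.insert) (intro sum.cong, auto)
    moreover have "\<forall>i\<in>insert a I. (y(a := x)) i \<in> N i" using z by auto
    ultimately show "z \<in> ?L" unfolding sum_family_def by blast
  qed
qed

lemma sum_family_subspace_fin_dim:
  assumes "finite I" "\<And>i. i \<in> I \<Longrightarrow> subspace (N i)" "\<And>i. i \<in> I \<Longrightarrow> fin_dim (N i)"
  shows "subspace (sum_family I N) \<and> fin_dim (sum_family I N)"
  using assms
proof (induction I rule: finite_induct)
  case empty
  then show ?case by (auto simp: sum_family_def fin_dim_def intro!: exI[of _ "{}"])
next
  case (insert a I)
  then have *: "subspace (sum_family I N)" "fin_dim (sum_family I N)" by auto
  obtain A B where "finite A" "N a \<subseteq> span A" "finite B" "sum_family I N \<subseteq> span B"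
    using * insert.prems unfolding fin_dim_def by (meson insertI1)
  then have "finite (A \<union> B)" "{x + y |x y. x \<in> N a \<and> y \<in> sum_family I N} \<subseteq> span (A \<union> B)"
    unfolding span_Un by blast+
  then show ?case using * insert subspace_sums[of "N a" "sum_family I N"]
    unfolding fin_dim_def by (auto simp: sum_family_insert)
qed

lemma dim_sum_family:
  assumes "finite I" "\<And>i. i \<in> I \<Longrightarrow> subspace (N i)" "\<And>i. i \<in> I \<Longrightarrow> fin_dim (N i)"
    and "indep_family I N"
  shows "dim (sum_family I N) = (\<Sum>i\<in>I. dim (N i))"
  using assms
proof (induction I rule: finite_induct)
  case empty
  have "sum_family {} N = span {}" by (auto simp: sum_family_def)
  then show ?case using dim_span_eq_card_independent[OF independent_empty] by simp
next
  case (insert a I)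
  have ex: "\<exists>z. (\<forall>i\<in>insert a I. z i \<in> N i) \<and> (\<Sum>i\<in>insert a I. z i) = x + (\<Sum>i\<in>I. y i) \<and> z a = x 
      \<and> (\<forall>i\<in>I. z i = y i)"
    if "x \<in> N a" "\<forall>i\<in>I. y i \<in> N i" for x y
  proof (intro exI[of _ "y(a := x)"] conjI)
    have "(\<Sum>i\<in>I. (y(a := x)) i) = (\<Sum>i\<in>I. y i)" using insert.hyps by (intro sum.cong) auto
    then show "(\<Sum>i\<in>insert a I. (y(a := x)) i) = x + (\<Sum>i\<in>I. y i)" using insert.hyps by simp
  qed (use that insert.hyps in auto)
  have indI: "indep_family I N"
    unfolding indep_family_def
  proof (intro allI impI)
    fix y assume y: "\<forall>i\<in>I. y i \<in> N i" "(\<Sum>i\<in>I. y i) = 0"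
    have "0 \<in> N a" using insert.prems subspace_0 by blast
    from ex[OF this y(1)] obtain z where z: "\<forall>i\<in>insert a I. z i \<in> N i" 
      "(\<Sum>i\<in>insert a I. z i) = 0 + (\<Sum>i\<in>I. y i)" "\<forall>i\<in>I. z i = y i" by blast
    then have s0: "(\<Sum>i\<in>insert a I. z i) = 0" using y(2) by simp
    have "z i = 0" if "i \<in> I" for i
      by (rule indep_familyD[OF insert.prems(3) _ s0]) (use z(1) that in auto)
    then show "\<forall>i\<in>I. y i = 0" using z by simp
  qed
  have sub: "subspace (sum_family I N)" "fin_dim (sum_family I N)"
    using sum_family_subspace_fin_dim insert by auto
  have "N a \<inter> sum_family I N \<subseteq> {0}"
  proof
    fix x assume x: "x \<in> N a \<inter> sum_family I N"
    then obtain y where y: "x = (\<Sum>i\<in>I. y i)" "\<forall>i\<in>I. y i \<in> N i" unfolding sum_family_def by blast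
    have "- x \<in> N a" using x insert.prems subspace_neg by blast
    from ex[OF this y(2)] obtain z where z: "\<forall>i\<in>insert a I. z i \<in> N i" 
      "(\<Sum>i\<in>insert a I. z i) = - x + (\<Sum>i\<in>I. y i)" "z a = - x" by blast
    then have s0: "(\<Sum>i\<in>insert a I. z i) = 0" using y(1) by simp
    have "z a = 0"
      by (rule indep_familyD[OF insert.prems(3) _ s0]) (use z(1) in auto)
    then show "x \<in> {0}" using z by simp
  qed
  then show ?case using insert indI sub
    by (simp add: sum_family_insert dim_plus_trivial_Int)
qed

lemma sum_family_superset:
  assumes "finite I" "\<And>i. i \<in> I \<Longrightarrow> subspace (N i)" "i \<in> I"
  shows "N i \<subseteq> sum_family I N"
proof
  fix x assume x: "x \<in> N i"
  let ?y = "\<lambda>j. if j = i then x else 0"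
  have "x = (\<Sum>j\<in>I. ?y j)" using assms(1,3) by (simp add: sum.delta)
  moreover have "\<forall>j\<in>I. ?y j \<in> N j" using x assms(2) by (auto simp: subspace_0)
  ultimately show "x \<in> sum_family I N" unfolding sum_family_def by (intro CollectI exI[of _ ?y] conjI)
qed

lemma sum_family_subspace:
  assumes "finite I" "\<And>i. i \<in> I \<Longrightarrow> subspace (N i)" "\<And>i. i \<in> I \<Longrightarrow> fin_dim (N i)"
  shows "subspace (sum_family I N)"
  by (rule conjunct1[OF sum_family_subspace_fin_dim]) (rule assms, assumption?)+

lemma sum_family_least:
  assumes "subspace S" "\<And>i. i \<in> I \<Longrightarrow> N i \<subseteq> S"
  shows "sum_family I N \<subseteq> S"
  using assms by (auto simp: sum_family_def intro!: subspace_sum)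

lemma sum_familyI: "(\<And>i. i \<in> I \<Longrightarrow> y i \<in> N i) \<Longrightarrow> x = (\<Sum>i\<in>I. y i) \<Longrightarrow> x \<in> sum_family I N"
  unfolding sum_family_def by (intro CollectI exI[of _ y]) auto

lemma sum_familyE:
  assumes "x \<in> sum_family I N"
  obtains y where "x = (\<Sum>i\<in>I. y i)" "\<forall>i\<in>I. y i \<in> N i"
  using assms unfolding sum_family_def by blast

lemma indep_familyI:
  "(\<And>y i. \<forall>i\<in>I. y i \<in> N i \<Longrightarrow> (\<Sum>i\<in>I. y i) = 0 \<Longrightarrow> i \<in> I \<Longrightarrow> y i = 0) \<Longrightarrow> indep_family I N"
  unfolding indep_family_def by blast

lemma indep_family_mono:
  assumes "indep_family I N" "\<And>i. i \<in> I \<Longrightarrow> N' i \<subseteq> N i"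
  shows "indep_family I N'"
proof (rule indep_familyI)
  fix y i assume y: "\<forall>i\<in>I. y i \<in> N' i" "(\<Sum>i\<in>I. y i) = 0" "i \<in> I"
  show "y i = 0" by (rule indep_familyD[OF assms(1) _ y(2,3)]) (use y(1) assms(2) in blast)
qed

text \<open>A basis of \<open>Z\<close> modulo \<open>M\<close>, as it is needed for minimal generators, where \<open>M\<close> is the part of \<open>Z\<close> that
comes from lower degrees.\<close>
lemma complement_basis:
  assumes "subspace M" "M \<subseteq> Z" "subspace Z" "fin_dim Z"
  shows "\<exists>(n::nat) G. (\<forall>m<n. G m \<in> Z) \<and> (\<forall>z\<in>Z. \<exists>a w. w \<in> M \<and> z = (\<Sum>m<n. scale (a m) (G m)) + w) \<and>
    (\<forall>a. (\<Sum>m<n. scale (a m) (G m)) \<in> M \<longrightarrow> (\<forall>m<n. a m = 0))"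
proof -
  obtain A where A: "finite A" "independent A" "A \<subseteq> M" "span A = M" "card A = dim M"
    by (rule fin_dim_basis[OF fin_dim_subset[OF assms(4,2)] assms(1)])
  obtain B where B: "A \<subseteq> B" "B \<subseteq> Z" "independent B" "Z \<subseteq> span B"
    by (rule maximal_independent_subset_extend[OF order_trans[OF A(3) assms(2)] A(2)])
  have fB: "finite B" using fin_dim_independent_finite[OF assms(4) B(3,2)] .
  obtain G where G: "bij_betw G {..<card (B - A)} (B - A)"
    using ex_bij_betw_nat_finite[of "B - A"] fB by (auto simp: atLeast0LessThan)
  let ?n = "card (B - A)"
  have reind: "(\<Sum>m<?n. scale (a m) (G m)) = (\<Sum>x\<in>B - A. scale (a (inv_into {..<?n} G x)) x)" for a
    using sum.reindex_bij_betw[OF G, of "\<lambda>x. scale (a (inv_into {..<?n} G x)) x"]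
      inv_into_f_f[OF bij_betw_imp_inj_on[OF G]] by simp
  show ?thesis
  proof (rule exI[where x = ?n], rule exI[where x = G], intro conjI allI impI ballI)
    fix m assume "m < ?n"
    then have "G m \<in> B - A" using G unfolding bij_betw_def by blast
    then show "G m \<in> Z" using B by blast
  next
    fix z assume "z \<in> Z"
    then have "z \<in> span B" using B by blast
    then obtain u where u: "z = (\<Sum>x\<in>B. scale (u x) x)" unfolding span_finite[OF fB] by blast
    also have "\<dots> = (\<Sum>x\<in>B - A. scale (u x) x) + (\<Sum>x\<in>A. scale (u x) x)"
      by (rule sum.subset_diff[OF B(1) fB])
    also have "(\<Sum>x\<in>B - A. scale (u x) x) = (\<Sum>m<?n. scale (u (G m)) (G m))"
      by (rule sum.reindex_bij_betw[OF G, symmetric])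
    finally have "z = (\<Sum>m<?n. scale (u (G m)) (G m)) + (\<Sum>x\<in>A. scale (u x) x)" .
    moreover have "(\<Sum>x\<in>A. scale (u x) x) \<in> M"
      using A(3) assms(1) by (intro subspace_sum subspace_scale) auto
    ultimately show "\<exists>a w. w \<in> M \<and> z = (\<Sum>m<?n. scale (a m) (G m)) + w" by (intro exI conjI)
  next
    fix a m assume a: "(\<Sum>m<?n. scale (a m) (G m)) \<in> M" and m: "m < ?n"
    have "(\<Sum>m<?n. scale (a m) (G m)) \<in> span A" using a A(4) by simp
    then obtain u where u: "(\<Sum>m<?n. scale (a m) (G m)) = (\<Sum>x\<in>A. scale (u x) x)"
      unfolding span_finite[OF A(1)] by blast
    let ?c = "\<lambda>x. if x \<in> A then - u x else a (inv_into {..<?n} G x)"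
    have "(\<Sum>x\<in>B. scale (?c x) x) = (\<Sum>x\<in>B-A. scale (?c x) x) + (\<Sum>x\<in>A. scale (?c x) x)"
      by (rule sum.subset_diff[OF B(1) fB])
    also have "\<dots> = (\<Sum>m<?n. scale (a m) (G m)) - (\<Sum>x\<in>A. scale (u x) x)"
      by (simp add: sum_negf reind)
    also have "\<dots> = 0" using u by simp
    finally have 0: "(\<Sum>x\<in>B. scale (?c x) x) = 0" .
    have Gm: "G m \<in> B - A" using G m unfolding bij_betw_def by blast
    have "?c (G m) = 0" by (rule independentD[OF B(3) fB subset_refl 0]) (use Gm in blast)
    then show "a m = 0" using Gm inv_into_f_f[OF bij_betw_imp_inj_on[OF G]] m by simp
  qed
qed

end

locale vec_space_pair = vs1: vec_space s1 + vs2: vec_space s2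
  for s1 :: "'a::field \<Rightarrow> 'b::ab_group_add \<Rightarrow> 'b" and s2 :: "'a \<Rightarrow> 'c::ab_group_add \<Rightarrow> 'c"
begin

sublocale vector_space_pair s1 s2 ..

lemma fin_dim_image:
  assumes "Vector_Spaces.linear s1 s2 f" "vs1.fin_dim S"
  shows "vs2.fin_dim (f ` S)"
proof -
  obtain B where "finite B" "S \<subseteq> vs1.span B" using assms by (auto simp: vs1.fin_dim_def)
  then have "finite (f ` B)" "f ` S \<subseteq> vs2.span (f ` B)"
    using linear_span_image[OF assms(1), of B] by auto
  then show ?thesis unfolding vs2.fin_dim_def by blast
qed

lemma rank_nullity:
  assumes lin: "Vector_Spaces.linear s1 s2 f" and S: "vs1.subspace S" "vs1.fin_dim S"
  shows "vs1.dim S = vs2.dim (f ` S) + vs1.dim {x\<in>S. f x = 0}"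
proof -
  interpret f: Vector_Spaces.linear s1 s2 f by (rule lin)
  let ?K = "{x\<in>S. f x = 0}"
  have K: "vs1.subspace ?K"
    using S(1) by (auto simp: vs1.subspace_def f.zero f.add f.scale)
  obtain A where A: "finite A" "vs1.independent A" "A \<subseteq> ?K" "vs1.span A = ?K" "card A = vs1.dim ?K"
    using vs1.fin_dim_basis[OF vs1.fin_dim_subset[OF S(2)] K] by blast
  obtain B where B: "A \<subseteq> B" "B \<subseteq> S" "vs1.independent B" "S \<subseteq> vs1.span B"
    using vs1.maximal_independent_subset_extend[of A S] A by blast
  have fB: "finite B" using vs1.fin_dim_independent_finite S B by blast
  have spB: "vs1.span B = S" using B S vs1.span_minimal by blast
  have key: "\<forall>b\<in>B - A. u b = 0" if "(\<Sum>b\<in>B - A. s2 (u b) (f b)) = 0" for u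
  proof -
    have "f (\<Sum>b\<in>B - A. s1 (u b) b) = 0" using that by (simp add: f.sum f.scale)
    moreover have "(\<Sum>b\<in>B - A. s1 (u b) b) \<in> S"
      using B S by (auto intro!: vs1.subspace_sum vs1.subspace_scale)
    ultimately have "(\<Sum>b\<in>B - A. s1 (u b) b) \<in> vs1.span A" using A by auto
    then obtain w where w: "(\<Sum>b\<in>B - A. s1 (u b) b) = (\<Sum>b\<in>A. s1 (w b) b)"
      unfolding vs1.span_finite[OF A(1)] by (elim imageE)
    let ?c = "\<lambda>b. if b \<in> A then - w b else u b"
    have "(\<Sum>b\<in>B. s1 (?c b) b) = (\<Sum>b\<in>B-A. s1 (?c b) b) + (\<Sum>b\<in>A. s1 (?c b) b)"
      by (rule sum.subset_diff[OF B(1) fB])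
    also have "\<dots> = 0" using w by (simp add: sum_negf)
    finally have "\<forall>b\<in>B. ?c b = 0"
      using vs1.independentD[OF B(3) fB subset_refl, of ?c] by blast
    then show ?thesis by (metis DiffD1 DiffD2)
  qed
  have inj: "inj_on f (B - A)"
  proof (rule inj_onI, rule ccontr)
    fix x y assume xy: "x \<in> B - A" "y \<in> B - A" "f x = f y" "x \<noteq> y"
    let ?u = "\<lambda>b. if b = x then (1::'a) else if b = y then - 1 else 0"
    have "(\<Sum>b\<in>B - A. s2 (?u b) (f b)) = (\<Sum>b\<in>{x,y}. s2 (?u b) (f b))"
      using xy fB by (intro sum.mono_neutral_right) auto
    also have "\<dots> = 0" using xy by simp
    finally have "?u x = 0" using key[of ?u] xy(1) by blast
    then show False by simp
  qed
  have ind: "vs2.independent (f ` (B - A))"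
  proof (rule vs2.independent_if_scalars_zero)
    show "finite (f ` (B - A))" using fB by simp
    fix u x assume "(\<Sum>x\<in>f ` (B - A). s2 (u x) x) = 0" "x \<in> f ` (B - A)"
    then show "u x = 0" using key[of "\<lambda>b. u (f b)"] by (auto simp: sum.reindex[OF inj])
  qed
  have "f ` S = vs2.span (f ` B)" using linear_span_image[OF lin, of B] spB by simp
  also have "\<dots> = vs2.span (f ` (B - A))"
  proof
    have "f ` B \<subseteq> insert 0 (f ` (B - A))" using A by auto
    then show "vs2.span (f ` B) \<subseteq> vs2.span (f ` (B - A))"
      using vs2.span_mono vs2.span_insert_0 by blast
    show "vs2.span (f ` (B - A)) \<subseteq> vs2.span (f ` B)" by (intro vs2.span_mono) auto
  qed
  finally have "vs2.dim (f ` S) = card (B - A)"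
    using vs2.dim_span_eq_card_independent[OF ind] card_image[OF inj] by simp
  moreover have "vs1.dim S = card B" using spB vs1.dim_span_eq_card_independent[OF B(3)] by simp
  moreover have "card B = card (B - A) + card A"
    using fB A(1) B(1) by (simp add: card_Diff_subset card_mono)
  ultimately show ?thesis using A by simp
qed

lemma dim_image_inj:
  assumes "Vector_Spaces.linear s1 s2 f" "vs1.subspace S" "vs1.fin_dim S" "\<And>x. x \<in> S \<Longrightarrow> f x = 0 \<Longrightarrow> x = 0"
  shows "vs2.dim (f ` S) = vs1.dim S"
proof -
  have "{x\<in>S. f x = 0} \<subseteq> vs1.span {}" using assms by auto
  then have "vs1.dim {x\<in>S. f x = 0} \<le> card ({}::'b set)" by (rule vs1.dim_le_card) simp
  then show ?thesis using rank_nullity[OF assms(1-3)] by simp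
qed

text \<open>Both quotients \<open>L / Q\<close> and \<open>f L / f Q\<close> are isomorphic, since the kernel of \<open>f\<close> lies in \<open>Q\<close>. Homology is
compared in this form throughout, by dimensions of subspaces.\<close>
lemma dim_diff_image:
  assumes "Vector_Spaces.linear s1 s2 f" "vs1.subspace L" "vs1.fin_dim L" "vs1.subspace Q" "Q \<subseteq> L"
    and "\<And>x. x \<in> L \<Longrightarrow> f x = 0 \<Longrightarrow> x \<in> Q"
  shows "vs1.dim L - vs1.dim Q = vs2.dim (f ` L) - vs2.dim (f ` Q)"
proof -
  have "{x\<in>Q. f x = 0} = {x\<in>L. f x = 0}" using assms by auto
  then show ?thesis
    using rank_nullity[OF assms(1-3)] rank_nullity[OF assms(1,4) vs1.fin_dim_subset[OF assms(3,5)]]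
    by simp
qed

text \<open>Used to extend the evaluation of a linear form on one summand by zero to the other summands.\<close>
lemma linear_extend_by_zero:
  assumes lin: "Vector_Spaces.linear s1 s2 f" and S: "vs1.subspace S" "vs1.fin_dim S"
    and T: "vs1.subspace T" "vs1.fin_dim T" and ST: "S \<inter> T \<subseteq> {0}"
  shows "\<exists>h. Vector_Spaces.linear s1 s2 h \<and> (\<forall>x\<in>S. h x = f x) \<and> (\<forall>x\<in>T. h x = 0)"
proof -
  obtain A where A: "finite A" "vs1.independent A" "A \<subseteq> S" "vs1.span A = S" "card A = vs1.dim S"
    by (rule vs1.fin_dim_basis[OF S(2,1)])
  obtain B where B: "finite B" "vs1.independent B" "B \<subseteq> T" "vs1.span B = T" "card B = vs1.dim T"
    by (rule vs1.fin_dim_basis[OF T(2,1)])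
  note Un = vs1.independent_Un_trivial_Int[OF S(1) T(1) ST A(1-3) B(1-3)]
  obtain h where h: "Vector_Spaces.linear s1 s2 h" "\<forall>x\<in>A \<union> B. h x = (if x \<in> A then f x else 0)"
    using linear_independent_extend[OF Un(2), of "\<lambda>x. if x \<in> A then f x else 0"] by (elim exE conjE)
  have "h x = f x" if "x \<in> S" for x
    by (rule linear_eq_on[OF h(1) lin, where B = A]) (use that A(4) h(2) in auto)
  moreover have "h x = 0" if "x \<in> T" for x
  proof (rule linear_eq_on[OF h(1) linear_zero, where B = B])
    show "x \<in> vs1.span B" using that B(4) by simp
    fix y assume "y \<in> B"
    then show "h y = 0" using Un(1) h(2) by auto
  qed
  ultimately show ?thesis using h(1) by blast
qed

end

section \<open>The Koszul complex of commuting operators\<close>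

lemma sum_fun_apply: "(\<Sum>i\<in>I. F i) x = (\<Sum>i\<in>I. F i x)"
  by (induction I rule: infinite_finite_induct) auto

text \<open>Koszul chains are functions on finite sets \<open>T\<close> of indices: the value at \<open>T\<close> is the coefficient of the
exterior monomial \<open>e\<^sub>T\<close>.\<close>
definition pointwise_scale :: "('k \<Rightarrow> 'a \<Rightarrow> 'a) \<Rightarrow> 'k \<Rightarrow> ('i \<Rightarrow> 'a) \<Rightarrow> 'i \<Rightarrow> 'a" where
  "pointwise_scale sc c u = (\<lambda>T. sc c (u T))"

lemma pointwise_scale_apply [simp]: "pointwise_scale sc c u T = sc c (u T)"
  by (simp add: pointwise_scale_def)

lemma vec_space_pointwise_scale:
  assumes "vec_space sc"
  shows "vec_space (pointwise_scale sc)"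
proof -
  interpret vec_space sc by fact
  show ?thesis
    by unfold_locales (auto simp: fun_eq_iff scale_right_distrib scale_left_distrib)
qed

context vec_space
begin

text \<open>The functions supported at one point of \<open>\<T>\<close> with value \<open>y\<close> there form a basis.\<close>
lemma dim_line_functions:
  fixes y :: 'b and \<T> :: "'i set"
  assumes "y \<noteq> 0" "finite \<T>"
  shows "vector_space.dim (pointwise_scale scale) {u :: 'i \<Rightarrow> 'b. \<forall>T. u T \<in> span {y} \<and> (u T \<noteq> 0 \<longrightarrow> T \<in> \<T>)} = card \<T>"
proof -
  interpret chain: vec_space "pointwise_scale scale :: 'a \<Rightarrow> ('i \<Rightarrow> 'b) \<Rightarrow> _" by (rule vec_space_pointwise_scale) unfold_locales
  let ?e = "\<lambda>T T'. if T' = T then y else 0"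
  let ?S = "{u :: 'i \<Rightarrow> 'b. \<forall>T. u T \<in> span {y} \<and> (u T \<noteq> 0 \<longrightarrow> T \<in> \<T>)}"
  have inj: "inj_on ?e \<T>" 
  proof (rule inj_onI)
    fix T T' assume "?e T = ?e T'"
    then have "?e T T = ?e T' T" by (rule fun_cong)
    then show "T = T'" using assms(1) by (auto split: if_splits)
  qed
  have ev: "(\<Sum>T\<in>\<T>. pointwise_scale scale (c T) (?e T)) T' = (if T' \<in> \<T> then scale (c T') y else 0)" for c T'
  proof -
    have "(\<Sum>T\<in>\<T>. pointwise_scale scale (c T) (?e T)) T' = (\<Sum>T\<in>\<T>. if T' = T then scale (c T) y else 0)"
      unfolding sum_fun_apply by (intro sum.cong) auto
    also have "\<dots> = (if T' \<in> \<T> then scale (c T') y else 0)" using assms(2) by simp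
    finally show ?thesis .
  qed
  have ind: "chain.independent (?e ` \<T>)"
  proof (rule chain.independent_if_scalars_zero)
    show "finite (?e ` \<T>)" using assms(2) by simp
    fix c w assume s: "(\<Sum>w\<in>?e ` \<T>. pointwise_scale scale (c w) w) = 0" and w: "w \<in> ?e ` \<T>"
    have "(\<Sum>w\<in>?e ` \<T>. pointwise_scale scale (c w) w) = (\<Sum>T\<in>\<T>. pointwise_scale scale (c (?e T)) (?e T))"
      by (rule sum.reindex[OF inj, unfolded o_def])
    then have s0: "(\<Sum>T\<in>\<T>. pointwise_scale scale (c (?e T)) (?e T)) = 0" using s by simp
    obtain T where T: "T \<in> \<T>" "w = ?e T" using w by blast
    have "scale (c (?e T)) y = 0" using fun_cong[OF s0, of T] T(1) ev[of "\<lambda>T. c (?e T)" T] by simp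
    then show "c w = 0" using assms(1) T(2) by simp
  qed
  have sub: "chain.subspace ?S"
  proof (rule chain.subspaceI)
    fix u w assume uw: "u \<in> ?S" "w \<in> ?S"
    have "(u + w) T \<noteq> 0 \<Longrightarrow> u T \<noteq> 0 \<or> w T \<noteq> 0" for T by auto
    then show "u + w \<in> ?S" using uw by (auto intro: span_add)
  qed (auto intro: span_zero span_scale)
  have "?S \<subseteq> chain.span (?e ` \<T>)"
  proof
    fix u assume u: "u \<in> ?S"
    have "\<forall>T. \<exists>c. u T = scale c y" using u by (auto simp: span_singleton)
    then obtain c where c: "\<And>T. u T = scale (c T) y" by metis
    have "u = (\<Sum>T\<in>\<T>. pointwise_scale scale (c T) (?e T))"
    proof (rule ext)
      fix T'
      have "u T' \<noteq> 0 \<Longrightarrow> T' \<in> \<T>" using u by blast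
      then have "u T' = (if T' \<in> \<T> then scale (c T') y else 0)" using c[of T'] by metis
      then show "u T' = (\<Sum>T\<in>\<T>. pointwise_scale scale (c T) (?e T)) T'" by (simp only: ev)
    qed
    also have "\<dots> \<in> chain.span (?e ` \<T>)" by (intro chain.span_sum chain.span_scale chain.span_base imageI)
    finally show "u \<in> chain.span (?e ` \<T>)" .
  qed
  moreover have "?e ` \<T> \<subseteq> ?S" by (auto intro: span_base span_zero split: if_splits)
  then have "chain.span (?e ` \<T>) \<subseteq> ?S" using sub by (rule chain.span_minimal)
  ultimately have "?S = chain.span (?e ` \<T>)" by blast
  then have "chain.dim ?S = card (?e ` \<T>)" using chain.dim_span_eq_card_independent[OF ind] by simp
  then show ?thesis using card_image[OF inj] by simp
qed

end

text \<open>The contribution of the index \<open>m\<close> to the Koszul differential: contraction against \<open>e\<^sub>m\<close> followed by the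
operator \<open>X m\<close>. The sign counts the indices in \<open>T\<close> below \<open>m\<close>.\<close>
definition koszul_d_step :: "(nat \<Rightarrow> 'a \<Rightarrow> 'a::ab_group_add) \<Rightarrow> nat \<Rightarrow> (nat set \<Rightarrow> 'a) \<Rightarrow> nat set \<Rightarrow> 'a" where
  "koszul_d_step X m u = (\<lambda>T. if m \<in> T then 0
     else if even (card (T \<inter> {..<m})) then X m (u (insert m T)) else - X m (u (insert m T)))"

text \<open>The differential for the operators \<open>X 0, \<dots>, X (m - 1)\<close>. It acts on arbitrary functions of \<open>T\<close>, also for
\<open>T\<close> with elements beyond \<open>m\<close>, so that the complex for \<open>m + 1\<close> operators is the cone of \<open>X m\<close> on the complex
for \<open>m\<close> operators and induction on \<open>m\<close> applies.\<close>
primrec koszul_d :: "(nat \<Rightarrow> 'a \<Rightarrow> 'a::ab_group_add) \<Rightarrow> nat \<Rightarrow> (nat set \<Rightarrow> 'a) \<Rightarrow> nat set \<Rightarrow> 'a" where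
  "koszul_d X 0 u = 0"
| "koszul_d X (Suc m) u = koszul_d X m u + koszul_d_step X m u"

definition koszul_chains :: "nat \<Rightarrow> nat \<Rightarrow> 'a set \<Rightarrow> (nat set \<Rightarrow> 'a::zero) set" where
  "koszul_chains m p N = {u. \<forall>T. u T \<in> N \<and> (u T \<noteq> 0 \<longrightarrow> T \<subseteq> {..<m} \<and> card T = p)}"

definition koszul_cycles :: "(nat \<Rightarrow> 'a \<Rightarrow> 'a::ab_group_add) \<Rightarrow> nat \<Rightarrow> nat \<Rightarrow> 'a set \<Rightarrow> (nat set \<Rightarrow> 'a) set" where
  "koszul_cycles X m p N = {u \<in> koszul_chains m p N. koszul_d X m u = 0}"

definition koszul_boundaries :: "(nat \<Rightarrow> 'a \<Rightarrow> 'a::ab_group_add) \<Rightarrow> nat \<Rightarrow> nat \<Rightarrow> 'a set \<Rightarrow> (nat set \<Rightarrow> 'a) set" where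
  "koszul_boundaries X m p N = koszul_d X m ` koszul_chains m (Suc p) N"

text \<open>The dimension of the Koszul homology of the graded module \<open>M\<close> at \<open>\<Lambda>\<^bsup>p\<^esup> \<otimes> M e\<close>. Degrees are integers, so that
\<open>M (e - 1)\<close> makes sense for \<open>e = 0\<close>.\<close>
definition koszul_dim :: "('k::field \<Rightarrow> 'a \<Rightarrow> 'a) \<Rightarrow> (nat \<Rightarrow> 'a \<Rightarrow> 'a::ab_group_add) \<Rightarrow> nat \<Rightarrow> nat \<Rightarrow> (int \<Rightarrow> 'a set) \<Rightarrow> int \<Rightarrow> nat" where
  "koszul_dim sc X m p M e = vector_space.dim (pointwise_scale sc) (koszul_cycles X m p (M e))
     - vector_space.dim (pointwise_scale sc) (koszul_boundaries X m p (M (e - 1)))"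

text \<open>Only the action of finitely many commuting operators matters for the Koszul complex. In the applications they
are linear forms that act on polynomials, on free modules or on divided powers.\<close>
locale commuting_ops = vec_space scale
  for scale :: "'k::field \<Rightarrow> 'a::ab_group_add \<Rightarrow> 'a" +
  fixes X :: "nat \<Rightarrow> 'a \<Rightarrow> 'a"
  assumes X_add: "X v (x + y) = X v x + X v y"
    and X_scale: "X v (scale c x) = scale c (X v x)"
    and X_commute: "X v (X w x) = X w (X v x)"
begin

sublocale chain: vec_space "pointwise_scale scale :: 'k \<Rightarrow> (nat set \<Rightarrow> 'a) \<Rightarrow> _"
  by (rule vec_space_pointwise_scale) unfold_locales

lemma X_zero [simp]: "X v 0 = 0"
  using X_add[of v 0 0] by simp

lemma X_minus: "X v (- x) = - X v x"
  using X_add[of v x "- x"] by (simp add: eq_neg_iff_add_eq_0 add.commute)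

lemma koszul_d_add: "koszul_d X m (u + w) = koszul_d X m u + koszul_d X m w"
  by (induction m) (auto simp: fun_eq_iff koszul_d_step_def X_add algebra_simps)

lemma koszul_d_scale: "koszul_d X m (pointwise_scale scale c u) = pointwise_scale scale c (koszul_d X m u)"
  by (induction m) (auto simp: fun_eq_iff koszul_d_step_def X_scale scale_right_distrib)

lemma koszul_d_linear: "Vector_Spaces.linear (pointwise_scale scale) (pointwise_scale scale) (koszul_d X m)"
  using koszul_d_add koszul_d_scale by unfold_locales auto

lemma koszul_d_zero [simp]: "koszul_d X m 0 = 0"
  using koszul_d_add[of m 0 0] by simp

lemma koszul_d_minus: "koszul_d X m (- u) = - koszul_d X m u"
  using koszul_d_add[of m u "- u"] by (simp add: eq_neg_iff_add_eq_0 add.commute)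

lemma koszul_d_step_add: "koszul_d_step X m (u + w) = koszul_d_step X m u + koszul_d_step X m w"
  by (auto simp: fun_eq_iff X_add koszul_d_step_def)

lemma card_insert_below:
  fixes q m :: nat
  assumes "q < m" "q \<notin> T"
  shows "card (insert q T \<inter> {..<m}) = Suc (card (T \<inter> {..<m}))"
proof -
  have "insert q T \<inter> {..<m} = insert q (T \<inter> {..<m})" "finite (T \<inter> {..<m})" "q \<notin> T \<inter> {..<m}"
    using assms by auto
  then show ?thesis by simp
qed

lemma insert_above: "(q::nat) < m \<Longrightarrow> insert m T \<inter> {..<q} = T \<inter> {..<q}"
  by auto

lemma koszul_d_step_anticommute:
  assumes "q < m"
  shows "koszul_d_step X q (koszul_d_step X m u) = - koszul_d_step X m (koszul_d_step X q u)"
  using assms X_commute[of q m]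
  by (auto simp: fun_eq_iff koszul_d_step_def card_insert_below insert_above X_minus insert_commute[of q m])

text \<open>Moving the step for \<open>m\<close> past the steps for smaller indices changes the sign, as \<open>m\<close> has one more index below
it afterwards.\<close>
lemma koszul_d_step_anticommute_koszul_d: "q \<le> m \<Longrightarrow> koszul_d X q (koszul_d_step X m u) = - koszul_d_step X m (koszul_d X q u)"
proof (induction q)
  case 0
  then show ?case by (auto simp: fun_eq_iff koszul_d_step_def)
next
  case (Suc q)
  have "koszul_d X (Suc q) (koszul_d_step X m u) = koszul_d X q (koszul_d_step X m u) + koszul_d_step X q (koszul_d_step X m u)" by simp
  also have "\<dots> = - koszul_d_step X m (koszul_d X q u) - koszul_d_step X m (koszul_d_step X q u)"
    using Suc koszul_d_step_anticommute[of q m u] by (simp add: fun_eq_iff)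
  also have "\<dots> = - koszul_d_step X m (koszul_d X q u + koszul_d_step X q u)" by (simp only: koszul_d_step_add) (simp add: fun_eq_iff)
  finally show ?case by (simp only: koszul_d.simps)
qed

lemma koszul_d_koszul_d: "koszul_d X m (koszul_d X m u) = 0"
proof (induction m)
  case (Suc m)
  have "koszul_d X (Suc m) (koszul_d X (Suc m) u) = koszul_d X m (koszul_d X m u) + koszul_d X m (koszul_d_step X m u) 
      + (koszul_d_step X m (koszul_d X m u) + koszul_d_step X m (koszul_d_step X m u))"
    by (simp only: koszul_d.simps koszul_d_add koszul_d_step_add)
  moreover have "koszul_d_step X m (koszul_d_step X m u) = 0" by (auto simp: fun_eq_iff koszul_d_step_def)
  ultimately show ?case using Suc koszul_d_step_anticommute_koszul_d[of m m u] by (simp only:) (simp add: fun_eq_iff)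
qed simp

lemma koszul_chains_mono: "N \<subseteq> N' \<Longrightarrow> koszul_chains m p N \<subseteq> koszul_chains m p N'"
  unfolding koszul_chains_def by auto

lemma koszul_chainsI:
  assumes "\<And>T. u T \<in> N" "\<And>T. u T \<noteq> 0 \<Longrightarrow> T \<subseteq> {..<m} \<and> card T = p"
  shows "u \<in> koszul_chains m p N"
  using assms unfolding koszul_chains_def by auto

lemma koszul_chainsD:
  "u \<in> koszul_chains m p N \<Longrightarrow> u T \<in> N"
  "u \<in> koszul_chains m p N \<Longrightarrow> u T \<noteq> 0 \<Longrightarrow> T \<subseteq> {..<m} \<and> card T = p"
  unfolding koszul_chains_def by auto

lemma koszul_chains_subspace:
  assumes "subspace N"
  shows "chain.subspace (koszul_chains m p N)"
proof (rule chain.subspaceI)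
  show "0 \<in> koszul_chains m p N" using assms by (intro koszul_chainsI) (auto simp: subspace_0)
next
  fix u w assume u: "u \<in> koszul_chains m p N" and w: "w \<in> koszul_chains m p N"
  show "u + w \<in> koszul_chains m p N"
  proof (rule koszul_chainsI)
    fix T
    show "(u + w) T \<in> N" using koszul_chainsD(1)[OF u] koszul_chainsD(1)[OF w] assms by (simp add: subspace_add)
    assume "(u + w) T \<noteq> 0"
    then have "u T \<noteq> 0 \<or> w T \<noteq> 0" by auto
    then show "T \<subseteq> {..<m} \<and> card T = p" using koszul_chainsD(2)[OF u] koszul_chainsD(2)[OF w] by blast
  qed
next
  fix c u assume u: "u \<in> koszul_chains m p N"
  show "pointwise_scale scale c u \<in> koszul_chains m p N"
  proof (rule koszul_chainsI)
    fix T
    show "pointwise_scale scale c u T \<in> N" using koszul_chainsD(1)[OF u] assms by (simp add: subspace_scale)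
    assume "pointwise_scale scale c u T \<noteq> 0"
    then have "u T \<noteq> 0" by auto
    then show "T \<subseteq> {..<m} \<and> card T = p" using koszul_chainsD(2)[OF u] by blast
  qed
qed

lemma koszul_d_step_chains:
  assumes "u \<in> koszul_chains m (Suc p) N" "v < m" "subspace N'" "\<And>x. x \<in> N \<Longrightarrow> X v x \<in> N'"
  shows "koszul_d_step X v u \<in> koszul_chains m p N'"
proof (rule koszul_chainsI)
  fix T
  show "koszul_d_step X v u T \<in> N'"
    using assms(3,4) koszul_chainsD(1)[OF assms(1)] by (auto simp: koszul_d_step_def subspace_0 subspace_neg)
  assume nz: "koszul_d_step X v u T \<noteq> 0"
  then have v: "v \<notin> T" "u (insert v T) \<noteq> 0" by (auto simp: koszul_d_step_def split: if_splits)
  then have "insert v T \<subseteq> {..<m} \<and> card (insert v T) = Suc p" using koszul_chainsD(2)[OF assms(1)] by blast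
  then show "T \<subseteq> {..<m} \<and> card T = p" using v finite_subset[of T "{..<m}"] by auto
qed

lemma koszul_d_chains:
  assumes "u \<in> koszul_chains m (Suc p) N" "q \<le> m" "subspace N'" "\<And>v x. v < q \<Longrightarrow> x \<in> N \<Longrightarrow> X v x \<in> N'"
  shows "koszul_d X q u \<in> koszul_chains m p N'"
  using assms(2,4)
proof (induction q)
  case 0
  then show ?case using assms(3) by (auto intro: koszul_chainsI simp: subspace_0)
next
  case (Suc q)
  then show ?case using koszul_d_step_chains[OF assms(1), of q N'] assms(3)
      chain.subspace_add[OF koszul_chains_subspace[OF assms(3)], of "koszul_d X q u" m p "koszul_d_step X q u"]
    by (simp del: plus_fun_apply)
qed

lemma koszul_d_chains_0: "u \<in> koszul_chains m 0 N \<Longrightarrow> q \<le> m \<Longrightarrow> koszul_d X q u = 0"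
proof (induction q)
  case (Suc q)
  have "u (insert q T) = 0" for T
  proof (rule ccontr)
    assume "u (insert q T) \<noteq> 0"
    then have "insert q T \<subseteq> {..<m}" "card (insert q T) = 0" using koszul_chainsD(2)[OF Suc.prems(1)] by blast+
    then show False using finite_subset[of "insert q T" "{..<m}"] by auto
  qed
  then show ?case using Suc by (auto simp: fun_eq_iff koszul_d_step_def)
qed simp

lemma koszul_d_empty: "koszul_d X m w {} = (\<Sum>v<m. X v (w {v}))"
  by (induction m) (auto simp: koszul_d_step_def)

lemma koszul_d_sum: "koszul_d X m u T = (\<Sum>v<m. if v \<in> T then 0
    else if even (card (T \<inter> {..<v})) then X v (u (insert v T)) else - X v (u (insert v T)))"
  by (induction m) (auto simp: koszul_d_step_def)

lemma koszul_d_X: "koszul_d X m (\<lambda>T. X v (u T)) = (\<lambda>T. X v (koszul_d X m u T))"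
proof (induction m)
  case (Suc m)
  show ?case by (simp add: Suc fun_eq_iff koszul_d_step_def X_add X_minus X_commute[of v m])
qed (auto simp: fun_eq_iff)

lemma koszul_d_eq_0: "(\<And>T v. v < m \<Longrightarrow> v \<notin> T \<Longrightarrow> X v (u (insert v T)) = 0) \<Longrightarrow> koszul_d X m u = 0"
  by (induction m) (auto simp: fun_eq_iff koszul_d_step_def)

lemma koszul_d_eq_0_at: "(\<And>v. v < m \<Longrightarrow> v \<notin> T \<Longrightarrow> X v (u (insert v T)) = 0) \<Longrightarrow> koszul_d X m u T = 0"
  by (induction m) (auto simp: fun_eq_iff koszul_d_step_def)

definition graded_module :: "nat \<Rightarrow> (int \<Rightarrow> 'a set) \<Rightarrow> bool" where
  "graded_module m M \<longleftrightarrow> (\<forall>e. subspace (M e) \<and> fin_dim (M e)) \<and> (\<forall>v<m. \<forall>e. \<forall>x\<in>M e. X v x \<in> M (e + 1))"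

text \<open>If \<open>N\<close> is a component of a graded module \<open>M\<close>, this is the next component of the submodule
\<open>(X 0, \<dots>, X (k - 1)) M\<close>.\<close>
definition op_sum :: "nat \<Rightarrow> 'a set \<Rightarrow> 'a set" where
  "op_sum k N = {\<Sum>v<k. X v (q v) |q. \<forall>v<k. q v \<in> N}"

lemma op_sumI: "x = (\<Sum>v<k. X v (q v)) \<Longrightarrow> (\<And>v. v < k \<Longrightarrow> q v \<in> N) \<Longrightarrow> x \<in> op_sum k N"
  unfolding op_sum_def by (intro CollectI exI[of _ q]) auto

lemma op_sumE:
  assumes "x \<in> op_sum k N"
  obtains q where "x = (\<Sum>v<k. X v (q v))" "\<forall>v<k. q v \<in> N"
  using assms unfolding op_sum_def by blast

text \<open>The operator \<open>X k\<close> is injective modulo the image of the operators before it, stated degree by degree.\<close>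
definition regular_seq :: "nat \<Rightarrow> (int \<Rightarrow> 'a set) \<Rightarrow> bool" where
  "regular_seq m M \<longleftrightarrow> (\<forall>k<m. \<forall>e. \<forall>y\<in>M e. X k y \<in> op_sum k (M e) \<longrightarrow> y \<in> op_sum k (M (e - 1)))"

lemma graded_moduleD: "graded_module m M \<Longrightarrow> subspace (M e)" "graded_module m M \<Longrightarrow> fin_dim (M e)"
  "graded_module m M \<Longrightarrow> v < m \<Longrightarrow> x \<in> M e \<Longrightarrow> X v x \<in> M (e + 1)"
  "graded_module m M \<Longrightarrow> v < m \<Longrightarrow> x \<in> M (e - 1) \<Longrightarrow> X v x \<in> M e"
proof -
  show 1: "graded_module m M \<Longrightarrow> v < m \<Longrightarrow> x \<in> M e \<Longrightarrow> X v x \<in> M (e + 1)" for e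
    unfolding graded_module_def by blast
  show "graded_module m M \<Longrightarrow> v < m \<Longrightarrow> x \<in> M (e - 1) \<Longrightarrow> X v x \<in> M e"
    using 1[of "e - 1"] by simp
qed (auto simp: graded_module_def)

text \<open>Multiplication by \<open>e\<^sub>m\<close>.\<close>
definition adjoin :: "nat \<Rightarrow> (nat set \<Rightarrow> 'a) \<Rightarrow> nat set \<Rightarrow> 'a" where
  "adjoin m w = (\<lambda>T. if m \<in> T then w (T - {m}) else 0)"

lemma koszul_d_adjoin: "q \<le> m \<Longrightarrow> koszul_d X q (adjoin m w) = adjoin m (koszul_d X q w)"
proof (induction q)
  case 0
  then show ?case by (auto simp: adjoin_def fun_eq_iff)
next
  case (Suc q)
  have "insert q (T - {m}) = insert q T - {m}" "(T - {m}) \<inter> {..<q} = T \<inter> {..<q}" for T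
    using Suc.prems by auto
  then have "koszul_d_step X q (adjoin m w) = adjoin m (koszul_d_step X q w)"
    using Suc.prems by (auto simp: fun_eq_iff adjoin_def koszul_d_step_def)
  moreover have "adjoin m (a + b) = adjoin m a + adjoin m b" for a b by (auto simp: adjoin_def fun_eq_iff)
  ultimately show ?case using Suc by (simp del: plus_fun_apply)
qed

text \<open>Induction on the number of operators. A chain is \<open>u1 + e\<^sub>k u2\<close> with \<open>u1\<close> and \<open>u2\<close> free of \<open>e\<^sub>k\<close>, and it is a
cycle iff \<open>u2\<close> is a cycle and \<open>d u1 \<plusminus> X\<^sub>k u2 = 0\<close>. So \<open>u2\<close> is a boundary \<open>d w2\<close>, by induction, or by
regularity if it has homological degree \<open>0\<close>. Then \<open>u1 \<plusminus> X\<^sub>k w2\<close> is a cycle and the induction hypothesis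
applies again.\<close>
theorem koszul_exact:
  assumes "graded_module m M" "regular_seq m M"
  shows "u \<in> koszul_chains k (Suc p) (M e) \<Longrightarrow> koszul_d X k u = 0 \<Longrightarrow> k \<le> m \<Longrightarrow>
     \<exists>w\<in>koszul_chains k (Suc (Suc p)) (M (e - 1)). koszul_d X k w = u"
proof (induction k arbitrary: p e u)
  case 0
  have "u T = 0" for T
  proof (rule ccontr)
    assume "u T \<noteq> 0"
    then have "T \<subseteq> {..<0}" "card T = Suc p" using koszul_chainsD(2)[OF 0(1)] by blast+
    then show False by simp
  qed
  then have "u = 0" by (auto simp: fun_eq_iff)
  moreover have "0 \<in> koszul_chains 0 (Suc (Suc p)) (M (e - 1))"
    using graded_moduleD(1)[OF assms(1)] by (auto intro!: koszul_chainsI simp: subspace_0)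
  ultimately show ?case by force
next
  case (Suc k)
  note sub = graded_moduleD(1)[OF assms(1)] and XM = graded_moduleD(3,4)[OF assms(1)]
  have k: "k < m" "k \<le> m" using Suc.prems by auto
  define u1 where "u1 = (\<lambda>T. if k \<in> T then 0 else u T)"
  define u2 where "u2 = (\<lambda>T. if k \<in> T then 0 else u (insert k T))"
  have u: "u = u1 + adjoin k u2" by (auto simp: u1_def u2_def adjoin_def fun_eq_iff insert_absorb)
  have u1: "u1 \<in> koszul_chains k (Suc p) (M e)"
  proof (rule koszul_chainsI)
    fix T
    show "u1 T \<in> M e" using koszul_chainsD(1)[OF Suc.prems(1)] sub by (auto simp: u1_def subspace_0)
    assume "u1 T \<noteq> 0"
    then have "k \<notin> T" "u T \<noteq> 0" by (auto simp: u1_def split: if_splits)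
    then show "T \<subseteq> {..<k} \<and> card T = Suc p"
      using koszul_chainsD(2)[OF Suc.prems(1), of T] by (auto simp: less_Suc_eq)
  qed
  have u2: "u2 \<in> koszul_chains k p (M e)"
  proof (rule koszul_chainsI)
    fix T
    show "u2 T \<in> M e" using koszul_chainsD(1)[OF Suc.prems(1)] sub by (auto simp: u2_def subspace_0)
    assume "u2 T \<noteq> 0"
    then have nk: "k \<notin> T" "u (insert k T) \<noteq> 0" by (auto simp: u2_def split: if_splits)
    then have *: "insert k T \<subseteq> {..<Suc k}" "card (insert k T) = Suc p"
      using koszul_chainsD(2)[OF Suc.prems(1), of "insert k T"] by auto
    then show "T \<subseteq> {..<k} \<and> card T = p"
      using nk finite_subset[of T "{..<Suc k}"] by (auto simp: less_Suc_eq)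
  qed
  define X' where "X' = (\<lambda>(w :: nat set \<Rightarrow> 'a) T. X k (w T))"
  have X'_chains: "X' w \<in> koszul_chains k q (M e)" if "w \<in> koszul_chains k q (M (e - 1))" for w q e
  proof (rule koszul_chainsI)
    fix T
    show "X' w T \<in> M e" using XM(2)[OF k(1)] koszul_chainsD(1)[OF that] by (simp add: X'_def)
    assume "X' w T \<noteq> 0"
    then have "w T \<noteq> 0" by (auto simp: X'_def)
    then show "T \<subseteq> {..<k} \<and> card T = q" using koszul_chainsD(2)[OF that] by blast
  qed
  have X'_kd: "koszul_d X k (X' w) = X' (koszul_d X k w)" for w
    unfolding X'_def by (rule koszul_d_X)
  have ke0: "koszul_d_step X k w = 0" if "w \<in> koszul_chains k q N" for w q N
  proof -
    have "w (insert k T) = 0" for T using koszul_chainsD(2)[OF that, of "insert k T"] by auto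
    then show ?thesis by (auto simp: fun_eq_iff koszul_d_step_def)
  qed
  have kej: "koszul_d_step X k (adjoin k w) = (if even q then X' w else - X' w)" if "w \<in> koszul_chains k q N" for w q N
  proof -
    have "koszul_d_step X k (adjoin k w) T = (if even q then X' w else - X' w) T" for T
    proof (cases "w T = 0")
      case True
      have "k \<in> T \<Longrightarrow> X' w T = 0" using True by (simp add: X'_def)
      then show ?thesis using True by (simp add: adjoin_def koszul_d_step_def X'_def insert_Diff_if)
    next
      case False
      then have T: "T \<subseteq> {..<k}" "card T = q" using koszul_chainsD(2)[OF that] by blast+
      then have "k \<notin> T" "T \<inter> {..<k} = T" by auto
      then show ?thesis using T by (simp add: adjoin_def X'_def koszul_d_step_def)
    qed
    then show ?thesis by blast
  qed
  \<comment> \<open>All sets in the support of a chain of degree \<open>p\<close> have \<open>p\<close> elements, so the sign of the step for \<open>k\<close> is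
  constant on chains without \<open>e\<^sub>k\<close>.\<close>
  define s where "s w = (if even p then X' w else - X' w)" for w
  have s_koszul_d: "koszul_d X k (s w) = s (koszul_d X k w)" for w
    by (simp add: s_def X'_kd koszul_d_minus)
  have s_chains: "s w \<in> koszul_chains k q (M e)" if "w \<in> koszul_chains k q (M (e - 1))" for w q e
    using X'_chains[OF that] chain.subspace_neg[OF koszul_chains_subspace[OF sub]] by (auto simp: s_def)
  have du: "koszul_d X (Suc k) u = (koszul_d X k u1 + s u2) + adjoin k (koszul_d X k u2)"
  proof -
    have "koszul_d X (Suc k) u = koszul_d X k u1 + koszul_d X k (adjoin k u2) + (koszul_d_step X k u1 + koszul_d_step X k (adjoin k u2))"
      by (simp only: koszul_d.simps u koszul_d_add koszul_d_step_add)
    then show ?thesis using ke0[OF u1] kej[OF u2] koszul_d_adjoin[of k k u2] by (simp add: s_def)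
  qed
  have kd2: "koszul_d X k u2 T = 0" if "k \<in> T" for T
    by (rule koszul_d_eq_0_at) (use that u2_def in auto)
  have kd1: "koszul_d X k u1 T = 0" if "k \<in> T" for T
    by (rule koszul_d_eq_0_at) (use that u1_def in auto)
  have c1: "koszul_d X k u2 = 0"
  proof (rule ext)
    fix T
    show "koszul_d X k u2 T = 0 T"
    proof (cases "k \<in> T")
      case False
      have "koszul_d X (Suc k) u (insert k T) = 0" using fun_cong[OF Suc.prems(2), of "insert k T"] by (simp del: koszul_d.simps)
      then have "s u2 (insert k T) + koszul_d X k u2 T = 0"
        using False kd1[of "insert k T"] by (simp only: du) (simp add: adjoin_def)
      moreover have "u2 (insert k T) = 0" by (simp add: u2_def)
      ultimately show ?thesis by (cases "even p") (simp_all add: s_def X'_def)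
    qed (simp add: kd2)
  qed
  then have c2: "koszul_d X k u1 + s u2 = 0"
  proof -
    have "adjoin k (koszul_d X k u2) = 0" using c1 by (auto simp: adjoin_def fun_eq_iff)
    then show ?thesis using du Suc.prems(2) by (simp only: add_0_right)
  qed
  have "\<exists>w2\<in>koszul_chains k (Suc p) (M (e - 1)). koszul_d X k w2 = u2"
  proof (cases p)
    case (Suc p')
    then show ?thesis using Suc.IH[of u2 p' e] u2 c1 k by simp
  next
    case 0
    have u2T: "u2 T = 0" if "T \<noteq> {}" for T
    proof (rule ccontr)
      assume "u2 T \<noteq> 0"
      then have "T \<subseteq> {..<k}" "card T = 0" using koszul_chainsD(2)[OF u2] 0 by auto
      then show False using that finite_subset[of T "{..<k}"] by auto
    qed
    have "X k (u2 {}) = - koszul_d X k u1 {}"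
      using fun_cong[OF c2, of "{}"] 0 by (simp add: s_def X'_def eq_neg_iff_add_eq_0 add.commute)
    also have "\<dots> = (\<Sum>v<k. X v (- u1 {v}))" by (simp add: koszul_d_empty X_minus sum_negf)
    finally have "X k (u2 {}) = (\<Sum>v<k. X v (- u1 {v}))" .
    then have "X k (u2 {}) \<in> op_sum k (M e)"
      by (rule op_sumI) (use koszul_chainsD(1)[OF u1] sub subspace_neg in blast)
    then have "u2 {} \<in> op_sum k (M (e - 1))"
      using assms(2) k(1) koszul_chainsD(1)[OF u2] unfolding regular_seq_def by blast
    then obtain q where q: "u2 {} = (\<Sum>v<k. X v (q v))" "\<forall>v<k. q v \<in> M (e - 1)"
      unfolding op_sum_def by blast
    \<comment> \<open>The chain \<open>\<Sum>\<^sub>v q\<^sub>v e\<^sub>v\<close>, whose boundary is \<open>\<Sum>\<^sub>v X\<^sub>v q\<^sub>v\<close>.\<close>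
    define w where "w T = (if \<exists>v<k. T = {v} then q (THE v. T = {v}) else 0)" for T
    have wv: "w {v} = q v" if "v < k" for v using that by (auto simp: w_def)
    have w: "w \<in> koszul_chains k (Suc p) (M (e - 1))"
      using q(2) sub 0 by (intro koszul_chainsI) (auto simp: w_def subspace_0 split: if_splits)
    have "koszul_d X k w = u2"
    proof (rule ext)
      fix T
      show "koszul_d X k w T = u2 T"
      proof (cases "T = {}")
        case True
        then show ?thesis using q(1) wv by (simp add: koszul_d_empty)
      next
        case False
        have "koszul_d X k w T = 0"
        proof (rule koszul_d_eq_0_at)
          fix v assume "v \<notin> T"
          then have "\<not> (\<exists>v'. insert v T = {v'})" using False by auto
          then show "X v (w (insert v T)) = 0" by (auto simp: w_def)
        qed
        then show ?thesis using u2T False by simp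
      qed
    qed
    then show ?thesis using w by blast
  qed
  then obtain w2 where w2: "w2 \<in> koszul_chains k (Suc p) (M (e - 1))" "koszul_d X k w2 = u2" by blast
  have "koszul_d X k (u1 + s w2) = 0" using c2 w2 by (simp add: koszul_d_add s_koszul_d)
  moreover have "u1 + s w2 \<in> koszul_chains k (Suc p) (M e)"
    using u1 s_chains[OF w2(1)] chain.subspace_add[OF koszul_chains_subspace[OF sub]] by blast
  ultimately obtain w1 where w1: "w1 \<in> koszul_chains k (Suc (Suc p)) (M (e - 1))" "koszul_d X k w1 = u1 + s w2"
    using Suc.IH[of "u1 + s w2" p e] k by blast
  have "koszul_d X (Suc k) (w1 + adjoin k w2) = koszul_d X k w1 + koszul_d X k (adjoin k w2) + (koszul_d_step X k w1 + koszul_d_step X k (adjoin k w2))"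
    by (simp only: koszul_d.simps koszul_d_add koszul_d_step_add)
  also have "\<dots> = u"
    using ke0[OF w1(1)] kej[OF w2(1)] koszul_d_adjoin[of k k w2] w1(2) w2(2) u by (simp add: s_def)
  finally have "koszul_d X (Suc k) (w1 + adjoin k w2) = u" .
  moreover have "w1 + adjoin k w2 \<in> koszul_chains (Suc k) (Suc (Suc p)) (M (e - 1))"
  proof (rule koszul_chainsI)
    fix T
    show "(w1 + adjoin k w2) T \<in> M (e - 1)"
      using koszul_chainsD(1)[OF w1(1)] koszul_chainsD(1)[OF w2(1)] sub by (auto simp: adjoin_def subspace_add)
    assume nz: "(w1 + adjoin k w2) T \<noteq> 0"
    show "T \<subseteq> {..<Suc k} \<and> card T = Suc (Suc p)"
    proof (cases "w1 T = 0")
      case True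
      then have kT: "k \<in> T" "w2 (T - {k}) \<noteq> 0" using nz by (auto simp: adjoin_def split: if_splits)
      then have "T - {k} \<subseteq> {..<k}" "card (T - {k}) = Suc p" using koszul_chainsD(2)[OF w2(1)] by blast+
      moreover have "finite (T - {k})" using calculation(1) finite_subset by blast
      ultimately show ?thesis using kT(1)
        by (metis card_insert_disjoint Diff_iff insert_Diff insertI1 insert_mono lessThan_Suc)
    next
      case False
      then show ?thesis using koszul_chainsD(2)[OF w1(1), of T] by (auto simp: less_Suc_eq)
    qed
  qed
  ultimately show ?case by blast
qed

end

context commuting_ops
begin

lemma delta_linear: "Vector_Spaces.linear scale (pointwise_scale scale) (\<lambda>b T'. if T' = T then b else 0)"
  by unfold_locales (auto simp: fun_eq_iff scale_right_distrib scale_left_distrib)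

lemma koszul_chains_fin_dim:
  assumes "fin_dim N"
  shows "chain.fin_dim (koszul_chains m p N)"
proof -
  interpret P: vec_space_pair scale "pointwise_scale scale :: 'k \<Rightarrow> (nat set \<Rightarrow> 'a) \<Rightarrow> _" ..
  obtain B where B: "finite B" "N \<subseteq> span B" using assms by (auto simp: fin_dim_def)
  let ?e = "\<lambda>T b T'. if T' = T then b else (0::'a)"
  let ?E = "\<Union>T\<in>Pow {..<m}. ?e T ` B"
  have "koszul_chains m p N \<subseteq> chain.span ?E"
  proof
    fix u assume u: "u \<in> koszul_chains m p N"
    have "u = (\<Sum>T\<in>Pow {..<m}. ?e T (u T))"
    proof (rule ext)
      fix T'
      have "(\<Sum>T\<in>Pow {..<m}. ?e T (u T)) T' = (\<Sum>T\<in>Pow {..<m}. if T = T' then u T else 0)"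
        unfolding sum_fun_apply by (intro sum.cong) auto
      also have "\<dots> = u T'" using koszul_chainsD(2)[OF u, of T'] by auto
      finally show "u T' = (\<Sum>T\<in>Pow {..<m}. ?e T (u T)) T'" by simp
    qed
    moreover have "?e T (u T) \<in> chain.span ?E" if "T \<in> Pow {..<m}" for T
    proof -
      have "?e T (u T) \<in> ?e T ` span B" using koszul_chainsD(1)[OF u] B by blast
      also have "\<dots> = chain.span (?e T ` B)" using P.linear_span_image[OF delta_linear, of T B] by simp
      also have "\<dots> \<subseteq> chain.span ?E" using that by (intro chain.span_mono) blast
      finally show ?thesis .
    qed
    ultimately show "u \<in> chain.span ?E" using chain.span_sum[of "Pow {..<m}" "\<lambda>T. ?e T (u T)" ?E] by simp
  qed
  moreover have "finite ?E" using B by auto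
  ultimately show ?thesis unfolding chain.fin_dim_def by blast
qed

lemma koszul_cycles_subspace: "subspace N \<Longrightarrow> chain.subspace (koszul_cycles X m p N)"
  using koszul_chains_subspace[of N m p] unfolding koszul_cycles_def chain.subspace_def
  by (auto simp: koszul_d_add koszul_d_scale)

lemma koszul_boundaries_subspace:
  assumes "subspace N"
  shows "chain.subspace (koszul_boundaries X m p N)"
proof -
  interpret koszul_d: Vector_Spaces.linear "pointwise_scale scale" "pointwise_scale scale" "koszul_d X m" by (rule koszul_d_linear)
  show ?thesis unfolding koszul_boundaries_def by (rule koszul_d.subspace_image[OF koszul_chains_subspace[OF assms]])
qed

lemma op_sum_eq: "op_sum m N = (\<lambda>u. u {}) ` koszul_boundaries X m 0 N" if "subspace N"
proof (intro set_eqI iffI)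
  fix x assume "x \<in> op_sum m N"
  then obtain q where q: "x = (\<Sum>v<m. X v (q v))" "\<forall>v<m. q v \<in> N" unfolding op_sum_def by blast
  define w where "w T = (if \<exists>v<m. T = {v} then q (THE v. T = {v}) else 0)" for T
  have "w \<in> koszul_chains m (Suc 0) N"
    using q(2) that by (intro koszul_chainsI) (auto simp: w_def subspace_0 split: if_splits)
  moreover have "koszul_d X m w {} = x" unfolding koszul_d_empty q by (intro sum.cong) (auto simp: w_def)
  ultimately show "x \<in> (\<lambda>u. u {}) ` koszul_boundaries X m 0 N" unfolding koszul_boundaries_def by force
next
  fix x assume "x \<in> (\<lambda>u. u {}) ` koszul_boundaries X m 0 N"
  then obtain w where w: "w \<in> koszul_chains m (Suc 0) N" "x = koszul_d X m w {}" unfolding koszul_boundaries_def by auto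
  then show "x \<in> op_sum m N" using koszul_chainsD(1)[OF w(1)] by (intro op_sumI[where q = "\<lambda>v. w {v}"]) (auto simp: koszul_d_empty)
qed

text \<open>In homological degree \<open>0\<close> the homology is \<open>M\<close> modulo the image of the operators.\<close>
lemma koszul_dim_0:
  assumes "graded_module m M"
  shows "koszul_dim scale X m 0 M e = dim (M e) - dim (op_sum m (M (e - 1)))"
proof -
  interpret P: vec_space_pair "pointwise_scale scale :: 'k \<Rightarrow> (nat set \<Rightarrow> 'a) \<Rightarrow> _" scale ..
  note sub = graded_moduleD(1)[OF assms]
  let ?f = "\<lambda>u::nat set \<Rightarrow> 'a. u {}"
  have lin: "Vector_Spaces.linear (pointwise_scale scale) scale ?f" by unfold_locales auto
  have cyc: "koszul_cycles X m 0 (M e) = koszul_chains m 0 (M e)"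
    unfolding koszul_cycles_def using koszul_d_chains_0[of _ m "M e" m] by auto
  have supp: "u T = 0" if "u \<in> koszul_chains m 0 N" "T \<noteq> {}" for u :: "nat set \<Rightarrow> 'a" and T N
  proof (rule ccontr)
    assume "u T \<noteq> 0"
    then have "T \<subseteq> {..<m}" "card T = 0" using koszul_chainsD(2)[OF that(1)] by auto
    then show False using that finite_subset[of T "{..<m}"] by auto
  qed
  have zero: "u = 0" if "u \<in> koszul_chains m 0 N" "u {} = 0" for u :: "nat set \<Rightarrow> 'a" and N
  proof (rule ext)
    show "u T = 0 T" for T using supp[OF that(1), of T] that(2) by (cases "T = {}") auto
  qed
  have "?f ` koszul_chains m 0 (M e) = M e"
  proof (intro equalityI subsetI)
    fix x assume "x \<in> M e"
    then have "(\<lambda>T. if T = {} then x else 0) \<in> koszul_chains m 0 (M e)"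
      using sub by (intro koszul_chainsI) (auto simp: subspace_0 split: if_splits)
    then show "x \<in> ?f ` koszul_chains m 0 (M e)" by (rule rev_image_eqI) simp
  qed (use koszul_chainsD(1) in auto)
  then have 1: "chain.dim (koszul_chains m 0 (M e)) = dim (M e)"
    using P.dim_image_inj[OF lin koszul_chains_subspace[OF sub] koszul_chains_fin_dim[OF graded_moduleD(2)[OF assms]], of m 0 e]
      zero by auto
  have b: "koszul_boundaries X m 0 (M (e - 1)) \<subseteq> koszul_chains m 0 (M e)"
    unfolding koszul_boundaries_def using koszul_d_chains[of _ m 0 "M (e-1)" m "M e"] sub graded_moduleD(4)[OF assms] by auto
  have 2: "chain.dim (koszul_boundaries X m 0 (M (e - 1))) = dim (op_sum m (M (e - 1)))"
    unfolding op_sum_eq[OF sub]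
    by (rule P.dim_image_inj[OF lin koszul_boundaries_subspace[OF sub] 
        chain.fin_dim_subset[OF koszul_chains_fin_dim[OF graded_moduleD(2)[OF assms]] b], symmetric])
      (use zero b in blast)
  show ?thesis unfolding koszul_dim_def cyc 1 2 by simp
qed

lemma op_sum_subspace: "subspace N \<Longrightarrow> subspace (op_sum k N)"
proof -
  assume N: "subspace N"
  have "Vector_Spaces.linear (pointwise_scale scale) scale (\<lambda>u::nat set \<Rightarrow> 'a. u {})" by unfold_locales auto
  then interpret ev: Vector_Spaces.linear "pointwise_scale scale" scale "\<lambda>u::nat set \<Rightarrow> 'a. u {}" .
  show ?thesis unfolding op_sum_eq[OF N] by (rule ev.subspace_image[OF koszul_boundaries_subspace[OF N]])
qed

lemma op_sum_single: "subspace N \<Longrightarrow> v < k \<Longrightarrow> q \<in> N \<Longrightarrow> X v q \<in> op_sum k N"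
  by (rule op_sumI[where q = "\<lambda>w. if w = v then q else 0"])
    (auto simp: subspace_0 if_distrib[of "X _"] sum.delta cong: if_cong)

lemma op_sum_least:
  assumes "subspace S" "\<And>v q. v < k \<Longrightarrow> q \<in> N \<Longrightarrow> X v q \<in> S"
  shows "op_sum k N \<subseteq> S"
  using assms by (auto elim!: op_sumE intro!: subspace_sum)

end

section \<open>Koszul homology along graded surjections\<close>

text \<open>The kernel, the source and the target of \<open>pr\<close> form a short exact sequence of graded modules. Two
pieces of the long exact sequence of its Koszul homology suffice for the computation of Betti numbers.\<close>
locale graded_surjection = F: commuting_ops scF XF + M: commuting_ops scM XM
  for scF :: "'k::field \<Rightarrow> 'a::ab_group_add \<Rightarrow> 'a" and XF
    and scM :: "'k \<Rightarrow> 'b::ab_group_add \<Rightarrow> 'b" and XM +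
  fixes pr :: "'a \<Rightarrow> 'b" and m :: nat and gF :: "int \<Rightarrow> 'a set" and gM :: "int \<Rightarrow> 'b set"
  assumes pr_linear: "Vector_Spaces.linear scF scM pr"
    and pr_X: "\<And>v x. v < m \<Longrightarrow> pr (XF v x) = XM v (pr x)"
    and F_graded_module: "F.graded_module m gF"
    and pr_surj: "pr ` gF e = gM e"
begin

definition ker :: "int \<Rightarrow> 'a set" where
  "ker e = {x\<in>gF e. pr x = 0}"

interpretation pr: Vector_Spaces.linear scF scM pr by (rule pr_linear)

lemma M_graded_module: "M.graded_module m gM"
proof -
  interpret P: vec_space_pair scF scM ..
  show ?thesis unfolding M.graded_module_def
  proof (intro conjI allI impI ballI)
    fix e
    show "M.subspace (gM e)" unfolding pr_surj[symmetric] by (rule pr.subspace_image[OF F.graded_moduleD(1)[OF F_graded_module]])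
    show "M.fin_dim (gM e)" unfolding pr_surj[symmetric] by (rule P.fin_dim_image[OF pr_linear F.graded_moduleD(2)[OF F_graded_module]])
    fix v x assume v: "v < m" and "x \<in> gM e"
    then obtain y where "y \<in> gF e" "x = pr y" unfolding pr_surj[symmetric] by blast
    then show "XM v x \<in> gM (e + 1)"
      using F.graded_moduleD(3)[OF F_graded_module v, of y e] pr_X[OF v, of y] unfolding pr_surj[symmetric] by force
  qed
qed

lemma ker_graded_module: "F.graded_module m ker"
  unfolding F.graded_module_def
proof (intro conjI allI impI ballI)
  fix e
  show "F.subspace (ker e)" 
    using F.graded_moduleD(1)[OF F_graded_module, of e] by (auto simp: ker_def F.subspace_def pr.add pr.scale)
  show "F.fin_dim (ker e)"
    by (rule F.fin_dim_subset[OF F.graded_moduleD(2)[OF F_graded_module, of e]]) (auto simp: ker_def)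
  fix v x assume "v < m" "x \<in> ker e"
  then show "XF v x \<in> ker (e + 1)" using F.graded_moduleD(3)[OF F_graded_module] pr_X by (auto simp: ker_def)
qed

lemma ker_sub: "ker e \<subseteq> gF e" by (auto simp: ker_def)

abbreviation chain_map :: "(nat set \<Rightarrow> 'a) \<Rightarrow> nat set \<Rightarrow> 'b" where
  "chain_map u \<equiv> (\<lambda>T. pr (u T))"

lemma chain_map_linear: "Vector_Spaces.linear (pointwise_scale scF) (pointwise_scale scM) chain_map"
  by unfold_locales (auto simp: fun_eq_iff pr.add pr.scale)

lemma chain_map_koszul_d: "q \<le> m \<Longrightarrow> chain_map (koszul_d XF q u) = koszul_d XM q (chain_map u)"
proof (induction q)
  case (Suc q)
  then show ?case by (auto simp: fun_eq_iff koszul_d_step_def pr.add pr.neg pr_X)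
qed (auto simp: fun_eq_iff)

lemma chain_map_chains: "chain_map ` koszul_chains m p (gF e) = koszul_chains m p (gM e)"
proof (intro equalityI subsetI)
  fix u assume "u \<in> chain_map ` koszul_chains m p (gF e)"
  then obtain w where w: "w \<in> koszul_chains m p (gF e)" "u = chain_map w" by blast
  show "u \<in> koszul_chains m p (gM e)"
  proof (rule M.koszul_chainsI)
    fix T
    show "u T \<in> gM e" using F.koszul_chainsD(1)[OF w(1)] w(2) pr_surj by blast
    assume "u T \<noteq> 0"
    then have "w T \<noteq> 0" using w by auto
    then show "T \<subseteq> {..<m} \<and> card T = p" using F.koszul_chainsD(2)[OF w(1)] by blast
  qed
next
  fix u assume u: "u \<in> koszul_chains m p (gM e)"
  have "\<exists>x. x \<in> gF e \<and> pr x = u T \<and> (u T = 0 \<longrightarrow> x = 0)" for T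
  proof (cases "u T = 0")
    case True
    then show ?thesis using F.subspace_0[OF F.graded_moduleD(1)[OF F_graded_module]] by auto
  next
    case False
    then show ?thesis using M.koszul_chainsD(1)[OF u, of T] unfolding pr_surj[symmetric] by auto
  qed
  then obtain w where w: "\<And>T. w T \<in> gF e \<and> pr (w T) = u T \<and> (u T = 0 \<longrightarrow> w T = 0)" by metis
  have "w \<in> koszul_chains m p (gF e)"
  proof (rule F.koszul_chainsI)
    fix T
    show "w T \<in> gF e" using w by blast
    assume "w T \<noteq> 0"
    then have "u T \<noteq> 0" using w by blast
    then show "T \<subseteq> {..<m} \<and> card T = p" using M.koszul_chainsD(2)[OF u] by blast
  qed
  then show "u \<in> chain_map ` koszul_chains m p (gF e)" using w by (intro image_eqI[of _ _ w]) auto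
qed

lemma chains_ker: "u \<in> koszul_chains m p (gF e) \<Longrightarrow> chain_map u = 0 \<Longrightarrow> u \<in> koszul_chains m p (ker e)"
  by (auto simp: koszul_chains_def ker_def fun_eq_iff)

lemma chains_ker_D: "u \<in> koszul_chains m p (ker e) \<Longrightarrow> u \<in> koszul_chains m p (gF e) \<and> chain_map u = 0"
  by (auto simp: koszul_chains_def ker_def fun_eq_iff)

text \<open>The connecting homomorphism. Let \<open>L\<close> be the space of chains \<open>w\<close> of \<open>F\<close> for which \<open>d w\<close> lies in the kernel
\<open>N\<close> of \<open>pr\<close>, and let \<open>Q\<close> be the sum of the chains of \<open>N\<close> and the boundaries of \<open>F\<close>. Then \<open>pr\<close> maps \<open>L\<close>
and \<open>Q\<close> onto the cycles and boundaries of the target, while \<open>d\<close> maps them onto the cycles and boundaries of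
\<open>N\<close>. So both homologies are isomorphic to \<open>L / Q\<close>.\<close>
theorem koszul_dim_shift:
  assumes exF: "\<And>u. u \<in> koszul_chains m (Suc p) (gF e) \<Longrightarrow> koszul_d XF m u = 0 \<Longrightarrow>
      \<exists>w\<in>koszul_chains m (Suc (Suc p)) (gF (e - 1)). koszul_d XF m w = u"
    and exN: "\<And>u. u \<in> koszul_chains m p (ker (e + 1)) \<Longrightarrow> koszul_d XF m u = 0 \<Longrightarrow>
      \<exists>w\<in>koszul_chains m (Suc p) (gF e). koszul_d XF m w = u"
  shows "koszul_dim scM XM m (Suc p) gM e = koszul_dim scF XF m p ker (e + 1)"
proof -
  interpret PF: vec_space_pair "pointwise_scale scF :: 'k \<Rightarrow> (nat set \<Rightarrow> 'a) \<Rightarrow> _" "pointwise_scale scF :: 'k \<Rightarrow> (nat set \<Rightarrow> 'a) \<Rightarrow> _" ..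
  interpret PM: vec_space_pair "pointwise_scale scF :: 'k \<Rightarrow> (nat set \<Rightarrow> 'a) \<Rightarrow> _" "pointwise_scale scM :: 'k \<Rightarrow> (nat set \<Rightarrow> 'b) \<Rightarrow> _" ..
  interpret chain_map: Vector_Spaces.linear "pointwise_scale scF" "pointwise_scale scM" chain_map by (rule chain_map_linear)
  let ?d = "koszul_d XF m"
  define L where "L = {w\<in>koszul_chains m (Suc p) (gF e). chain_map (?d w) = 0}"
  define Q where "Q = {w + z |w z. w \<in> koszul_chains m (Suc p) (ker e) \<and> z \<in> ?d ` koszul_chains m (Suc (Suc p)) (gF (e - 1))}"
  note subF = F.graded_moduleD(1)[OF F_graded_module] and XF = F.graded_moduleD(3,4)[OF F_graded_module]
  note subN = F.graded_moduleD(1)[OF ker_graded_module] and XN = F.graded_moduleD(3,4)[OF ker_graded_module]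
  have dF: "?d z \<in> koszul_chains m q (gF e)" if "z \<in> koszul_chains m (Suc q) (gF (e - 1))" for z q e
    using F.koszul_d_chains[OF that, of m "gF e"] subF XF by blast
  have dN: "?d z \<in> koszul_chains m q (ker (e + 1))" if "z \<in> koszul_chains m (Suc q) (ker e)" for z q e
    using F.koszul_d_chains[OF that, of m "ker (e + 1)"] subN XN by blast
  have subB: "F.chain.subspace (?d ` koszul_chains m (Suc (Suc p)) (gF (e - 1)))"
    using F.koszul_boundaries_subspace[OF subF, of m "Suc p" "e - 1"] by (simp add: koszul_boundaries_def)
  have L: "F.chain.subspace L"
    using F.koszul_chains_subspace[OF subF, of m "Suc p" e] unfolding L_def F.chain.subspace_def
    by (auto simp: F.koszul_d_add F.koszul_d_scale fun_eq_iff pr.add pr.scale)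
  have Lf: "F.chain.fin_dim L"
    by (rule F.chain.fin_dim_subset[OF F.koszul_chains_fin_dim[OF F.graded_moduleD(2)[OF F_graded_module]]]) (auto simp: L_def)
  have Q: "F.chain.subspace Q" unfolding Q_def
    by (rule F.chain.subspace_sums[OF F.koszul_chains_subspace[OF subN] subB])
  have NL: "koszul_chains m (Suc p) (ker e) \<subseteq> L"
  proof
    fix w assume w: "w \<in> koszul_chains m (Suc p) (ker e)"
    then show "w \<in> L" using chains_ker_D[OF w] chains_ker_D[OF dN[OF w]] by (simp add: L_def)
  qed
  have BL: "?d ` koszul_chains m (Suc (Suc p)) (gF (e - 1)) \<subseteq> L"
    using dF[of _ "Suc p" e] by (auto simp: L_def F.koszul_d_koszul_d fun_eq_iff)
  have QL: "Q \<subseteq> L" unfolding Q_def using NL BL F.chain.subspace_add[OF L] by blast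
  have zN: "0 \<in> koszul_chains m (Suc p) (ker e)" using F.chain.subspace_0[OF F.koszul_chains_subspace[OF subN]] .
  have NQ: "koszul_chains m (Suc p) (ker e) \<subseteq> Q"
  proof
    fix w assume "w \<in> koszul_chains m (Suc p) (ker e)"
    moreover have "w = w + 0" by simp
    ultimately show "w \<in> Q" unfolding Q_def using F.chain.subspace_0[OF subB] by blast
  qed
  have BQ: "?d ` koszul_chains m (Suc (Suc p)) (gF (e - 1)) \<subseteq> Q"
  proof
    fix w assume "w \<in> ?d ` koszul_chains m (Suc (Suc p)) (gF (e - 1))"
    moreover have "w = 0 + w" by simp
    ultimately show "w \<in> Q" unfolding Q_def using zN by blast
  qed
  have 1: "F.chain.dim L - F.chain.dim Q = M.chain.dim (chain_map ` L) - M.chain.dim (chain_map ` Q)"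
  proof (rule PM.dim_diff_image[OF chain_map_linear L Lf Q QL])
    fix x assume "x \<in> L" "chain_map x = 0"
    then show "x \<in> Q" using NQ chains_ker[of x "Suc p" e] by (auto simp: L_def)
  qed
  have 2: "F.chain.dim L - F.chain.dim Q = F.chain.dim (?d ` L) - F.chain.dim (?d ` Q)"
  proof (rule PF.dim_diff_image[OF F.koszul_d_linear L Lf Q QL])
    fix x assume "x \<in> L" "?d x = 0"
    then have "x \<in> ?d ` koszul_chains m (Suc (Suc p)) (gF (e - 1))" using exF[of x] by (auto simp: L_def)
    then show "x \<in> Q" using BQ by blast
  qed
  have "chain_map ` L = koszul_cycles XM m (Suc p) (gM e)"
    unfolding L_def koszul_cycles_def chain_map_chains[symmetric] using chain_map_koszul_d[of m] by auto
  moreover have "chain_map ` Q = koszul_boundaries XM m (Suc p) (gM (e - 1))"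
  proof (intro equalityI subsetI)
    fix y assume "y \<in> chain_map ` Q"
    then obtain w z where w: "w \<in> koszul_chains m (Suc p) (ker e)" and
      z: "z \<in> koszul_chains m (Suc (Suc p)) (gF (e - 1))" and y: "y = chain_map (w + ?d z)" unfolding Q_def by blast
    have "y = chain_map (?d z)" using y chains_ker_D[OF w] by (auto simp: fun_eq_iff pr.add)
    then have "y = koszul_d XM m (chain_map z)" using chain_map_koszul_d[of m z] by simp
    then show "y \<in> koszul_boundaries XM m (Suc p) (gM (e - 1))"
      unfolding koszul_boundaries_def chain_map_chains[symmetric] using z by blast
  next
    fix y assume "y \<in> koszul_boundaries XM m (Suc p) (gM (e - 1))"
    then obtain z where z: "z \<in> koszul_chains m (Suc (Suc p)) (gF (e - 1))" "y = koszul_d XM m (chain_map z)"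
      unfolding koszul_boundaries_def chain_map_chains[symmetric] by blast
    then have "y = chain_map (?d z)" using chain_map_koszul_d[of m z] by simp
    then show "y \<in> chain_map ` Q" using BQ z(1) by blast
  qed
  moreover have "?d ` L = koszul_cycles XF m p (ker (e + 1))"
  proof (intro equalityI subsetI)
    fix y assume "y \<in> ?d ` L"
    then obtain w where w: "w \<in> koszul_chains m (Suc p) (gF e)" "chain_map (?d w) = 0" "y = ?d w" 
      unfolding L_def by blast
    have "y \<in> koszul_chains m p (gF (e + 1))" using dF[of w p "e + 1"] w by simp
    then show "y \<in> koszul_cycles XF m p (ker (e + 1))"
      using chains_ker[of y p "e + 1"] w F.koszul_d_koszul_d by (simp add: koszul_cycles_def)
  next
    fix y assume y: "y \<in> koszul_cycles XF m p (ker (e + 1))"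
    then obtain w where w: "w \<in> koszul_chains m (Suc p) (gF e)" "?d w = y" using exN[of y] by (auto simp: koszul_cycles_def)
    moreover have "chain_map (?d w) = 0" using y w chains_ker_D[of y p "e + 1"] by (auto simp: koszul_cycles_def)
    ultimately show "y \<in> ?d ` L" unfolding L_def by blast
  qed
  moreover have "?d ` Q = koszul_boundaries XF m p (ker e)"
  proof (intro equalityI subsetI)
    fix y assume "y \<in> ?d ` Q"
    then obtain w z where w: "w \<in> koszul_chains m (Suc p) (ker e)" and y: "y = ?d (w + ?d z)" unfolding Q_def by blast
    then have "y = ?d w" by (simp add: F.koszul_d_add F.koszul_d_koszul_d)
    then show "y \<in> koszul_boundaries XF m p (ker e)" using w by (simp add: koszul_boundaries_def)
  next
    fix y assume "y \<in> koszul_boundaries XF m p (ker e)"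
    then show "y \<in> ?d ` Q" using NQ by (auto simp: koszul_boundaries_def)
  qed
  ultimately show ?thesis using 1 2 unfolding koszul_dim_def by simp
qed

text \<open>If the kernel consists of combinations of operators, source and target have the same minimal generators.\<close>
theorem koszul_dim_0_cover:
  assumes "\<And>x. x \<in> ker e \<Longrightarrow> x \<in> F.op_sum m (gF (e - 1))"
  shows "koszul_dim scM XM m 0 gM e = koszul_dim scF XF m 0 gF e"
proof -
  interpret P: vec_space_pair scF scM ..
  note subF = F.graded_moduleD(1)[OF F_graded_module]
  have Q: "F.subspace (F.op_sum m (gF (e - 1)))"
  proof -
    have "Vector_Spaces.linear (pointwise_scale scF) scF (\<lambda>u::nat set \<Rightarrow> 'a. u {})" by unfold_locales auto
    then interpret ev: Vector_Spaces.linear "pointwise_scale scF" scF "\<lambda>u::nat set \<Rightarrow> 'a. u {}" .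
    show ?thesis unfolding F.op_sum_eq[OF subF] by (rule ev.subspace_image[OF F.koszul_boundaries_subspace[OF subF]])
  qed
  have QL: "F.op_sum m (gF (e - 1)) \<subseteq> gF e"
    unfolding F.op_sum_def using F.graded_moduleD(4)[OF F_graded_module] by (auto intro!: F.subspace_sum[OF subF])
  have "F.dim (gF e) - F.dim (F.op_sum m (gF (e - 1))) = M.dim (pr ` gF e) - M.dim (pr ` F.op_sum m (gF (e - 1)))"
    by (rule P.dim_diff_image[OF pr_linear subF F.graded_moduleD(2)[OF F_graded_module] Q QL])
      (use assms in \<open>auto simp: ker_def\<close>)
  moreover have "pr ` F.op_sum m (gF (e - 1)) = M.op_sum m (gM (e - 1))"
  proof (intro equalityI subsetI)
    fix y assume "y \<in> pr ` F.op_sum m (gF (e - 1))"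
    then obtain q where "y = pr (\<Sum>v<m. XF v (q v))" "\<forall>v<m. q v \<in> gF (e - 1)"
      by (auto elim!: F.op_sumE)
    then show "y \<in> M.op_sum m (gM (e - 1))"
      using pr_surj by (intro M.op_sumI[where q = "\<lambda>v. pr (q v)"]) (auto simp: pr.sum pr_X)
  next
    fix y assume "y \<in> M.op_sum m (gM (e - 1))"
    then obtain q where q: "y = (\<Sum>v<m. XM v (q v))" "\<forall>v<m. q v \<in> gM (e - 1)" by (rule M.op_sumE)
    then have "\<forall>v. \<exists>x. v < m \<longrightarrow> x \<in> gF (e - 1) \<and> q v = pr x" using pr_surj[of "e - 1"] by blast
    then obtain q' where q': "\<And>v. v < m \<Longrightarrow> q' v \<in> gF (e - 1) \<and> q v = pr (q' v)" by metis
    then have "y = pr (\<Sum>v<m. XF v (q' v))" using q by (simp add: pr.sum pr_X)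
    moreover have "(\<Sum>v<m. XF v (q' v)) \<in> F.op_sum m (gF (e - 1))" using q' by (intro F.op_sumI[OF refl]) auto
    ultimately show "y \<in> pr ` F.op_sum m (gF (e - 1))" by blast
  qed
  ultimately show ?thesis
    using F.koszul_dim_0[OF F_graded_module, of e] M.koszul_dim_0[OF M_graded_module, of e] pr_surj by simp
qed

text \<open>The hypotheses of \<open>koszul_dim_shift\<close> for a minimal cover by a free module: its complex is exact in positive
homological degree, and in degree \<open>0\<close> elements of the kernel are boundaries by minimality.\<close>
theorem koszul_dim_shift_minimal:
  assumes reg: "F.regular_seq m gF" and mini: "\<And>e x. x \<in> ker e \<Longrightarrow> x \<in> F.op_sum m (gF (e - 1))"
  shows "koszul_dim scM XM m (Suc p) gM e = koszul_dim scF XF m p ker (e + 1)"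
proof (rule koszul_dim_shift)
  fix u assume "u \<in> koszul_chains m (Suc p) (gF e)" "koszul_d XF m u = 0"
  then show "\<exists>w\<in>koszul_chains m (Suc (Suc p)) (gF (e - 1)). koszul_d XF m w = u"
    using F.koszul_exact[OF F_graded_module reg] by blast
next
  fix u assume u: "u \<in> koszul_chains m p (ker (e + 1))" and du: "koszul_d XF m u = 0"
  show "\<exists>w\<in>koszul_chains m (Suc p) (gF e). koszul_d XF m w = u"
  proof (cases p)
    case (Suc p')
    have "u \<in> koszul_chains m (Suc p') (gF (e + 1))" using u ker_sub Suc F.koszul_chains_mono by blast
    from F.koszul_exact[OF F_graded_module reg this du order_refl] show ?thesis using Suc by simp
  next
    case 0
    have "u {} \<in> ker (e + 1)" using F.koszul_chainsD(1)[OF u] .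
    then have "u {} \<in> F.op_sum m (gF e)" using mini[of "u {}" "e + 1"] by simp
    then obtain w where w: "w \<in> koszul_chains m (Suc 0) (gF e)" "u {} = koszul_d XF m w {}"
      unfolding F.op_sum_eq[OF F.graded_moduleD(1)[OF F_graded_module]] koszul_boundaries_def by blast
    have dw: "koszul_d XF m w \<in> koszul_chains m 0 (gF (e + 1))"
      using F.koszul_d_chains[OF w(1), of m "gF (e + 1)"] F.graded_moduleD(1,3)[OF F_graded_module] by blast
    have "koszul_d XF m w T = u T" for T
    proof (cases "T = {}")
      case False
      have "\<not> (T \<subseteq> {..<m} \<and> card T = 0)" using False finite_subset[of T "{..<m}"] by auto
      then have "koszul_d XF m w T = 0" "u T = 0" using F.koszul_chainsD(2)[OF dw, of T] F.koszul_chainsD(2)[OF u, of T] 0 by blast+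
      then show ?thesis by simp
    qed (use w in simp)
    then show ?thesis using w(1) 0 by blast
  qed
qed

end

section \<open>Linear forms as regular sequences\<close>

abbreviation lookup where "lookup \<equiv> Poly_Mapping.lookup"
abbreviation single where "single \<equiv> Poly_Mapping.single"
abbreviation keys where "keys \<equiv> Poly_Mapping.keys"

lemma vec_space_smul: "vec_space (smul :: 'k::field \<Rightarrow> ('b \<Rightarrow>\<^sub>0 'k) \<Rightarrow> _)"
  by (intro vec_space.intro vector_space_smul)

interpretation poly_space: vec_space "smul :: 'k::field \<Rightarrow> ('b \<Rightarrow>\<^sub>0 'k) \<Rightarrow> _"
  by (rule vec_space_smul)

lemma sum_singles:
  assumes "finite S" "keys p \<subseteq> S"
  shows "(\<Sum>a\<in>S. single a (lookup p a)) = p"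
proof (rule poly_mapping_eqI)
  fix x
  have "lookup (\<Sum>a\<in>S. single a (lookup p a)) x = (\<Sum>a\<in>S. if a = x then lookup p a else 0)"
    by (auto simp: lookup_sum lookup_single when_def intro!: sum.cong)
  also have "\<dots> = lookup p x" using assms by (auto simp: in_keys_iff)
  finally show "lookup (\<Sum>a\<in>S. single a (lookup p a)) x = lookup p x" .
qed

text \<open>Linear statements about finitely supported functions need to be checked on single terms only.\<close>
lemma poly_mapping_add_induct [case_names zero single add]:
  assumes "P 0" "\<And>a c. P (single a c)" "\<And>p q. P p \<Longrightarrow> P q \<Longrightarrow> P (p + q)"
  shows "P (p :: 'b \<Rightarrow>\<^sub>0 'c::comm_monoid_add)"
proof -
  have "P (\<Sum>a\<in>S. single a (lookup p a))" if "finite S" for S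
    using that by (induction S rule: finite_induct) (auto simp: assms)
  from this[of "keys p"] show ?thesis by (simp add: sum_singles)
qed

lemma smul_single [simp]: "smul c (single a b) = single a (c * b)"
  by (rule poly_mapping_eqI) (simp add: lookup_single when_def)

lemma smul_eq_mult: "smul c p = single 0 c * (p :: ('v::finite, 'k::field) poly_ring)"
  by (simp add: smul_def mult_map_scale_conv_mult)

lemma keys_smul: "keys (smul c p) \<subseteq> keys p"
  by (auto simp: in_keys_iff)

lemma smul_mult_left: "smul c (p * q) = smul c p * (q :: ('v::finite, 'k::field) poly_ring)"
  by (simp add: smul_eq_mult mult.assoc)

lemma smul_mult_right: "smul c (p * q) = p * smul c (q :: ('v::finite, 'k::field) poly_ring)"
  by (simp add: smul_eq_mult mult.left_commute)

definition linear_extension :: "('c::comm_ring_1 \<Rightarrow> 'a \<Rightarrow> 'a::ab_group_add) \<Rightarrow> ('b \<Rightarrow> 'a) \<Rightarrow> ('b \<Rightarrow>\<^sub>0 'c) \<Rightarrow> 'a" where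
  "linear_extension sc G u = (\<Sum>x\<in>keys u. sc (lookup u x) (G x))"

context module
begin

lemma linear_extension_superset:
  assumes "finite S" "keys u \<subseteq> S"
  shows "linear_extension scale G u = (\<Sum>x\<in>S. scale (lookup u x) (G x))"
  unfolding linear_extension_def using assms by (intro sum.mono_neutral_left) (auto simp: in_keys_iff)

lemma linear_extension_hom: "module_hom smul scale (linear_extension scale G)"
proof -
  interpret sm: module "smul :: 'a \<Rightarrow> ('c \<Rightarrow>\<^sub>0 'a) \<Rightarrow> _" by (rule module_smul)
  show ?thesis
  proof unfold_locales
    fix u w :: "'c \<Rightarrow>\<^sub>0 'a"
    have "keys (u + w) \<subseteq> keys u \<union> keys w" by (rule keys_add)
    then show "linear_extension scale G (u + w) = linear_extension scale G u + linear_extension scale G w"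
      by (simp add: linear_extension_superset[of "keys u \<union> keys w"] lookup_add scale_left_distrib sum.distrib)
    fix c
    show "linear_extension scale G (smul c u) = scale c (linear_extension scale G u)"
      using keys_smul[of c u] by (simp add: linear_extension_superset[of "keys u"] scale_sum_right)
  qed
qed

lemma linear_extension_single [simp]: "linear_extension scale G (single x c) = scale c (G x)"
  by (simp add: linear_extension_def)

end

lemma mdeg_add: "mdeg (\<alpha> + \<beta>) = mdeg \<alpha> + mdeg \<beta>"
  by (simp add: mdeg_def lookup_add sum.distrib)

lemma mdeg_zero [simp]: "mdeg 0 = 0"
  by (simp add: mdeg_def)

lemma mdeg_eq_0_iff: "mdeg \<alpha> = 0 \<longleftrightarrow> \<alpha> = 0"
  unfolding mdeg_def by (auto simp: poly_mapping_eq_iff fun_eq_iff)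

lemma mdeg_single [simp]: "mdeg (single v n) = n"
  unfolding mdeg_def by (simp add: lookup_single when_def)

lemma finite_mdeg: "finite {\<alpha> :: 'v::finite \<Rightarrow>\<^sub>0 nat. mdeg \<alpha> = n}"
proof -
  have "lookup ` {\<alpha> :: 'v \<Rightarrow>\<^sub>0 nat. mdeg \<alpha> = n} \<subseteq>
      {f. \<forall>v. (v \<in> UNIV \<longrightarrow> f v \<in> {..n}) \<and> (v \<notin> UNIV \<longrightarrow> f v = 0)}"
    by (auto simp: mdeg_def intro!: member_le_sum)
  moreover have "finite {f :: 'v \<Rightarrow> nat. \<forall>v. (v \<in> UNIV \<longrightarrow> f v \<in> {..n}) \<and> (v \<notin> UNIV \<longrightarrow> f v = 0)}"
    by (rule finite_set_of_finite_funs) auto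
  ultimately have "finite (lookup ` {\<alpha> :: 'v \<Rightarrow>\<^sub>0 nat. mdeg \<alpha> = n})" by (rule finite_subset)
  then show ?thesis by (rule finite_imageD) (rule inj_onI, rule poly_mapping_eqI, simp)
qed

text \<open>Degrees are integers so that differences of degrees are never truncated; components of negative degree are
zero.\<close>
definition homog_int :: "int \<Rightarrow> (('v::finite \<Rightarrow>\<^sub>0 nat) \<Rightarrow>\<^sub>0 'k::zero) set" where
  "homog_int e = {p. \<forall>\<alpha>\<in>keys p. int (mdeg \<alpha>) = e}"

lemma homog_eq_homog_int: "homog n = homog_int (int n)"
  by (auto simp: homog_def homog_int_def)

lemma homog_int_iff: "p \<in> homog_int e \<longleftrightarrow> (\<forall>\<alpha>. lookup p \<alpha> \<noteq> 0 \<longrightarrow> int (mdeg \<alpha>) = e)"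
  by (auto simp: homog_int_def in_keys_iff)

lemma homog_int_neg: "e < 0 \<Longrightarrow> homog_int e = {0}"
proof (intro set_eqI iffI)
  fix p :: "('a \<Rightarrow>\<^sub>0 nat) \<Rightarrow>\<^sub>0 'b" assume "e < 0" "p \<in> homog_int e"
  then have "lookup p \<alpha> = 0" for \<alpha> by (force simp: homog_int_iff)
  then show "p \<in> {0}" by (simp add: poly_mapping_eqI)
qed (auto simp: homog_int_iff)

lemma homog_int_subspace: "poly_space.subspace (homog_int e :: (('v::finite \<Rightarrow>\<^sub>0 nat) \<Rightarrow>\<^sub>0 'k::field) set)"
proof (rule poly_space.subspaceI)
  fix x y :: "('v \<Rightarrow>\<^sub>0 nat) \<Rightarrow>\<^sub>0 'k" assume "x \<in> homog_int e" "y \<in> homog_int e"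
  moreover have "lookup (x + y) \<alpha> \<noteq> 0 \<Longrightarrow> lookup x \<alpha> \<noteq> 0 \<or> lookup y \<alpha> \<noteq> 0" for \<alpha>
    by (auto simp: lookup_add)
  ultimately show "x + y \<in> homog_int e" unfolding homog_int_iff by blast
qed (auto simp: homog_int_iff)

lemma homog_int_single: "int (mdeg \<alpha>) = e \<Longrightarrow> single \<alpha> c \<in> homog_int e"
  by (auto simp: homog_int_iff lookup_single when_def)

lemma homog_int_mult:
  assumes "p \<in> homog_int a" "q \<in> homog_int (b::int)"
  shows "p * q \<in> (homog_int (a + b) :: ('v::finite, 'k::field) poly_ring set)"
  unfolding homog_int_def
proof (intro CollectI ballI)
  fix \<alpha> assume "\<alpha> \<in> keys (p * q)"
  then obtain \<beta> \<gamma> where "\<alpha> = \<beta> + \<gamma>" "\<beta> \<in> keys p" "\<gamma> \<in> keys q" using keys_mult[of p q] by blast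
  then show "int (mdeg \<alpha>) = a + b" using assms by (auto simp: homog_int_def mdeg_add)
qed

lemma homog_int_fin_dim: "poly_space.fin_dim (homog_int e :: ('v::finite, 'k::field) poly_ring set)"
  unfolding poly_space.fin_dim_def
proof (intro exI conjI subsetI)
  show "finite ((\<lambda>\<alpha>. single \<alpha> (1::'k)) ` {\<alpha>::'v \<Rightarrow>\<^sub>0 nat. mdeg \<alpha> = nat e})" by (intro finite_imageI finite_mdeg)
  fix p :: "('v, 'k) poly_ring" assume p: "p \<in> homog_int e"
  have "p = (\<Sum>\<alpha>\<in>keys p. smul (lookup p \<alpha>) (single \<alpha> 1))" by (simp add: sum_singles)
  also have "\<dots> \<in> poly_space.span ((\<lambda>\<alpha>. single \<alpha> 1) ` {\<alpha>. mdeg \<alpha> = nat e})"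
  proof (intro poly_space.span_sum poly_space.span_scale poly_space.span_base imageI CollectI)
    fix \<alpha> assume "\<alpha> \<in> keys p"
    then show "mdeg \<alpha> = nat e" using p by (auto simp: homog_int_def)
  qed
  finally show "p \<in> poly_space.span ((\<lambda>\<alpha>. single \<alpha> 1) ` {\<alpha>. mdeg \<alpha> = nat e})" .
qed

text \<open>The Koszul complex uses operators indexed by natural numbers, so the variables are enumerated once and for
all.\<close>
definition var_enum :: "nat \<Rightarrow> 'v::finite" where
  "var_enum = (SOME h. bij_betw h {..<CARD('v)} UNIV)"

lemma var_enum_bij: "bij_betw (var_enum :: nat \<Rightarrow> 'v::finite) {..<CARD('v)} UNIV"
proof -
  have "\<exists>h. bij_betw h {..<CARD('v)} (UNIV :: 'v set)" by (rule finite_same_card_bij) auto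
  then show ?thesis unfolding var_enum_def by (rule someI_ex)
qed

lemma var_enum_surj: "\<exists>i<CARD('v). var_enum i = (v :: 'v::finite)"
  using var_enum_bij[where 'v = 'v] unfolding bij_betw_def by (metis UNIV_I imageE lessThan_iff)

lemma var_enum_inj: "i < CARD('v) \<Longrightarrow> j < CARD('v) \<Longrightarrow> (var_enum i :: 'v::finite) = var_enum j \<longleftrightarrow> i = j"
  using var_enum_bij[where 'v = 'v] unfolding bij_betw_def inj_on_def by auto

definition var :: "nat \<Rightarrow> ('v::finite, 'k::field) poly_ring" where
  "var i = single (single (var_enum i) (Suc 0)) 1"

lemma var_homog_int: "var i \<in> homog_int 1"
  unfolding var_def by (rule homog_int_single) simp

lemma var_mult_single: "var i * single \<alpha> c = single (single (var_enum i) (Suc 0) + \<alpha>) c"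
  by (simp add: var_def mult_single)

abbreviation (input) mult_ops :: "(nat \<Rightarrow> ('v::finite, 'k::field) poly_ring) \<Rightarrow> nat \<Rightarrow> ('v, 'k) poly_ring \<Rightarrow> ('v, 'k) poly_ring" where
  "mult_ops l \<equiv> (\<lambda>i p. l i * p)"

lemma commuting_mult_ops: "commuting_ops smul (mult_ops l)"
  by unfold_locales (simp_all only: distrib_left smul_mult_right mult.left_commute)

interpretation mult_ops: commuting_ops "smul :: 'k \<Rightarrow> ('v::finite, 'k::field) poly_ring \<Rightarrow> _" "mult_ops l" for l
  by (rule commuting_mult_ops)

text \<open>Each monomial of \<open>p\<close> is divisible by one of the first \<open>k\<close> variables.\<close>
lemma op_sum_var_divisible:
  fixes p :: "('v::finite, 'k::field) poly_ring"
  assumes "p \<in> homog_int e" "\<And>\<alpha>. lookup p \<alpha> \<noteq> 0 \<Longrightarrow> \<exists>i<k. lookup \<alpha> (var_enum i) > 0"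
  shows "p \<in> mult_ops.op_sum var k (homog_int (e - 1))"
proof -
  have "single \<alpha> (lookup p \<alpha>) \<in> mult_ops.op_sum var k (homog_int (e - 1))" if a: "\<alpha> \<in> keys p" for \<alpha>
  proof -
    obtain i where i: "i < k" "lookup \<alpha> (var_enum i) > 0" using assms(2) a by (auto simp: in_keys_iff)
    have \<alpha>: "\<alpha> = single (var_enum i) (Suc 0) + (\<alpha> - single (var_enum i) (Suc 0))"
      by (rule poly_mapping_eqI) (use i in \<open>auto simp: lookup_add lookup_minus lookup_single when_def\<close>)
    have "mdeg \<alpha> = 1 + mdeg (\<alpha> - single (var_enum i) (Suc 0))" by (subst \<alpha>) (simp add: mdeg_add)
    then have "single (\<alpha> - single (var_enum i) (Suc 0)) (lookup p \<alpha>) \<in> homog_int (e - 1)"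
      using assms(1) a by (intro homog_int_single) (auto simp: homog_int_def)
    from mult_ops.op_sum_single[OF homog_int_subspace i(1) this, of var] show ?thesis
      by (simp only: var_mult_single \<alpha>[symmetric])
  qed
  then have "(\<Sum>\<alpha>\<in>keys p. single \<alpha> (lookup p \<alpha>)) \<in> mult_ops.op_sum var k (homog_int (e - 1))"
    by (intro poly_space.subspace_sum mult_ops.op_sum_subspace homog_int_subspace)
  then show ?thesis by (simp add: sum_singles)
qed

lemma lookup_var_mult:
  fixes p :: "('v::finite, 'k::field) poly_ring"
  shows "lookup (var i * p) \<alpha> \<noteq> 0 \<Longrightarrow> lookup \<alpha> (var_enum i) > 0"
proof -
  assume "lookup (var i * p) \<alpha> \<noteq> 0"
  then have "\<alpha> \<in> keys (var i * p)" by (simp add: in_keys_iff)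
  then obtain \<beta> \<gamma> where "\<alpha> = \<beta> + \<gamma>" "\<beta> \<in> keys (var i :: ('v, 'k) poly_ring)" using keys_mult[of "var i" p] by blast
  then show ?thesis by (auto simp: var_def lookup_add split: if_splits)
qed

lemma lookup_var_mult_add: "lookup (var i * p) (single (var_enum i) (Suc 0) + \<alpha>) = lookup p \<alpha>"
proof (induction p rule: poly_mapping_add_induct)
  case (single a c)
  then show ?case unfolding var_mult_single by (auto simp: lookup_single when_def)
qed (auto simp: lookup_add distrib_left)

text \<open>If \<open>x\<^sub>k y\<close> lies in the ideal of the earlier variables, each monomial of \<open>x\<^sub>k y\<close> contains one of these, and
so does the corresponding monomial of \<open>y\<close>.\<close>
lemma var_regular: "mult_ops.regular_seq (var :: nat \<Rightarrow> ('v::finite, 'k::field) poly_ring) CARD('v) homog_int"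
  unfolding mult_ops.regular_seq_def
proof (intro allI impI ballI)
  fix k e and y :: "('v, 'k) poly_ring"
  assume k: "k < CARD('v)" and y: "y \<in> homog_int e" and "var k * y \<in> mult_ops.op_sum var k (homog_int e)"
  then obtain q where q: "var k * y = (\<Sum>v<k. var v * q v)" by (auto elim!: mult_ops.op_sumE)
  show "y \<in> mult_ops.op_sum var k (homog_int (e - 1))"
  proof (rule op_sum_var_divisible[OF y])
    fix \<alpha> assume "lookup y \<alpha> \<noteq> 0"
    then have "lookup (var k * y) (single (var_enum k) (Suc 0) + \<alpha>) \<noteq> 0" by (simp add: lookup_var_mult_add)
    then have "(\<Sum>v<k. lookup (var v * q v) (single (var_enum k) (Suc 0) + \<alpha>)) \<noteq> 0" by (simp add: q lookup_sum)
    then obtain v where v: "v < k" "lookup (var v * q v) (single (var_enum k) (Suc 0) + \<alpha>) \<noteq> 0"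
      using sum.neutral[of "{..<k}" "\<lambda>v. lookup (var v * q v) (single (var_enum k) (Suc 0) + \<alpha>)"] by blast
    then have "lookup (single (var_enum k :: 'v) (Suc 0) + \<alpha>) (var_enum v) > 0" using lookup_var_mult by blast
    moreover have "(var_enum k :: 'v) \<noteq> var_enum v" using var_enum_inj[of k v, where 'v = 'v] v(1) k by simp
    ultimately show "\<exists>i<k. lookup \<alpha> (var_enum i) > 0" using v by (auto simp: lookup_add lookup_single)
  qed
qed

lemma op_sum_var_no_constant:
  fixes p :: "('v::finite, 'k::field) poly_ring"
  assumes "p \<in> homog_int e" "lookup p 0 = 0"
  shows "p \<in> mult_ops.op_sum var CARD('v) (homog_int (e - 1))"
proof (rule op_sum_var_divisible[OF assms(1)])
  fix \<alpha> :: "'v \<Rightarrow>\<^sub>0 nat" assume "lookup p \<alpha> \<noteq> 0"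
  then have "\<alpha> \<noteq> 0" using assms by auto
  then obtain v where "lookup \<alpha> v \<noteq> 0" by (auto simp: poly_mapping_eq_iff fun_eq_iff)
  then show "\<exists>i<CARD('v). lookup \<alpha> (var_enum i) > 0" using var_enum_surj[of v] by auto
qed

text \<open>As there are exactly as many forms as variables, spanning means that \<open>l\<close> is a basis of the linear forms, that
is, a linear change of coordinates.\<close>
definition spanning_forms :: "(nat \<Rightarrow> ('v::finite, 'k::field) poly_ring) \<Rightarrow> bool" where
  "spanning_forms l \<longleftrightarrow> (\<forall>i<CARD('v). l i \<in> homog_int 1) \<and>
     (\<forall>i<CARD('v). \<exists>a. var i = (\<Sum>j<CARD('v). smul (a j) (l j)))"

lemma spanning_var: "spanning_forms (var :: nat \<Rightarrow> ('v::finite, 'k::field) poly_ring)"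
  unfolding spanning_forms_def
proof (intro conjI allI impI)
  fix i assume "i < CARD('v)"
  then have "var i = (\<Sum>j<CARD('v). smul (if j = i then 1 else 0) (var j :: ('v, 'k) poly_ring))"
    by (simp add: if_distrib[of "\<lambda>c. smul c _"] sum.delta' cong: if_cong)
  then show "\<exists>a. var i = (\<Sum>j<CARD('v). smul (a j) (var j :: ('v, 'k) poly_ring))"
    by (intro exI[of _ "\<lambda>j. if j = i then 1 else 0"])
qed (rule var_homog_int)

lemma op_sum_no_constant:
  fixes p :: "('v::finite, 'k::field) poly_ring"
  assumes "spanning_forms l" "p \<in> homog_int e" "lookup p 0 = 0"
  shows "p \<in> mult_ops.op_sum l CARD('v) (homog_int (e - 1))"
proof -
  have "mult_ops.op_sum var CARD('v) (homog_int (e - 1)) \<subseteq> mult_ops.op_sum l CARD('v) (homog_int (e - 1))"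
  proof (rule mult_ops.op_sum_least[OF mult_ops.op_sum_subspace[OF homog_int_subspace]])
    fix v and q :: "('v, 'k) poly_ring" assume v: "v < CARD('v)" and q: "q \<in> homog_int (e - 1)"
    obtain a where "var v = (\<Sum>j<CARD('v). smul (a j) (l j))" using assms(1) v unfolding spanning_forms_def by blast
    then have "var v * q = (\<Sum>j<CARD('v). l j * smul (a j) q)"
      by (simp add: sum_distrib_right smul_mult_left[symmetric] smul_mult_right)
    then show "var v * q \<in> mult_ops.op_sum l CARD('v) (homog_int (e - 1))"
      by (rule mult_ops.op_sumI) (rule poly_space.subspace_scale[OF homog_int_subspace q])
  qed
  then show ?thesis using op_sum_var_no_constant[OF assms(2,3)] by blast
qed

text \<open>Substitution of the form \<open>l i\<close> for the variable with number \<open>i\<close>.\<close>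
definition subst :: "(nat \<Rightarrow> ('v::finite, 'k::field) poly_ring) \<Rightarrow> ('v, 'k) poly_ring \<Rightarrow> ('v, 'k) poly_ring" where
  "subst l = linear_extension smul (\<lambda>\<alpha>. \<Prod>i<CARD('v). l i ^ lookup \<alpha> (var_enum i))"

lemma subst_linear: "Vector_Spaces.linear smul smul (subst l)"
  using poly_space.linear_extension_hom by (simp add: subst_def module_hom_iff_linear)

interpretation subst: Vector_Spaces.linear smul smul "subst l" for l
  by (rule subst_linear)

lemma subst_single: "subst l (single \<alpha> c) = smul c (\<Prod>i<CARD('v). l i ^ lookup \<alpha> (var_enum i :: 'v::finite))"
  unfolding subst_def by simp

lemma subst_var_mult:
  fixes l :: "nat \<Rightarrow> ('v::finite, 'k::field) poly_ring"
  assumes "k < CARD('v)"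
  shows "subst l (var k * p) = l k * subst l p"
proof (induction p rule: poly_mapping_add_induct)
  case (single \<alpha> c)
  have "(\<Prod>i<CARD('v). l i ^ lookup (single (var_enum k) (Suc 0) + \<alpha>) (var_enum i)) =
    (\<Prod>i<CARD('v). (if i = k then l k else 1) * l i ^ lookup \<alpha> (var_enum i))"
  proof (intro prod.cong refl)
    fix i assume "i \<in> {..<CARD('v)}"
    then have "(var_enum k :: 'v) = var_enum i \<longleftrightarrow> k = i" using var_enum_inj[of k i, where 'v = 'v] assms by simp
    then show "l i ^ lookup (single (var_enum k) (Suc 0) + \<alpha>) (var_enum i) = (if i = k then l k else 1) * l i ^ lookup \<alpha> (var_enum i)"
      by (auto simp: lookup_add lookup_single when_def)
  qed
  also have "\<dots> = l k * (\<Prod>i<CARD('v). l i ^ lookup \<alpha> (var_enum i))"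
    using assms by (simp add: prod.distrib)
  finally show ?case by (simp add: var_mult_single subst_single smul_mult_right)
qed (auto simp: distrib_left subst.add subst.zero)

lemma subst_homog_int:
  fixes l :: "nat \<Rightarrow> ('v::finite, 'k::field) poly_ring"
  assumes "\<And>i. i < CARD('v) \<Longrightarrow> l i \<in> homog_int 1" "p \<in> homog_int e"
  shows "subst l p \<in> homog_int e"
proof -
  have one: "(1 :: ('v, 'k) poly_ring) \<in> homog_int 0" using homog_int_single[of 0 0 "1::'k"] by simp
  have pow: "l i ^ n \<in> homog_int (int n)" if "i < CARD('v)" for i n
    using homog_int_mult[OF assms(1)[OF that]] one by (induction n) auto
  have pr: "(\<Prod>i\<in>I. l i ^ lookup \<alpha> (var_enum i)) \<in> homog_int (int (\<Sum>i\<in>I. lookup \<alpha> (var_enum i)))" if "I \<subseteq> {..<CARD('v)}" for I and \<alpha> :: "'v \<Rightarrow>\<^sub>0 nat"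
    using finite_subset[OF that finite_lessThan] that
  proof (induction I rule: finite_induct)
    case (insert x F)
    then have "l x ^ lookup \<alpha> (var_enum x) * (\<Prod>i\<in>F. l i ^ lookup \<alpha> (var_enum i))
        \<in> homog_int (int (lookup \<alpha> (var_enum x)) + int (\<Sum>i\<in>F. lookup \<alpha> (var_enum i)))"
      by (intro homog_int_mult pow) auto
    then show ?case using insert.hyps by simp
  qed (use one in simp)
  have sm: "(\<Sum>i<CARD('v). lookup \<alpha> (var_enum i)) = mdeg \<alpha>" for \<alpha> :: "'v \<Rightarrow>\<^sub>0 nat"
    unfolding mdeg_def by (rule sum.reindex_bij_betw[OF var_enum_bij])
  have m: "(\<Prod>i<CARD('v). l i ^ lookup \<alpha> (var_enum i)) \<in> homog_int (int (mdeg \<alpha>))" for \<alpha> :: "'v \<Rightarrow>\<^sub>0 nat"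
    using pr[OF order_refl, of \<alpha>] sm[of \<alpha>] by simp
  show ?thesis unfolding subst_def linear_extension_def
    using assms(2) m by (intro poly_space.subspace_sum[OF homog_int_subspace] poly_space.subspace_scale[OF homog_int_subspace]) (auto simp: homog_int_def)
qed

lemma subst_surj:
  fixes l :: "nat \<Rightarrow> ('v::finite, 'k::field) poly_ring"
  assumes "spanning_forms l"
  shows "p \<in> homog_int (int n) \<Longrightarrow> p \<in> subst l ` homog_int (int n)"
proof (induction n arbitrary: p)
  case 0
  have "lookup p \<alpha> = 0" if "\<alpha> \<noteq> 0" for \<alpha> using 0 that mdeg_eq_0_iff[of \<alpha>] by (auto simp: homog_int_iff)
  then have p: "p = single 0 (lookup p 0)" 
    by (intro poly_mapping_eqI) (auto simp: lookup_single when_def)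
  moreover have "subst l (single 0 c) = single 0 c" for c using subst_single[of l 0 c] by (simp add: smul_eq_mult)
  ultimately show ?case using 0 by (metis imageI)
next
  case (Suc n)
  have "lookup p 0 = 0" using Suc.prems by (force simp: homog_int_iff)
  from op_sum_no_constant[OF assms Suc.prems this]
  have "p \<in> mult_ops.op_sum l CARD('v) (homog_int (int n))" by simp
  then obtain q where q: "p = (\<Sum>v<CARD('v). l v * q v)" "\<forall>v<CARD('v). q v \<in> homog_int (int n)" by (rule mult_ops.op_sumE)
  have "\<forall>v. \<exists>q'. v < CARD('v) \<longrightarrow> q' \<in> homog_int (int n) \<and> q v = subst l q'" using Suc.IH q by blast
  then obtain q' where q': "\<And>v. v < CARD('v) \<Longrightarrow> q' v \<in> homog_int (int n) \<and> q v = subst l (q' v)" by metis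
  have "p = subst l (\<Sum>v<CARD('v). var v * q' v)" using q(1) q' by (simp add: subst.sum subst_var_mult)
  moreover have "(\<Sum>v<CARD('v). var v * q' v) \<in> homog_int (int (Suc n))"
    using q' homog_int_mult[OF var_homog_int] by (intro poly_space.subspace_sum[OF homog_int_subspace]) force
  ultimately show ?case by blast
qed

lemma subst_image:
  fixes l :: "nat \<Rightarrow> ('v::finite, 'k::field) poly_ring"
  assumes "spanning_forms l"
  shows "subst l ` homog_int e = homog_int e"
proof (cases "e < 0")
  case False
  then show ?thesis using subst_surj[OF assms, of _ "nat e"] subst_homog_int[of l] assms
    by (auto simp: spanning_forms_def)
qed (auto simp: homog_int_neg subst.zero)

text \<open>A linear map of a finite-dimensional space onto itself is injective.\<close>
lemma subst_inj:
  fixes l :: "nat \<Rightarrow> ('v::finite, 'k::field) poly_ring"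
  assumes "spanning_forms l" "p \<in> homog_int e" "subst l p = 0"
  shows "p = 0"
proof -
  interpret P: vec_space_pair "smul :: 'k \<Rightarrow> ('v, 'k) poly_ring \<Rightarrow> _" "smul :: 'k \<Rightarrow> ('v, 'k) poly_ring \<Rightarrow> _" ..
  let ?N = "{x \<in> homog_int e. subst l x = 0}"
  have "poly_space.dim ?N = 0"
    using P.rank_nullity[of "subst l" "homog_int e", OF subst_linear homog_int_subspace homog_int_fin_dim] subst_image[OF assms(1)] by simp
  moreover have "poly_space.subspace ?N" using homog_int_subspace[of e]
    by (auto simp: poly_space.subspace_def subst.add subst.scale subst.zero)
  moreover have "poly_space.fin_dim ?N" by (rule poly_space.fin_dim_subset[OF homog_int_fin_dim]) auto
  ultimately obtain B where B: "finite B" "poly_space.span B = ?N" "card B = 0"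
    using poly_space.fin_dim_basis[of ?N] by (metis (no_types, lifting))
  then have "B = {}" by simp
  then have N0: "?N = {0}" using B(2) by (simp only: poly_space.span_empty)
  have "p \<in> ?N" using assms(2,3) by (intro CollectI conjI)
  then have "p \<in> {0}" by (subst (asm) N0)
  then show ?thesis by (rule singletonD)
qed

text \<open>The substitution is a graded automorphism that carries the variables to the forms, so regularity is inherited
from the variables.\<close>
lemma forms_regular:
  fixes l :: "nat \<Rightarrow> ('v::finite, 'k::field) poly_ring"
  assumes "spanning_forms l"
  shows "mult_ops.regular_seq l CARD('v) homog_int"
  unfolding mult_ops.regular_seq_def
proof (intro allI impI ballI)
  fix k e and y :: "('v, 'k) poly_ring"
  assume k: "k < CARD('v)" and y: "y \<in> homog_int e" and ly: "l k * y \<in> mult_ops.op_sum l k (homog_int e)"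
  from ly obtain q where q: "l k * y = (\<Sum>v<k. l v * q v)" "\<forall>v<k. q v \<in> homog_int e" by (rule mult_ops.op_sumE)
  obtain y' where y': "y = subst l y'" "y' \<in> homog_int e" using y subst_image[OF assms] by blast
  have "\<forall>v. \<exists>q'. v < k \<longrightarrow> q' \<in> homog_int e \<and> q v = subst l q'" using subst_image[OF assms, of e] q(2) by blast
  then obtain q' where q': "\<And>v. v < k \<Longrightarrow> q' v \<in> homog_int e \<and> q v = subst l (q' v)" by metis
  have "var k * y' - (\<Sum>v<k. var v * q' v) = 0"
  proof (rule subst_inj[OF assms])
    show "var k * y' - (\<Sum>v<k. var v * q' v) \<in> homog_int (1 + e)"
      using q' y' homog_int_mult[OF var_homog_int] by (intro poly_space.subspace_diff[OF homog_int_subspace] poly_space.subspace_sum[OF homog_int_subspace]) auto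
    have "subst l (var v * q' v) = l v * q v" if "v < k" for v
      using q'[OF that] subst_var_mult[of v l "q' v"] that k by simp
    then show "subst l (var k * y' - (\<Sum>v<k. var v * q' v)) = 0"
      using q(1) y'(1) by (simp add: subst.diff subst.sum subst_var_mult[OF k])
  qed
  then have "var k * y' \<in> mult_ops.op_sum var k (homog_int e)" using q' by (intro mult_ops.op_sumI[where q = q']) auto
  then have "y' \<in> mult_ops.op_sum var k (homog_int (e - 1))"
    using var_regular k y'(2) unfolding mult_ops.regular_seq_def by blast
  then obtain p where p: "y' = (\<Sum>v<k. var v * p v)" "\<forall>v<k. p v \<in> homog_int (e - 1)" by (rule mult_ops.op_sumE)
  have "y = (\<Sum>v<k. l v * subst l (p v))"
    using p y' k subst_var_mult[of _ l] by (simp add: subst.sum)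
  then show "y \<in> mult_ops.op_sum l k (homog_int (e - 1))"
    using p(2) subst_image[OF assms] by (intro mult_ops.op_sumI[where q = "\<lambda>v. subst l (p v)"]) auto
qed

section \<open>Graded free modules\<close>

text \<open>The structure of a free module as a vector space over the field; \<open>smul\<close> is its structure over the polynomial
ring.\<close>
definition field_scale :: "'k::field \<Rightarrow> ('v::finite, 'k) fmod \<Rightarrow> ('v, 'k) fmod" where
  "field_scale c u = smul (single 0 c) u"

lemma lookup_field_scale [simp]: "lookup (field_scale c u) x = smul c (lookup u x)"
  by (simp add: field_scale_def smul_eq_mult)

lemma vec_space_field_scale: "vec_space (field_scale :: 'k::field \<Rightarrow> ('v::finite, 'k) fmod \<Rightarrow> _)"
  by unfold_locales
    (rule poly_mapping_eqI, simp add: lookup_add poly_space.scale_right_distrib poly_space.scale_left_distrib)+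

interpretation free_space: vec_space "field_scale :: 'k::field \<Rightarrow> ('v::finite, 'k) fmod \<Rightarrow> _"
  by (rule vec_space_field_scale)

abbreviation (input) free_ops :: "(nat \<Rightarrow> ('v::finite, 'k::field) poly_ring) \<Rightarrow> nat \<Rightarrow> ('v, 'k) fmod \<Rightarrow> ('v, 'k) fmod" where
  "free_ops l \<equiv> (\<lambda>i u. smul (l i) u)"

interpretation poly_module: module "smul :: 'c::comm_ring_1 \<Rightarrow> ('b \<Rightarrow>\<^sub>0 'c) \<Rightarrow> _"
  by (rule module_smul)

lemma commuting_free_ops: "commuting_ops field_scale (free_ops l)"
  by unfold_locales
    (rule poly_mapping_eqI, simp add: lookup_add distrib_left smul_mult_right mult.left_commute)+

interpretation free_ops: commuting_ops "field_scale :: 'k \<Rightarrow> ('v::finite, 'k::field) fmod \<Rightarrow> _" "free_ops l" for l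
  by (rule commuting_free_ops)

text \<open>The component of integer degree \<open>e\<close> of the free module in homological position \<open>i\<close>.\<close>
definition free_graded :: "nat \<Rightarrow> (nat \<Rightarrow> nat) \<Rightarrow> int \<Rightarrow> ('v::finite, 'k::field) fmod set" where
  "free_graded i c e = {u. (\<forall>x. lookup u x \<noteq> 0 \<longrightarrow> snd x < c (fst x)) \<and> (\<forall>x. lookup u x \<in> homog_int (e - int i - int (fst x)))}"

lemma free_mod_iff: "u \<in> free_mod c \<longleftrightarrow> (\<forall>x. lookup u x \<noteq> 0 \<longrightarrow> snd x < c (fst x))"
  by (auto simp: free_mod_def in_keys_iff)

lemma free_graded_free_mod: "u \<in> free_graded i c e \<longleftrightarrow> u \<in> free_mod c \<and> (\<forall>x. lookup u x \<in> homog_int (e - int i - int (fst x)))"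
  by (auto simp: free_mod_iff free_graded_def)

lemma free_gradedD:
  "u \<in> free_graded i c e \<Longrightarrow> lookup u x \<in> homog_int (e - int i - int (fst x))"
  "u \<in> free_graded i c e \<Longrightarrow> lookup u x \<noteq> 0 \<Longrightarrow> snd x < c (fst x)"
  unfolding free_graded_def by blast+

lemma free_gradedI:
  "(\<And>x. lookup u x \<noteq> 0 \<Longrightarrow> snd x < c (fst x)) \<Longrightarrow> (\<And>x. lookup u x \<in> homog_int (e - int i - int (fst x)))
    \<Longrightarrow> u \<in> free_graded i c e"
  unfolding free_graded_def by blast

lemma free_mod_deg_eq_free_graded: "free_mod_deg i c e = (free_graded i c (int e) :: ('v::finite, 'k::field) fmod set)"
proof -
  have "u \<in> free_mod_deg i c e \<longleftrightarrow> u \<in> free_graded i c (int e)" for u :: "('v, 'k) fmod"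
  proof -
    have 1: "int (mdeg \<alpha>) = int e - int i - int j \<longleftrightarrow> mdeg \<alpha> + (i + j) = e" for \<alpha> :: "'v \<Rightarrow>\<^sub>0 nat" and j
      by linarith
    have "u \<in> free_mod_deg i c e \<longleftrightarrow> u \<in> free_mod c \<and> (\<forall>x\<in>keys u. lookup u x \<in> homog_int (int e - int i - int (fst x)))"
      unfolding free_mod_deg_def homog_int_def by (auto simp: 1)
    also have "\<dots> \<longleftrightarrow> u \<in> free_graded i c (int e)"
    proof -
      have "0 \<in> homog_int a" for a by (simp add: homog_int_def)
      then show ?thesis unfolding free_graded_free_mod by (metis in_keys_iff)
    qed
    finally show ?thesis .
  qed
  then show ?thesis by blast
qed

lemma free_mod_subspace: "free_space.subspace (free_mod c :: ('v::finite, 'k::field) fmod set)"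
proof (rule free_space.subspaceI)
  fix x y :: "('v, 'k) fmod" assume "x \<in> free_mod c" "y \<in> free_mod c"
  moreover have "lookup (x + y) a \<noteq> 0 \<Longrightarrow> lookup x a \<noteq> 0 \<or> lookup y a \<noteq> 0" for a by (auto simp: lookup_add)
  ultimately show "x + y \<in> free_mod c" unfolding free_mod_iff by blast
qed (auto simp: free_mod_iff)

lemma free_graded_subspace: "free_space.subspace (free_graded i c e :: ('v::finite, 'k::field) fmod set)"
proof (rule free_space.subspaceI)
  show "0 \<in> (free_graded i c e :: ('v::finite, 'k::field) fmod set)" 
    by (auto simp: free_graded_def poly_space.subspace_0[OF homog_int_subspace])
next
  fix x y :: "('v, 'k) fmod" assume "x \<in> free_graded i c e" "y \<in> free_graded i c e"
  then show "x + y \<in> free_graded i c e" using free_space.subspace_add[OF free_mod_subspace]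
    by (auto simp: free_graded_free_mod lookup_add intro!: poly_space.subspace_add[OF homog_int_subspace])
next
  fix a and x :: "('v, 'k) fmod" assume "x \<in> free_graded i c e"
  then show "field_scale a x \<in> free_graded i c e" using free_space.subspace_scale[OF free_mod_subspace]
    by (auto simp: free_graded_free_mod intro!: poly_space.subspace_scale[OF homog_int_subspace])
qed

lemma single_linear: "Vector_Spaces.linear smul field_scale (\<lambda>p. single x p)"
  by unfold_locales (auto simp: single_add intro!: poly_mapping_eqI simp: lookup_single when_def)

lemma free_graded_fin_dim: "free_space.fin_dim (free_graded i c e :: ('v::finite, 'k::field) fmod set)"
proof -
  interpret P: vec_space_pair "smul :: 'k \<Rightarrow> ('v, 'k) poly_ring \<Rightarrow> _" "field_scale :: 'k \<Rightarrow> ('v, 'k) fmod \<Rightarrow> _" ..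
  define X where "X = (SIGMA j:{..nat e}. {..<c j})"
  have X: "finite X" by (simp add: X_def)
  define N where "N x = (single x ` homog_int (e - int i - int (fst x)) :: ('v, 'k) fmod set)" for x :: "nat \<times> nat"
  interpret sl: Vector_Spaces.linear smul field_scale "\<lambda>p :: ('v, 'k) poly_ring. single x p" for x :: "nat \<times> nat"
    by (rule single_linear)
  have N1: "free_space.subspace (N x)" for x unfolding N_def by (rule sl.subspace_image[OF homog_int_subspace])
  have N2: "free_space.fin_dim (N x)" for x unfolding N_def by (rule P.fin_dim_image[OF single_linear homog_int_fin_dim])
  have "free_space.fin_dim (free_space.sum_family X N)" using free_space.sum_family_subspace_fin_dim[OF X, of N] N1 N2 by blast
  moreover have "free_graded i c e \<subseteq> free_space.sum_family X N"
  proof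
    fix u :: "('v, 'k) fmod" assume u: "u \<in> free_graded i c e"
    have "keys u \<subseteq> X"
    proof
      fix x assume "x \<in> keys u"
      then have nz: "lookup u x \<noteq> 0" by (simp add: in_keys_iff)
      have "lookup u x \<in> homog_int (e - int i - int (fst x))" using free_gradedD(1)[OF u] .
      then have "\<not> e - int i - int (fst x) < 0" using nz homog_int_neg by (metis singletonD)
      then have "fst x \<le> nat e" by linarith
      moreover have "snd x < c (fst x)" using free_gradedD(2)[OF u nz] .
      ultimately show "x \<in> X" by (cases x) (simp add: X_def)
    qed
    then have "u = (\<Sum>x\<in>X. single x (lookup u x))" using sum_singles[OF X, of u] by simp
    moreover have "\<forall>x\<in>X. single x (lookup u x) \<in> N x" unfolding N_def using free_gradedD(1)[OF u] by blast
    ultimately show "u \<in> free_space.sum_family X N" unfolding free_space.sum_family_def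
      by (intro CollectI exI[of _ "\<lambda>x. single x (lookup u x)"] conjI)
  qed
  ultimately show ?thesis by (rule free_space.fin_dim_subset)
qed

lemma free_graded_smul:
  assumes "u \<in> free_graded i c e" "p \<in> homog_int a"
  shows "smul p u \<in> free_graded i c (a + e)"
proof (rule free_gradedI)
  fix x
  show "lookup (smul p u) x \<noteq> 0 \<Longrightarrow> snd x < c (fst x)" using free_gradedD(2)[OF assms(1), of x] by force
  show "lookup (smul p u) x \<in> homog_int (a + e - int i - int (fst x))"
    using homog_int_mult[OF assms(2) free_gradedD(1)[OF assms(1)], of x] by (simp add: algebra_simps)
qed

lemma graded_module_free_graded:
  assumes "\<And>i. i < m \<Longrightarrow> l i \<in> homog_int 1"
  shows "free_ops.graded_module l m (free_graded i c)"
  unfolding free_ops.graded_module_def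
  using free_graded_subspace free_graded_fin_dim free_graded_smul assms by (fastforce simp: add.commute)

text \<open>Membership in the submodule generated by the first forms is checked on each coordinate.\<close>
lemma free_graded_op_sumI:
  fixes l :: "nat \<Rightarrow> ('v::finite, 'k::field) poly_ring"
  assumes "u \<in> free_graded i c e" "\<And>x. lookup u x \<in> mult_ops.op_sum l k (homog_int (e - 1 - int i - int (fst x)))"
  shows "u \<in> free_ops.op_sum l k (free_graded i c (e - 1))"
proof -
  have "single x (lookup u x) \<in> free_ops.op_sum l k (free_graded i c (e - 1))" if x: "x \<in> keys u" for x
  proof -
    obtain q where q: "lookup u x = (\<Sum>v<k. l v * q v)" "\<forall>v<k. q v \<in> homog_int (e - 1 - int i - int (fst x))"
      using assms(2)[of x] by (rule mult_ops.op_sumE)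
    interpret sl: Vector_Spaces.linear smul field_scale "\<lambda>p :: ('v, 'k) poly_ring. single x p" by (rule single_linear)
    have "snd x < c (fst x)" using assms(1) x by (auto simp: free_graded_def in_keys_iff)
    then have "single x (q v) \<in> free_graded i c (e - 1)" if "v < k" for v
      using q(2) that by (auto simp: free_graded_def lookup_single when_def poly_space.subspace_0[OF homog_int_subspace])
    moreover have "single x (lookup u x) = (\<Sum>v<k. smul (l v) (single x (q v)))"
      unfolding q(1) by (simp add: sl.sum)
    ultimately show ?thesis by (intro free_ops.op_sumI[where q = "\<lambda>v. single x (q v)"])
  qed
  then have "(\<Sum>x\<in>keys u. single x (lookup u x)) \<in> free_ops.op_sum l k (free_graded i c (e - 1))"
    by (intro free_space.subspace_sum[OF free_ops.op_sum_subspace[OF free_graded_subspace]])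
  then show ?thesis by (simp add: sum_singles)
qed

lemma free_graded_regular:
  fixes l :: "nat \<Rightarrow> ('v::finite, 'k::field) poly_ring"
  assumes "spanning_forms l"
  shows "free_ops.regular_seq l CARD('v) (free_graded i c)"
  unfolding free_ops.regular_seq_def
proof (intro allI impI ballI)
  fix k e and y :: "('v, 'k) fmod"
  assume k: "k < CARD('v)" and y: "y \<in> free_graded i c e" and ly: "smul (l k) y \<in> free_ops.op_sum l k (free_graded i c e)"
  from ly obtain q where q: "smul (l k) y = (\<Sum>v<k. smul (l v) (q v))" "\<forall>v<k. q v \<in> free_graded i c e"
    by (rule free_ops.op_sumE)
  show "y \<in> free_ops.op_sum l k (free_graded i c (e - 1))"
  proof (rule free_graded_op_sumI[OF y])
    fix x
    have "l k * lookup y x = (\<Sum>v<k. l v * lookup (q v) x)"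
      using arg_cong[OF q(1), of "\<lambda>u. lookup u x"] by (simp add: lookup_sum)
    then have "l k * lookup y x \<in> mult_ops.op_sum l k (homog_int (e - int i - int (fst x)))"
      by (rule mult_ops.op_sumI) (use q(2) free_gradedD(1) in blast)
    moreover have "lookup y x \<in> homog_int (e - int i - int (fst x))" using free_gradedD(1)[OF y] .
    ultimately have "lookup y x \<in> mult_ops.op_sum l k (homog_int (e - int i - int (fst x) - 1))"
      using forms_regular[OF assms] k unfolding mult_ops.regular_seq_def by blast
    then show "lookup y x \<in> mult_ops.op_sum l k (homog_int (e - 1 - int i - int (fst x)))" by (simp add: algebra_simps)
  qed
qed

lemma free_graded_no_constant:
  fixes l :: "nat \<Rightarrow> ('v::finite, 'k::field) poly_ring"
  assumes "spanning_forms l" "u \<in> free_graded i c e" "\<And>x. lookup (lookup u x) 0 = 0"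
  shows "u \<in> free_ops.op_sum l CARD('v) (free_graded i c (e - 1))"
proof (rule free_graded_op_sumI[OF assms(2)])
  fix x
  have "lookup u x \<in> homog_int (e - int i - int (fst x))" using free_gradedD(1)[OF assms(2)] .
  from op_sum_no_constant[OF assms(1) this assms(3)]
  show "lookup u x \<in> mult_ops.op_sum l CARD('v) (homog_int (e - 1 - int i - int (fst x)))" by (simp add: algebra_simps)
qed

lemma vec_space_field: "vec_space ((*) :: 'k::field \<Rightarrow> 'k \<Rightarrow> 'k)"
  by unfold_locales (auto simp: algebra_simps)

text \<open>In degree \<open>i + j\<close>, a free module modulo multiples of linear forms is given by the constant coefficients at the
\<open>c j\<close> basis elements of that degree.\<close>
lemma koszul_dim_free:
  fixes l :: "nat \<Rightarrow> ('v::finite, 'k::field) poly_ring"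
  assumes "spanning_forms l"
  shows "koszul_dim field_scale (free_ops l) CARD('v) 0 (free_graded i c) (int i + int j) = c j"
proof -
  interpret K: vec_space "(*) :: 'k \<Rightarrow> 'k \<Rightarrow> 'k" by (rule vec_space_field)
  interpret FK: vec_space "pointwise_scale (*) :: 'k \<Rightarrow> (nat \<Rightarrow> 'k) \<Rightarrow> _" by (rule vec_space_pointwise_scale[OF vec_space_field])
  interpret P: vec_space_pair "field_scale :: 'k \<Rightarrow> ('v, 'k) fmod \<Rightarrow> _" "pointwise_scale (*) :: 'k \<Rightarrow> (nat \<Rightarrow> 'k) \<Rightarrow> _" ..
  let ?e = "int i + int j"
  define f where "f u = (\<lambda>m. lookup (lookup u (j, m)) 0)" for u :: "('v, 'k) fmod"
  have lin: "Vector_Spaces.linear field_scale (pointwise_scale (*)) f"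
    by unfold_locales (auto simp: f_def fun_eq_iff lookup_add)
  have l1: "\<And>i. i < CARD('v) \<Longrightarrow> l i \<in> homog_int 1" using assms by (simp add: spanning_forms_def)
  note g = graded_module_free_graded[where l = l and m = "CARD('v)", OF l1]
  let ?Q = "free_ops.op_sum l CARD('v) (free_graded i c (?e - 1))"
  have QL: "?Q \<subseteq> free_graded i c ?e"
    by (rule free_ops.op_sum_least[OF free_graded_subspace]) (use free_ops.graded_moduleD(4)[OF g] in blast)
  have fQ: "f u = 0" if uQ: "u \<in> ?Q" for u
  proof -
    obtain q where q: "u = (\<Sum>v<CARD('v). smul (l v) (q v))" "\<forall>v<CARD('v). q v \<in> free_graded i c (?e - 1)"
      using uQ by (rule free_ops.op_sumE)
    have "lookup (q v) (j, m) = 0" if "v < CARD('v)" for v m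
    proof -
      have "lookup (q v) (j, m) \<in> homog_int (?e - 1 - int i - int (fst (j, m)))" using q(2) that free_gradedD(1) by blast
      also have "homog_int (?e - 1 - int i - int (fst (j, m))) = ({0} :: ('v, 'k) poly_ring set)" by (rule homog_int_neg) simp
      finally show ?thesis by simp
    qed
    then show ?thesis by (auto simp: f_def q(1) lookup_sum fun_eq_iff)
  qed
  have ker: "u \<in> ?Q" if "u \<in> free_graded i c ?e" "f u = 0" for u
  proof (rule free_graded_no_constant[OF assms that(1)])
    fix x :: "nat \<times> nat"
    show "lookup (lookup u x) 0 = 0"
    proof (cases "fst x = j")
      case True
      then show ?thesis using fun_cong[OF that(2), of "snd x"] by (cases x) (simp add: f_def)
    next
      case False
      have "lookup u x \<in> homog_int (?e - int i - int (fst x))" using free_gradedD(1)[OF that(1)] .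
      then show ?thesis using False by (force simp: homog_int_iff)
    qed
  qed
  have "free_space.dim (free_graded i c ?e :: ('v, 'k) fmod set) - free_space.dim ?Q = FK.dim (f ` free_graded i c ?e) - FK.dim (f ` ?Q)"
  proof (rule P.dim_diff_image[OF lin])
    show "free_space.subspace (free_graded i c ?e :: ('v, 'k) fmod set)" by (rule free_graded_subspace)
    show "free_space.fin_dim (free_graded i c ?e :: ('v, 'k) fmod set)" by (rule free_graded_fin_dim)
    show "free_space.subspace ?Q" by (rule free_ops.op_sum_subspace[OF free_graded_subspace])
  qed (use QL ker in auto)
  moreover have "FK.dim (f ` ?Q) = 0"
  proof -
    have "f ` ?Q \<subseteq> FK.span {}" using fQ by auto
    then have "FK.dim (f ` ?Q) \<le> card ({} :: (nat \<Rightarrow> 'k) set)" by (rule FK.dim_le_card) simp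
    then show ?thesis by simp
  qed
  moreover have "f ` free_graded i c ?e = {h :: nat \<Rightarrow> 'k. \<forall>T. h T \<in> K.span {1} \<and> (h T \<noteq> 0 \<longrightarrow> T \<in> {..<c j})}" (is "_ = ?H")
  proof (intro equalityI subsetI)
    fix h assume "h \<in> f ` free_graded i c ?e"
    then obtain u where u: "u \<in> free_graded i c ?e" "h = f u" by blast
    have "h m \<noteq> 0 \<Longrightarrow> m < c j" for m
    proof -
      assume "h m \<noteq> 0"
      then have "lookup u (j, m) \<noteq> 0" using u(2) by (auto simp: f_def)
      then have "snd (j, m) < c (fst (j, m))" using u(1) unfolding free_graded_def by blast
      then show ?thesis by simp
    qed
    moreover have "a \<in> K.span {1}" for a :: 'k by (auto simp: K.span_singleton)
    ultimately show "h \<in> ?H" by simp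
  next
    fix h assume h: "h \<in> ?H"
    define u where "u = (\<Sum>m<c j. single (j, m) (single 0 (h m)) :: ('v, 'k) fmod)"
    have lu: "lookup u x = (if fst x = j \<and> snd x < c j then single 0 (h (snd x)) else 0)" for x
    proof -
      have "lookup u x = (\<Sum>m<c j. if m = snd x then (if fst x = j then single 0 (h m) else 0) else 0)"
        unfolding u_def lookup_sum by (cases x, intro sum.cong) (auto simp: lookup_single when_def)
      then show ?thesis by (simp add: sum.delta)
    qed
    have "u \<in> free_graded i c ?e"
      unfolding free_graded_def by (auto simp: lu poly_space.subspace_0[OF homog_int_subspace] intro!: homog_int_single)
    moreover have "f u = h" using h by (auto simp: f_def lu fun_eq_iff)
    ultimately show "h \<in> f ` free_graded i c ?e" by blast
  qed
  ultimately show ?thesis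
    using free_ops.koszul_dim_0[OF g] K.dim_line_functions[of 1 "{..<c j}"] by simp
qed

section \<open>Contraction and homogeneous components\<close>

interpretation field_module: module "(*) :: 'k::comm_ring_1 \<Rightarrow> 'k \<Rightarrow> 'k"
  by unfold_locales (auto simp: algebra_simps)

interpretation coeff_extension: module_hom smul "(*)" "linear_extension (*) (G :: 'b \<Rightarrow> 'k::comm_ring_1)" for G
  by (rule field_module.linear_extension_hom)

text \<open>A form of the contraction action in which only addition of exponents occurs.\<close>
lemma lookup_contract:
  fixes f :: "('v::finite, 'k::field) div_pow"
  shows "lookup (contract D f) \<gamma> = linear_extension (*) (\<lambda>\<beta>. lookup f (\<beta> + \<gamma>)) D"
proof -
  have *: "(\<forall>v. lookup \<beta> v \<le> lookup \<alpha> v) \<and> \<alpha> - \<beta> = \<gamma> \<longleftrightarrow> \<alpha> = \<beta> + \<gamma>" for \<alpha> \<beta> :: "'v \<Rightarrow>\<^sub>0 nat"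
    by (auto simp: poly_mapping_eq_iff lookup_add lookup_minus fun_eq_iff) (metis le_add_diff_inverse)
  have "lookup (contract D f) \<gamma> = (\<Sum>\<beta>\<in>keys D. \<Sum>\<alpha>\<in>keys f. if \<alpha> = \<beta> + \<gamma> then lookup D \<beta> * lookup f \<alpha> else 0)"
    unfolding contract_def lookup_sum
  proof (intro sum.cong refl)
    fix \<beta> \<alpha>
    show "lookup (if \<forall>v. lookup \<beta> v \<le> lookup \<alpha> v then single (\<alpha> - \<beta>) (lookup D \<beta> * lookup f \<alpha>) else 0) \<gamma> =
        (if \<alpha> = \<beta> + \<gamma> then lookup D \<beta> * lookup f \<alpha> else 0)"
      unfolding *[symmetric] by (auto simp: lookup_single when_def)
  qed
  also have "\<dots> = (\<Sum>\<beta>\<in>keys D. lookup D \<beta> * lookup f (\<beta> + \<gamma>))"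
    by (intro sum.cong refl) (simp add: sum.delta' in_keys_iff)
  finally show ?thesis by (simp add: linear_extension_def)
qed

lemma contract_add_left: "contract (D + E) f = contract D f + contract E f"
  by (rule poly_mapping_eqI) (simp add: lookup_contract lookup_add coeff_extension.add)

lemma contract_smul_left: "contract (smul c D) f = smul c (contract D f)"
  by (rule poly_mapping_eqI) (simp add: lookup_contract coeff_extension.scale)

lemma contract_add_right: "contract D (f + g) = contract D f + contract D g"
  by (rule poly_mapping_eqI) (simp add: lookup_contract lookup_add linear_extension_def distrib_left sum.distrib)

lemma contract_smul_right: "contract D (smul c f) = smul c (contract D f)"
  by (rule poly_mapping_eqI) (simp only: lookup_contract linear_extension_def lookup_smul sum_distrib_left mult.left_commute)

lemma contract_linear_left: "Vector_Spaces.linear smul smul (\<lambda>D. contract D f)"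
  by unfold_locales (auto simp: contract_add_left contract_smul_left)

lemma contract_linear_right: "Vector_Spaces.linear smul smul (contract D)"
  by unfold_locales (auto simp: contract_add_right contract_smul_right)

interpretation contract_left: Vector_Spaces.linear smul smul "\<lambda>D. contract D f" for f
  by (rule contract_linear_left)

interpretation contract_right: Vector_Spaces.linear smul smul "contract D" for D
  by (rule contract_linear_right)

lemma lookup_contract_single: "lookup (contract (single \<beta> b) f) \<gamma> = b * lookup f (\<beta> + \<gamma>)"
  by (simp add: lookup_contract)

lemma contract_mult: "contract (D * E) f = contract D (contract E f)"
proof (induction D rule: poly_mapping_add_induct)
  case (single \<beta> b)
  show ?case
  proof (induction E rule: poly_mapping_add_induct)
    case (single \<delta> c)
    show ?case
      by (rule poly_mapping_eqI) (simp add: mult_single lookup_contract_single add.assoc[symmetric] add.commute[of \<beta> \<delta>])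
  qed (simp_all add: distrib_left contract_add_left contract_add_right)
qed (simp_all add: distrib_right contract_add_left)

lemma contract_one: "contract 1 f = f"
  by (rule poly_mapping_eqI) (use lookup_contract_single[of 0 1 f] in simp)

lemma contract_const: "contract (single 0 c) y = smul c y"
  using contract_smul_left[of c 1 y] by (simp add: contract_one smul_eq_mult)

lemma contract_homog_int:
  assumes "D \<in> homog_int a" "f \<in> homog_int b"
  shows "contract D f \<in> homog_int (b - a)"
  unfolding homog_int_iff
proof (intro allI impI)
  fix \<gamma> assume "lookup (contract D f) \<gamma> \<noteq> 0"
  then have "(\<Sum>\<beta>\<in>keys D. lookup D \<beta> * lookup f (\<beta> + \<gamma>)) \<noteq> 0" by (simp add: lookup_contract linear_extension_def)
  then obtain \<beta> where "\<beta> \<in> keys D" "lookup D \<beta> * lookup f (\<beta> + \<gamma>) \<noteq> 0" by (rule sum.not_neutral_contains_not_neutral)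
  then have "int (mdeg \<beta>) = a" "int (mdeg (\<beta> + \<gamma>)) = b" using assms by (auto simp: homog_int_def in_keys_iff)
  then show "int (mdeg \<gamma>) = b - a" by (simp add: mdeg_add)
qed

abbreviation (input) contract_ops :: "(nat \<Rightarrow> ('v::finite, 'k::field) poly_ring) \<Rightarrow> nat \<Rightarrow> ('v, 'k) div_pow \<Rightarrow> ('v, 'k) div_pow" where
  "contract_ops l \<equiv> (\<lambda>i y. contract (l i) y)"

lemma commuting_contract_ops: "commuting_ops smul (contract_ops l)"
  by unfold_locales (simp_all only: contract_add_right contract_smul_right contract_mult[symmetric] mult.commute)

interpretation contract_ops: commuting_ops "smul :: 'k \<Rightarrow> ('v::finite, 'k::field) div_pow \<Rightarrow> _" "contract_ops l" for l
  by (rule commuting_contract_ops)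

text \<open>The degree \<open>e\<close> component \<open>R\<^sub>e h\<close> of the module \<open>R h\<close>; it is isomorphic to that of \<open>R / ann h\<close> and lies in
degree \<open>d - e\<close> of the divided powers if \<open>h\<close> has degree \<open>d\<close>.\<close>
definition derivs_int :: "('v::finite, 'k::field) div_pow \<Rightarrow> int \<Rightarrow> ('v, 'k) div_pow set" where
  "derivs_int f e = (\<lambda>D. contract D f) ` homog_int e"

definition homog_component :: "int \<Rightarrow> (('v::finite \<Rightarrow>\<^sub>0 nat) \<Rightarrow>\<^sub>0 'k::field) \<Rightarrow> (('v \<Rightarrow>\<^sub>0 nat) \<Rightarrow>\<^sub>0 'k)" where
  "homog_component e p = (\<Sum>\<alpha>\<in>keys p. if int (mdeg \<alpha>) = e then single \<alpha> (lookup p \<alpha>) else 0)"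

lemma lookup_homog_component: "lookup (homog_component e p) \<alpha> = (if int (mdeg \<alpha>) = e then lookup p \<alpha> else 0)"
proof -
  have "lookup (homog_component e p) \<alpha> = (\<Sum>\<beta>\<in>keys p. if \<beta> = \<alpha> then (if int (mdeg \<alpha>) = e then lookup p \<alpha> else 0) else 0)"
    unfolding homog_component_def lookup_sum by (intro sum.cong) (auto simp: lookup_single when_def)
  also have "\<dots> = (if int (mdeg \<alpha>) = e then lookup p \<alpha> else 0)" by (simp add: sum.delta in_keys_iff)
  finally show ?thesis .
qed

lemma homog_component_add: "homog_component e (p + q) = homog_component e p + homog_component e q"
  by (rule poly_mapping_eqI) (simp add: lookup_homog_component lookup_add)

lemma homog_component_zero [simp]: "homog_component e 0 = 0"
  by (rule poly_mapping_eqI) (simp add: lookup_homog_component)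

lemma homog_component_homog_int: "homog_component e p \<in> homog_int e"
  by (simp add: homog_int_iff lookup_homog_component)

lemma homog_component_of_homog_int: "p \<in> homog_int e' \<Longrightarrow> homog_component e p = (if e = e' then p else 0)"
  by (rule poly_mapping_eqI) (auto simp: lookup_homog_component homog_int_iff)

definition free_component :: "nat \<Rightarrow> int \<Rightarrow> ('v::finite, 'k::field) fmod \<Rightarrow> ('v, 'k) fmod" where
  "free_component i e u = (\<Sum>x\<in>keys u. single x (homog_component (e - int i - int (fst x)) (lookup u x)))"

lemma lookup_free_component: "lookup (free_component i e u) x = homog_component (e - int i - int (fst x)) (lookup u x)"
proof -
  have "lookup (free_component i e u) x = (\<Sum>y\<in>keys u. if y = x then homog_component (e - int i - int (fst x)) (lookup u x) else 0)"
    unfolding free_component_def lookup_sum by (intro sum.cong) (auto simp: lookup_single when_def)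
  also have "\<dots> = homog_component (e - int i - int (fst x)) (lookup u x)" by (simp add: sum.delta in_keys_iff)
  finally show ?thesis .
qed

lemma free_component_add: "free_component i e (u + w) = free_component i e u + free_component i e w"
  by (rule poly_mapping_eqI) (simp add: lookup_free_component lookup_add homog_component_add)

lemma free_component_free_graded: "u \<in> free_mod c \<Longrightarrow> free_component i e u \<in> free_graded i c e"
proof (rule free_gradedI)
  fix x
  assume u: "u \<in> free_mod c"
  show "lookup (free_component i e u) x \<in> homog_int (e - int i - int (fst x))" by (simp add: lookup_free_component homog_component_homog_int)
  assume "lookup (free_component i e u) x \<noteq> 0"
  then have "lookup u x \<noteq> 0" by (auto simp: lookup_free_component)
  then show "snd x < c (fst x)" using u by (simp add: free_mod_iff)
qed

lemma free_component_of_free_graded: "u \<in> free_graded i c e' \<Longrightarrow> free_component i e u = (if e = e' then u else 0)"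
  by (rule poly_mapping_eqI) (auto simp: lookup_free_component homog_component_of_homog_int[OF free_gradedD(1)])

lemma free_component_decomp:
  fixes u :: "('v::finite, 'k::field) fmod"
  shows "\<exists>E. finite E \<and> u = (\<Sum>e\<in>E. free_component i e u) \<and> (\<forall>e. e \<notin> E \<longrightarrow> free_component i e u = 0)"
proof (intro exI conjI allI impI)
  let ?E = "\<Union>x\<in>keys u. (\<lambda>\<alpha>. int (mdeg \<alpha>) + int i + int (fst x)) ` keys (lookup u x)"
  show "finite ?E" by simp
  show z: "free_component i e u = 0" if "e \<notin> ?E" for e
  proof (intro poly_mapping_eqI)
    fix x \<alpha>
    show "lookup (lookup (free_component i e u) x) \<alpha> = lookup (lookup 0 x) \<alpha>"
    proof (rule ccontr)
      assume "lookup (lookup (free_component i e u) x) \<alpha> \<noteq> lookup (lookup 0 x) \<alpha>"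
      then have "int (mdeg \<alpha>) = e - int i - int (fst x)" "lookup (lookup u x) \<alpha> \<noteq> 0"
        by (auto simp: lookup_free_component lookup_homog_component split: if_splits)
      then have "e = int (mdeg \<alpha>) + int i + int (fst x)" "\<alpha> \<in> keys (lookup u x)" "x \<in> keys u"
        by (auto simp: in_keys_iff)
      then show False using that by blast
    qed
  qed
  show "u = (\<Sum>e\<in>?E. free_component i e u)"
  proof (intro poly_mapping_eqI)
    fix x :: "nat \<times> nat" and \<alpha> :: "'v \<Rightarrow>\<^sub>0 nat"
    let ?e = "int (mdeg \<alpha>) + int i + int (fst x)"
    have "lookup (lookup (\<Sum>e\<in>?E. free_component i e u) x) \<alpha> = (\<Sum>e\<in>?E. if e = ?e then lookup (lookup u x) \<alpha> else 0)"
      unfolding lookup_sum by (intro sum.cong) (auto simp: lookup_free_component lookup_homog_component)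
    also have "\<dots> = (if ?e \<in> ?E then lookup (lookup u x) \<alpha> else 0)" using \<open>finite ?E\<close> by (simp add: sum.delta)
    also have "\<dots> = lookup (lookup u x) \<alpha>"
    proof (cases "lookup (lookup u x) \<alpha> = 0")
      case False
      then have "\<alpha> \<in> keys (lookup u x)" "x \<in> keys u" by (auto simp: in_keys_iff)
      then have "?e \<in> ?E" by blast
      then show ?thesis by simp
    qed simp
    finally show "lookup (lookup u x) \<alpha> = lookup (lookup (\<Sum>e\<in>?E. free_component i e u) x) \<alpha>" by simp
  qed
qed

text \<open>A map that respects degrees commutes with taking homogeneous components. The hypothesis on \<open>c\<close> says that \<open>u\<close>
is a finite sum of components.\<close>
lemma graded_map_component:
  fixes F :: "'a::comm_monoid_add \<Rightarrow> 'b::comm_monoid_add"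
  assumes "F 0 = 0" "\<And>x y. F (x + y) = F x + F y"
    and "c' 0 = 0" "\<And>x y. c' (x + y) = c' x + c' y"
    and "\<exists>E. finite E \<and> u = (\<Sum>e\<in>E. c e u) \<and> (\<forall>e. e \<notin> E \<longrightarrow> c e u = 0)"
    and "\<And>e. c' (F (c e u)) = (if e = e0 then F (c e u) else 0)"
  shows "c' (F u) = F (c (e0 :: int) u)"
proof -
  obtain E where E: "finite E" "u = (\<Sum>e\<in>E. c e u)" "\<And>e. e \<notin> E \<Longrightarrow> c e u = 0" using assms(5) by blast
  have F: "F (\<Sum>e\<in>E. g e) = (\<Sum>e\<in>E. F (g e))" for g :: "int \<Rightarrow> 'a"
    by (induction E rule: infinite_finite_induct) (auto simp: assms)
  have c': "c' (\<Sum>e\<in>E. g e) = (\<Sum>e\<in>E. c' (g e))" for g :: "int \<Rightarrow> 'b"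
    by (induction E rule: infinite_finite_induct) (auto simp: assms)
  have "c' (F u) = c' (F (\<Sum>e\<in>E. c e u))" using E(2) by simp
  also have "\<dots> = (\<Sum>e\<in>E. if e = e0 then F (c e u) else 0)" by (simp add: F c' assms(6))
  also have "\<dots> = F (c e0 u)" using E(1,3) assms(1) by (auto simp: sum.delta)
  finally show ?thesis .
qed

lemma hom_component:
  assumes "module_hom smul smul F" "\<And>e u. u \<in> free_graded i' c' e \<Longrightarrow> F u \<in> free_graded i c e" "u \<in> free_mod c'"
  shows "free_component i e (F u) = F (free_component i' e u)"
proof -
  interpret F: module_hom smul smul F by fact
  show ?thesis
  proof (rule graded_map_component[where c = "free_component i'", OF F.zero F.add _ free_component_add free_component_decomp])
    show "free_component i e 0 = 0" by (rule poly_mapping_eqI) (simp add: lookup_free_component)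
    fix e'
    have "F (free_component i' e' u) \<in> free_graded i c e'" by (rule assms(2)[OF free_component_free_graded[OF assms(3)]])
    then show "free_component i e (F (free_component i' e' u)) = (if e' = e then F (free_component i' e' u) else 0)"
      by (auto simp: free_component_of_free_graded)
  qed
qed

lemma contract_component:
  assumes "module_hom smul (*) E" "\<And>e u. u \<in> free_graded 0 c e \<Longrightarrow> E u \<in> homog_int e" "u \<in> free_mod c" "f \<in> homog_int d"
  shows "homog_component (d - e) (contract (E u) f) = contract (E (free_component 0 e u)) f"
proof -
  interpret E: module_hom smul "(*)" E by fact
  show ?thesis
  proof (rule graded_map_component[where c = "free_component 0" and F = "\<lambda>u. contract (E u) f", OF _ _ homog_component_zero homog_component_add free_component_decomp])
    fix e'
    have "contract (E (free_component 0 e' u)) f \<in> homog_int (d - e')"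
      by (rule contract_homog_int[OF assms(2)[OF free_component_free_graded[OF assms(3)]] assms(4)])
    then show "homog_component (d - e) (contract (E (free_component 0 e' u)) f) = (if e' = e then contract (E (free_component 0 e' u)) f else 0)"
      by (auto simp: homog_component_of_homog_int)
  qed (simp_all add: E.zero E.add contract_add_left contract_left.zero)
qed

section \<open>Betti numbers as Koszul homology\<close>

lemma free_graded_neg: "e < 0 \<Longrightarrow> free_graded i c e = {0}"
proof (intro equalityI subsetI)
  fix u :: "('a, 'b) fmod" assume e: "e < 0" and u: "u \<in> free_graded i c e"
  have "lookup u x = 0" for x
    using free_gradedD(1)[OF u, of x] homog_int_neg[of "e - int i - int (fst x)"] e by auto
  then show "u \<in> {0}" by (simp add: poly_mapping_eqI)
qed (simp add: free_space.subspace_0[OF free_graded_subspace])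

lemma minimal_free_resolutionD:
  assumes "minimal_free_resolution I b \<phi> \<epsilon>"
  shows "module_hom smul (*) \<epsilon>"
    and "\<epsilon> ` free_mod_deg 0 (b 0) n \<subseteq> homog n"
    and "module_hom smul smul (\<phi> i)"
    and "\<phi> i ` free_mod_deg (Suc i) (b (Suc i)) n \<subseteq> free_mod_deg i (b i) n"
    and "\<exists>u\<in>free_mod (b 0). p - \<epsilon> u \<in> I"
    and "{u\<in>free_mod (b 0). \<epsilon> u \<in> I} = \<phi> 0 ` free_mod (b 1)"
    and "{u\<in>free_mod (b (Suc i)). \<phi> i u = 0} = \<phi> (Suc i) ` free_mod (b (Suc (Suc i)))"
    and "u \<in> free_mod (b (Suc i)) \<Longrightarrow> lookup (lookup (\<phi> i u) x) 0 = 0"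
proof -
  note c = assms[unfolded minimal_free_resolution_def]
  note c2 = c[THEN conjunct2] note c3 = c2[THEN conjunct2] note c4 = c3[THEN conjunct2]
  note c5 = c4[THEN conjunct2] note c6 = c5[THEN conjunct2] note c7 = c6[THEN conjunct2]
  note c8 = c7[THEN conjunct2]
  show "module_hom smul (*) \<epsilon>" by (rule c[THEN conjunct1])
  show "\<epsilon> ` free_mod_deg 0 (b 0) n \<subseteq> homog n" by (rule c2[THEN conjunct1, THEN spec])
  show "module_hom smul smul (\<phi> i)" by (rule c3[THEN conjunct1, THEN spec])
  show "\<phi> i ` free_mod_deg (Suc i) (b (Suc i)) n \<subseteq> free_mod_deg i (b i) n"
    by (rule c4[THEN conjunct1, THEN spec, THEN spec])
  show "\<exists>u\<in>free_mod (b 0). p - \<epsilon> u \<in> I" by (rule c5[THEN conjunct1, THEN spec])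
  show "{u\<in>free_mod (b 0). \<epsilon> u \<in> I} = \<phi> 0 ` free_mod (b 1)" by (rule c6[THEN conjunct1])
  show "{u\<in>free_mod (b (Suc i)). \<phi> i u = 0} = \<phi> (Suc i) ` free_mod (b (Suc (Suc i)))"
    by (rule c7[THEN conjunct1, THEN spec])
  show "u \<in> free_mod (b (Suc i)) \<Longrightarrow> lookup (lookup (\<phi> i u) x) 0 = 0"
    by (rule c8[THEN spec, THEN bspec, THEN spec])
qed

text \<open>The augmentation \<open>u \<mapsto> (\<epsilon> u) f\<close> turns a resolution of \<open>R / ann f\<close> into one of \<open>R f\<close>, so that all modules
in the sequence are subspaces and no quotients are needed.\<close>
locale resolution =
  fixes f :: "('v::finite, 'k::field) div_pow" and d :: nat
    and b :: "nat \<Rightarrow> nat \<Rightarrow> nat" and \<phi> :: "nat \<Rightarrow> ('v, 'k) fmod \<Rightarrow> ('v, 'k) fmod"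
    and \<epsilon> :: "('v, 'k) fmod \<Rightarrow> ('v, 'k) poly_ring"
  assumes f_homog: "f \<in> homog d" and res: "minimal_free_resolution (ann f) b \<phi> \<epsilon>"
begin

sublocale eps: module_hom smul "(*)" \<epsilon>
  by (rule minimal_free_resolutionD(1)[OF res])

sublocale phi: module_hom smul smul "\<phi> i" for i
  by (rule minimal_free_resolutionD(3)[OF res])

lemma phi_free_graded: "u \<in> free_graded (Suc i) (b (Suc i)) e \<Longrightarrow> \<phi> i u \<in> free_graded i (b i) e"
proof (cases "e < 0")
  case False
  then have "\<phi> i ` free_graded (Suc i) (b (Suc i)) (int (nat e)) \<subseteq> free_graded i (b i) (int (nat e))"
    using minimal_free_resolutionD(4)[OF res, of i "nat e"] by (simp only: free_mod_deg_eq_free_graded)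
  then show "u \<in> free_graded (Suc i) (b (Suc i)) e \<Longrightarrow> \<phi> i u \<in> free_graded i (b i) e" using False by auto
qed (simp add: free_graded_neg phi.zero)

lemma eps_homog_int: "u \<in> free_graded 0 (b 0) e \<Longrightarrow> \<epsilon> u \<in> homog_int e"
proof (cases "e < 0")
  case False
  then have "\<epsilon> ` free_graded 0 (b 0) (int (nat e)) \<subseteq> homog_int (int (nat e))"
    using minimal_free_resolutionD(2)[OF res, of "nat e"] by (simp only: free_mod_deg_eq_free_graded homog_eq_homog_int)
  then show "u \<in> free_graded 0 (b 0) e \<Longrightarrow> \<epsilon> u \<in> homog_int e" using False by auto
qed (simp add: free_graded_neg homog_int_neg eps.zero)

definition augmentation :: "('v, 'k) fmod \<Rightarrow> ('v, 'k) div_pow" where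
  "augmentation u = contract (\<epsilon> u) f"

definition syzygies :: "nat \<Rightarrow> int \<Rightarrow> ('v, 'k) fmod set" where
  "syzygies i e = \<phi> i ` free_graded (Suc i) (b (Suc i)) e"

lemma augmentation_add: "augmentation (u + w) = augmentation u + augmentation w"
  by (simp add: augmentation_def eps.add contract_add_left)

lemma augmentation_smul: "augmentation (smul p u) = contract p (augmentation u)"
  by (simp add: augmentation_def eps.scale contract_mult)

lemma augmentation_zero [simp]: "augmentation 0 = 0"
  using augmentation_add[of 0 0] by simp

lemma augmentation_linear: "Vector_Spaces.linear field_scale smul augmentation"
  by unfold_locales (simp_all add: augmentation_add field_scale_def augmentation_smul contract_const)

lemma phi_linear: "Vector_Spaces.linear field_scale field_scale (\<phi> i)"
  by unfold_locales (simp_all add: phi.add field_scale_def phi.scale)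

lemma f_homog_int: "f \<in> homog_int (int d)"
  using f_homog by (simp add: homog_eq_homog_int)

lemma augmentation_component:
  assumes "u \<in> free_mod (b 0)"
  shows "homog_component (int d - e) (augmentation u) = augmentation (free_component 0 e u)"
  unfolding augmentation_def by (rule contract_component[OF eps.module_hom_axioms eps_homog_int assms f_homog_int])

lemma phi_component:
  assumes "u \<in> free_mod (b (Suc i))"
  shows "free_component i e (\<phi> i u) = \<phi> i (free_component (Suc i) e u)"
  by (rule hom_component[OF phi.module_hom_axioms phi_free_graded assms])

lemma augmentation_image: "augmentation ` free_graded 0 (b 0) e = derivs_int f e"
proof (intro equalityI subsetI)
  fix y assume "y \<in> augmentation ` free_graded 0 (b 0) e"
  then show "y \<in> derivs_int f e" unfolding derivs_int_def augmentation_def using eps_homog_int by blast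
next
  fix y assume "y \<in> derivs_int f e"
  then obtain D where D: "D \<in> homog_int e" "y = contract D f" unfolding derivs_int_def by blast
  obtain u where u: "u \<in> free_mod (b 0)" "D - \<epsilon> u \<in> ann f"
    using minimal_free_resolutionD(5)[OF res] by blast
  have "y = augmentation u" using u(2) D(2) by (simp add: ann_def augmentation_def contract_left.diff)
  moreover have "y \<in> homog_int (int d - e)" unfolding D(2) by (rule contract_homog_int[OF D(1) f_homog_int])
  ultimately have "y = homog_component (int d - e) (augmentation u)" by (simp add: homog_component_of_homog_int)
  then have "y = augmentation (free_component 0 e u)" using augmentation_component[OF u(1)] by simp
  then show "y \<in> augmentation ` free_graded 0 (b 0) e" using free_component_free_graded[OF u(1)] by blast
qed

lemma augmentation_kernel: "{u \<in> free_graded 0 (b 0) e. augmentation u = 0} = syzygies 0 e"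
proof (intro equalityI subsetI)
  have ex: "{u \<in> free_mod (b 0). \<epsilon> u \<in> ann f} = \<phi> 0 ` free_mod (b 1)"
    by (rule minimal_free_resolutionD(6)[OF res])
  {
    fix u assume "u \<in> {u \<in> free_graded 0 (b 0) e. augmentation u = 0}"
    then have u: "u \<in> free_graded 0 (b 0) e" "augmentation u = 0" by auto
    then have "u \<in> free_mod (b 0)" "\<epsilon> u \<in> ann f" by (auto simp: free_graded_free_mod augmentation_def ann_def)
    then have "u \<in> \<phi> 0 ` free_mod (b 1)" unfolding ex[symmetric] by (intro CollectI conjI)
    then obtain w where w: "w \<in> free_mod (b (Suc 0))" "u = \<phi> 0 w" by auto
    have "u = free_component 0 e (\<phi> 0 w)" using u(1) w(2) by (simp add: free_component_of_free_graded)
    then have "u = \<phi> 0 (free_component 1 e w)" using phi_component[OF w(1)] by simp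
    then show "u \<in> syzygies 0 e" unfolding syzygies_def using free_component_free_graded[OF w(1)] by auto
  next
    fix u assume "u \<in> syzygies 0 e"
    then obtain w where w: "w \<in> free_graded 1 (b 1) e" "u = \<phi> 0 w" by (auto simp: syzygies_def)
    then have "u \<in> {u \<in> free_mod (b 0). \<epsilon> u \<in> ann f}" unfolding ex by (auto simp: free_graded_free_mod)
    then show "u \<in> {u \<in> free_graded 0 (b 0) e. augmentation u = 0}"
      using phi_free_graded[of w 0 e] w by (auto simp: augmentation_def ann_def)
  }
qed

lemma phi_kernel: "{u \<in> free_graded (Suc i) (b (Suc i)) e. \<phi> i u = 0} = syzygies (Suc i) e"
proof (intro equalityI subsetI)
  have ex: "{u \<in> free_mod (b (Suc i)). \<phi> i u = 0} = \<phi> (Suc i) ` free_mod (b (Suc (Suc i)))"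
    by (rule minimal_free_resolutionD(7)[OF res])
  {
    fix u assume "u \<in> {u \<in> free_graded (Suc i) (b (Suc i)) e. \<phi> i u = 0}"
    then have u: "u \<in> free_graded (Suc i) (b (Suc i)) e" "\<phi> i u = 0" by auto
    then have "u \<in> \<phi> (Suc i) ` free_mod (b (Suc (Suc i)))"
      unfolding ex[symmetric] by (intro CollectI conjI) (auto simp: free_graded_free_mod)
    then obtain w where w: "w \<in> free_mod (b (Suc (Suc i)))" "u = \<phi> (Suc i) w" by auto
    have "u = free_component (Suc i) e (\<phi> (Suc i) w)" using u(1) w(2) by (simp add: free_component_of_free_graded)
    then have "u = \<phi> (Suc i) (free_component (Suc (Suc i)) e w)" using phi_component[OF w(1)] by simp
    then show "u \<in> syzygies (Suc i) e" unfolding syzygies_def using free_component_free_graded[OF w(1)] by auto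
  next
    fix u assume "u \<in> syzygies (Suc i) e"
    then obtain w where w: "w \<in> free_graded (Suc (Suc i)) (b (Suc (Suc i))) e" "u = \<phi> (Suc i) w" by (auto simp: syzygies_def)
    then have "u \<in> {u \<in> free_mod (b (Suc i)). \<phi> i u = 0}" unfolding ex by (auto simp: free_graded_free_mod)
    then show "u \<in> {u \<in> free_graded (Suc i) (b (Suc i)) e. \<phi> i u = 0}"
      using phi_free_graded[of w "Suc i" e] w by auto
  }
qed

lemma syzygies_minimal: "u \<in> syzygies i e \<Longrightarrow> lookup (lookup u x) 0 = 0"
  using minimal_free_resolutionD(8)[OF res, of _ i x] by (auto simp: syzygies_def free_graded_free_mod)

context
  fixes l :: "nat \<Rightarrow> ('v, 'k) poly_ring"
  assumes l: "spanning_forms l"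
begin

lemma l_homog_int: "i < CARD('v) \<Longrightarrow> l i \<in> homog_int 1"
  using l by (simp add: spanning_forms_def)

interpretation gs0: graded_surjection field_scale "free_ops l" smul "contract_ops l" augmentation "CARD('v)" "free_graded 0 (b 0)" "derivs_int f"
proof (intro graded_surjection.intro graded_surjection_axioms.intro)
  show "commuting_ops field_scale (free_ops l)" by (rule commuting_free_ops)
  show "commuting_ops smul (contract_ops l)" by (rule commuting_contract_ops)
  show "Vector_Spaces.linear field_scale smul augmentation" by (rule augmentation_linear)
  show "free_ops.graded_module l CARD('v) (free_graded 0 (b 0))" by (rule graded_module_free_graded) (rule l_homog_int)
qed (simp_all only: augmentation_smul augmentation_image)

interpretation gs: graded_surjection field_scale "free_ops l" field_scale "free_ops l" "\<phi> i" "CARD('v)" "free_graded (Suc i) (b (Suc i))" "syzygies i" for i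
proof (intro graded_surjection.intro graded_surjection_axioms.intro)
  show "commuting_ops field_scale (free_ops l)" by (rule commuting_free_ops)
  show "Vector_Spaces.linear field_scale field_scale (\<phi> i)" by (rule phi_linear)
  show "free_ops.graded_module l CARD('v) (free_graded (Suc i) (b (Suc i)))" by (rule graded_module_free_graded) (rule l_homog_int)
qed (simp_all only: phi.scale syzygies_def commuting_free_ops)

lemma ker0: "gs0.ker = syzygies 0"
  unfolding gs0.ker_def augmentation_kernel ..

lemma ker: "gs.ker i = syzygies (Suc i)"
  unfolding gs.ker_def phi_kernel ..

text \<open>Minimality of the resolution, in the form in which the dimension shift uses it.\<close>
lemma syzygies_op_sum: "u \<in> syzygies i e \<Longrightarrow> u \<in> free_ops.op_sum l CARD('v) (free_graded i (b i) (e - 1))"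
  by (rule free_graded_no_constant[OF l _ syzygies_minimal]) (auto simp: syzygies_def phi_free_graded)

lemma koszul_dim_syzygies_shift: "koszul_dim field_scale (free_ops l) CARD('v) (Suc p) (syzygies i) e = koszul_dim field_scale (free_ops l) CARD('v) p (syzygies (Suc i)) (e + 1)"
  using gs.koszul_dim_shift_minimal[OF free_graded_regular[OF l], of i p e] syzygies_op_sum by (simp add: ker)

lemma koszul_dim_syzygies: "koszul_dim field_scale (free_ops l) CARD('v) p (syzygies i) e = koszul_dim field_scale (free_ops l) CARD('v) 0 (syzygies (i + p)) (e + int p)"
proof (induction p arbitrary: i e)
  case (Suc p)
  show ?case unfolding koszul_dim_syzygies_shift Suc by (simp add: algebra_simps)
qed simp

text \<open>Shifting \<open>p\<close> times leads to homological degree \<open>0\<close> of the \<open>p\<close>-th syzygy module, whose minimal generators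
are those of the \<open>p\<close>-th free module.\<close>
theorem betti_eq_koszul_dim: "b p j = koszul_dim smul (contract_ops l) CARD('v) p (derivs_int f) (int j)"
proof (cases p)
  case 0
  have "koszul_dim smul (contract_ops l) CARD('v) 0 (derivs_int f) (int j) = koszul_dim field_scale (free_ops l) CARD('v) 0 (free_graded 0 (b 0)) (int j)"
    by (rule gs0.koszul_dim_0_cover) (use syzygies_op_sum in \<open>simp add: ker0\<close>)
  then show ?thesis using koszul_dim_free[OF l, of 0 "b 0" j] 0 by simp
next
  case (Suc q)
  have "koszul_dim smul (contract_ops l) CARD('v) (Suc q) (derivs_int f) (int j) = koszul_dim field_scale (free_ops l) CARD('v) q (syzygies 0) (int j + 1)"
    using gs0.koszul_dim_shift_minimal[OF free_graded_regular[OF l], of q "int j"] syzygies_op_sum by (simp add: ker0)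
  also have "\<dots> = koszul_dim field_scale (free_ops l) CARD('v) 0 (syzygies q) (int j + 1 + int q)"
    by (simp add: koszul_dim_syzygies[of q 0])
  also have "\<dots> = koszul_dim field_scale (free_ops l) CARD('v) 0 (free_graded (Suc q) (b (Suc q))) (int j + 1 + int q)"
    by (rule gs.koszul_dim_0_cover, rule syzygies_op_sum) (simp only: ker)
  also have "int j + 1 + int q = int (Suc q) + int j" by simp
  finally show ?thesis using koszul_dim_free[OF l, of "Suc q" "b (Suc q)" j] Suc by simp
qed

end

end

section \<open>Existence of minimal free resolutions\<close>

text \<open>The components of a graded submodule of the free module in position \<open>i\<close>. The last clause says that it
consists of relations with coefficients in the maximal ideal.\<close>
definition graded_submodule :: "nat \<Rightarrow> (nat \<Rightarrow> nat) \<Rightarrow> (int \<Rightarrow> ('v::finite, 'k::field) fmod set) \<Rightarrow> bool" where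
  "graded_submodule i c Z \<longleftrightarrow> (\<forall>e. Z e \<subseteq> free_graded i c e \<and> free_space.subspace (Z e)) \<and>
     (\<forall>e a p u. p \<in> homog_int a \<longrightarrow> u \<in> Z e \<longrightarrow> smul p u \<in> Z (a + e)) \<and>
     (\<forall>e u x. u \<in> Z e \<longrightarrow> lookup (lookup u x) 0 = 0)"

lemma graded_submoduleD:
  assumes "graded_submodule i c Z"
  shows "Z e \<subseteq> free_graded i c e" "free_space.subspace (Z e)" "p \<in> homog_int a \<Longrightarrow> u \<in> Z e \<Longrightarrow> smul p u \<in> Z (a + e)"
    "u \<in> Z e \<Longrightarrow> lookup (lookup u x) 0 = 0"
  using assms unfolding graded_submodule_def by blast+

lemma graded_submodule_low:
  assumes "graded_submodule i c Z" "e \<le> int i"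
  shows "Z e = {0}"
proof (intro equalityI subsetI)
  fix u assume u: "u \<in> Z e"
  then have uf: "u \<in> free_graded i c e" using graded_submoduleD(1)[OF assms(1)] by blast
  have "lookup (lookup u x) \<alpha> = 0" for x \<alpha>
  proof (rule ccontr)
    assume nz: "lookup (lookup u x) \<alpha> \<noteq> 0"
    then have "int (mdeg \<alpha>) = e - int i - int (fst x)" using free_gradedD(1)[OF uf, of x] by (simp add: homog_int_iff)
    then have "mdeg \<alpha> = 0" using assms(2) by linarith
    then have "\<alpha> = 0" by (simp add: mdeg_eq_0_iff)
    then show False using nz graded_submoduleD(4)[OF assms(1) u] by simp
  qed
  then have "u = 0" by (intro poly_mapping_eqI) simp
  then show "u \<in> {0}" by simp
qed (simp add: free_space.subspace_0[OF graded_submoduleD(2)[OF assms(1)]])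

text \<open>In each degree choose a basis of \<open>Z\<close> modulo the multiples of elements of lower degree, and send the basis
elements of a new free module to these. The map is onto by induction on the degree. A relation whose
coefficient at some generator had a nonzero constant term would express a nontrivial combination of the
chosen generators by multiples of elements of lower degree. Every \<open>Z e\<close> has finite dimension, so finitely many
generators are chosen in each degree.\<close>
lemma minimal_cover:
  fixes Z :: "int \<Rightarrow> ('v::finite, 'k::field) fmod set"
  assumes Z: "graded_submodule i c Z"
  shows "\<exists>c' F. module_hom smul smul F \<and> (\<forall>e. F ` free_graded (Suc i) c' e = Z e) \<and>
    graded_submodule (Suc i) c' (\<lambda>e. {u \<in> free_graded (Suc i) c' e. F u = 0})"
proof -
  let ?r = "CARD('v)"
  let ?x = "var :: nat \<Rightarrow> ('v, 'k) poly_ring"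
  let ?mZ = "\<lambda>e. free_ops.op_sum ?x ?r (Z (e - 1))"
  note subZ = graded_submoduleD(2)[OF Z]
  have ZX: "smul (?x v) u \<in> Z e" if "u \<in> Z (e - 1)" for v u e
    using graded_submoduleD(3)[OF Z var_homog_int that, of v] by simp
  define P where "P e n G \<longleftrightarrow> (\<forall>m<n. G m \<in> Z e) \<and>
      (\<forall>z\<in>Z e. \<exists>a w. w \<in> ?mZ e \<and> z = (\<Sum>m<n. field_scale (a m) (G m)) + w) \<and>
      (\<forall>a. (\<Sum>m<n. field_scale (a m) (G m)) \<in> ?mZ e \<longrightarrow> (\<forall>m<n. a m = 0))"
    for e and n :: nat and G
  have ex: "\<exists>n G. P e n G" for e
    unfolding P_def
  proof (rule free_space.complement_basis[OF free_ops.op_sum_subspace[OF subZ] _ subZ])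
    show "?mZ e \<subseteq> Z e" by (rule free_ops.op_sum_least[OF subZ]) (rule ZX)
    show "free_space.fin_dim (Z e)" by (rule free_space.fin_dim_subset[OF free_graded_fin_dim graded_submoduleD(1)[OF Z]])
  qed
  define n where "n e = (SOME n. \<exists>G. P e n G)" for e
  define G where "G e = (SOME G. P e (n e) G)" for e
  have "\<exists>G. P e (n e) G" for e unfolding n_def using ex[of e] by (rule someI_ex)
  then have P: "P e (n e) (G e)" for e unfolding G_def by (rule someI_ex)
  have GZ: "m < n e \<Longrightarrow> G e m \<in> Z e" for e m
    using P[of e] unfolding P_def by blast
  have Gspan: "z \<in> Z e \<Longrightarrow> \<exists>a w. w \<in> ?mZ e \<and> z = (\<Sum>m<n e. field_scale (a m) (G e m)) + w" for e z
    using P[of e] unfolding P_def by (elim conjE) (rule bspec)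
  have Gind: "(\<Sum>m<n e. field_scale (a m) (G e m)) \<in> ?mZ e \<Longrightarrow> m < n e \<Longrightarrow> a m = 0" for e a m
  proof -
    assume a: "(\<Sum>m<n e. field_scale (a m) (G e m)) \<in> ?mZ e" and m: "m < n e"
    have "\<forall>m<n e. a m = 0"
      by (rule P[of e, unfolded P_def, THEN conjunct2, THEN conjunct2, THEN spec, THEN mp, OF a])
    then show "a m = 0" using m by blast
  qed
  define c' where "c' j = n (int (Suc i) + int j)" for j
  define F where "F = linear_extension smul (\<lambda>x. G (int (Suc i) + int (fst x)) (snd x))"
  have homF: "module_hom smul smul F" unfolding F_def by (rule poly_module.linear_extension_hom)
  interpret F: module_hom smul smul F by (rule homF)
  have Fsingle: "F (single x p) = smul p (G (int (Suc i) + int (fst x)) (snd x))" for x p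
    unfolding F_def by (rule poly_module.linear_extension_single)
  have F_in: "F u \<in> Z e" if u: "u \<in> free_graded (Suc i) c' e" for u e
  proof -
    have "F u = (\<Sum>x\<in>keys u. smul (lookup u x) (G (int (Suc i) + int (fst x)) (snd x)))"
      by (simp add: F_def linear_extension_def)
    also have "\<dots> \<in> Z e"
    proof (rule free_space.subspace_sum[OF subZ])
      fix x assume "x \<in> keys u"
      then have "snd x < c' (fst x)" using free_gradedD(2)[OF u] by (simp add: in_keys_iff)
      then have "G (int (Suc i) + int (fst x)) (snd x) \<in> Z (int (Suc i) + int (fst x))"
        by (intro GZ) (simp add: c'_def)
      from graded_submoduleD(3)[OF Z free_gradedD(1)[OF u, of x] this]
      show "smul (lookup u x) (G (int (Suc i) + int (fst x)) (snd x)) \<in> Z e" by simp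
    qed
    finally show ?thesis .
  qed
  have xsmul: "smul (?x v) u \<in> free_graded (Suc i) c' e" if "u \<in> free_graded (Suc i) c' (e - 1)" for u v e
    using free_graded_smul[OF that var_homog_int, of v] by simp
  have const_in: "(\<Sum>m<c' j. single (j, m) (single 0 (a m))) \<in> free_graded (Suc i) c' (int (Suc i) + int j)" for j a
    by (intro free_space.subspace_sum[OF free_graded_subspace] free_gradedI)
      (auto simp: lookup_single when_def poly_space.subspace_0[OF homog_int_subspace] intro!: homog_int_single split: if_splits)
  have F_const: "F (\<Sum>m<c' j. single (j, m) (single 0 (a m))) = (\<Sum>m<c' j. field_scale (a m) (G (int (Suc i) + int j) m))" for j a
    by (simp add: F.sum Fsingle field_scale_def)
  have F_surj_nat: "Z (int i + int t) \<subseteq> F ` free_graded (Suc i) c' (int i + int t)" for t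
  proof (induction t)
    case 0
    have "Z (int i + int 0) = {0}" by (rule graded_submodule_low[OF Z]) simp
    moreover have "0 \<in> F ` free_graded (Suc i) c' (int i + int 0)"
      using free_space.subspace_0[OF free_graded_subspace] F.zero by (metis imageI)
    ultimately show ?case by simp
  next
    case (Suc t)
    let ?e = "int (Suc i) + int t"
    have e: "int i + int (Suc t) = ?e" "?e - 1 = int i + int t" by auto
    show ?case unfolding e(1)
    proof
      fix z assume "z \<in> Z ?e"
      then obtain a w where w: "w \<in> ?mZ ?e" and z: "z = (\<Sum>m<n ?e. field_scale (a m) (G ?e m)) + w"
        using Gspan by blast
      from w obtain q where q: "w = (\<Sum>v<?r. smul (?x v) (q v))" "\<forall>v<?r. q v \<in> Z (?e - 1)"
        by (rule free_ops.op_sumE)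
      have "\<forall>v. \<exists>q'. v < ?r \<longrightarrow> q' \<in> free_graded (Suc i) c' (?e - 1) \<and> q v = F q'"
        using q(2) Suc unfolding e(2) by blast
      then obtain q' where q': "\<And>v. v < ?r \<Longrightarrow> q' v \<in> free_graded (Suc i) c' (?e - 1) \<and> q v = F (q' v)" by metis
      let ?u = "(\<Sum>m<c' t. single (t, m) (single 0 (a m))) + (\<Sum>v<?r. smul (?x v) (q' v))"
      have "F (\<Sum>v<?r. smul (?x v) (q' v)) = w" using q(1) q' by (simp add: F.sum F.scale)
      then have "F ?u = z" unfolding z by (simp only: F.add F_const) (simp only: c'_def)
      moreover have "(\<Sum>v<?r. smul (?x v) (q' v)) \<in> free_graded (Suc i) c' ?e"
        using q' xsmul by (intro free_space.subspace_sum[OF free_graded_subspace]) auto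
      then have "?u \<in> free_graded (Suc i) c' ?e" by (rule free_space.subspace_add[OF free_graded_subspace const_in])
      ultimately show "z \<in> F ` free_graded (Suc i) c' ?e" by blast
    qed
  qed
  have F_surj: "F ` free_graded (Suc i) c' e = Z e" for e
  proof
    show "F ` free_graded (Suc i) c' e \<subseteq> Z e" using F_in by blast
    show "Z e \<subseteq> F ` free_graded (Suc i) c' e"
    proof (cases "e \<le> int i")
      case True
      have "0 \<in> F ` free_graded (Suc i) c' e"
        using free_space.subspace_0[OF free_graded_subspace] F.zero by (metis imageI)
      then show ?thesis using graded_submodule_low[OF Z True] by simp
    next
      case False
      then show ?thesis using F_surj_nat[of "nat (e - int i)"] by simp
    qed
  qed
  have F_min: "lookup (lookup u x) 0 = 0" if u: "u \<in> free_graded (Suc i) c' e" and Fu: "F u = 0" for u e x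
  proof (rule ccontr)
    assume nz: "lookup (lookup u x) 0 \<noteq> 0"
    define j where "j = fst x"
    have "int (mdeg (0 :: 'v \<Rightarrow>\<^sub>0 nat)) = e - int (Suc i) - int j"
      using free_gradedD(1)[OF u, of x] nz unfolding homog_int_iff j_def by blast
    then have e: "e = int (Suc i) + int j" by simp
    define a where "a m = lookup (lookup u (j, m)) 0" for m
    \<comment> \<open>The part of \<open>u\<close> with constant coefficients. The rest is a combination of linear forms, so \<open>F\<close> maps it to
    multiples of elements of lower degree.\<close>
    let ?u0 = "\<Sum>m<c' j. single (j, m) (single 0 (a m))"
    have l0: "lookup ?u0 y = (if fst y = j \<and> snd y < c' j then single 0 (a (snd y)) else 0)" for y
    proof -
      have "lookup ?u0 y = (\<Sum>m<c' j. if m = snd y then (if fst y = j then single 0 (a m) else 0) else 0)"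
        unfolding lookup_sum by (cases y, intro sum.cong) (auto simp: lookup_single when_def)
      then show ?thesis by (auto simp: sum.delta)
    qed
    have u0: "?u0 \<in> free_graded (Suc i) c' e" unfolding e by (rule const_in)
    have "u - ?u0 \<in> free_ops.op_sum ?x ?r (free_graded (Suc i) c' (e - 1))"
    proof (rule free_graded_no_constant[OF spanning_var free_space.subspace_diff[OF free_graded_subspace u u0]])
      fix y :: "nat \<times> nat"
      show "lookup (lookup (u - ?u0) y) 0 = 0"
      proof (cases "fst y = j")
        case True
        then have y: "y = (j, snd y)" by (metis prod.collapse)
        show ?thesis
        proof (cases "snd y < c' j")
          case True
          have "lookup (lookup u y) 0 = a (snd y)" unfolding a_def using y by simp
          then show ?thesis using True \<open>fst y = j\<close> by (simp add: lookup_minus l0)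
        next
          case False
          then have "lookup u y = 0" using free_gradedD(2)[OF u, of y] \<open>fst y = j\<close> by auto
          then show ?thesis using False by (simp add: lookup_minus l0)
        qed
      next
        case False
        have "lookup (lookup u y) 0 = 0"
        proof (rule ccontr)
          assume "lookup (lookup u y) 0 \<noteq> 0"
          then have "int (mdeg (0 :: 'v \<Rightarrow>\<^sub>0 nat)) = e - int (Suc i) - int (fst y)"
            using free_gradedD(1)[OF u, of y] unfolding homog_int_iff by blast
          then show False using False e by simp
        qed
        then show ?thesis using False by (simp add: lookup_minus l0)
      qed
    qed
    then obtain q where q: "u - ?u0 = (\<Sum>v<?r. smul (?x v) (q v))" "\<forall>v<?r. q v \<in> free_graded (Suc i) c' (e - 1)"
      by (rule free_ops.op_sumE)
    have "F (u - ?u0) = (\<Sum>v<?r. smul (?x v) (F (q v)))" by (simp only: q(1) F.sum F.scale)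
    moreover have "F (q v) \<in> Z (e - 1)" if "v < ?r" for v using q(2) that F_in by blast
    ultimately have "F (u - ?u0) \<in> ?mZ e" by (rule free_ops.op_sumI)
    then have "- F (u - ?u0) \<in> ?mZ e" by (rule free_space.subspace_neg[OF free_ops.op_sum_subspace[OF subZ]])
    moreover have "- F (u - ?u0) = F ?u0" using Fu by (simp add: F.diff)
    ultimately have "(\<Sum>m<c' j. field_scale (a m) (G (int (Suc i) + int j) m)) \<in> ?mZ (int (Suc i) + int j)"
      unfolding e F_const by simp
    moreover have "snd x < c' j" using free_gradedD(2)[OF u, of x] nz unfolding j_def by fastforce
    ultimately have "a (snd x) = 0" using Gind[where e = "int (Suc i) + int j"] unfolding c'_def by blast
    then show False using nz by (simp add: a_def j_def)
  qed
  have "graded_submodule (Suc i) c' (\<lambda>e. {u \<in> free_graded (Suc i) c' e. F u = 0})"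
    unfolding graded_submodule_def
  proof (intro conjI allI impI)
    fix e
    show "free_space.subspace {u \<in> free_graded (Suc i) c' e. F u = 0}"
      using free_graded_subspace[of "Suc i" c' e] by (auto simp: free_space.subspace_def F.zero F.add F.scale field_scale_def)
  qed (use F_min free_graded_smul F.scale in auto)
  then show ?thesis using homF F_surj by blast
qed

text \<open>Exactness in each degree implies exactness, as elements are finite sums of their components.\<close>
lemma kernel_eq_image:
  assumes F: "module_hom smul smul F" and im: "\<And>e. F ` free_graded i' c' e = Z e"
    and Z: "\<And>e u. u \<in> Z e \<Longrightarrow> u \<in> free_graded i c e \<and> u \<in> K"
    and K: "free_space.subspace K" "K \<subseteq> free_mod c"
    and comp: "\<And>e u. u \<in> K \<Longrightarrow> free_component i e u \<in> Z e"
  shows "K = F ` free_mod c'"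
proof (intro equalityI subsetI)
  interpret F: module_hom smul smul F by fact
  fix u assume u: "u \<in> K"
  obtain E where E: "finite E" "u = (\<Sum>e\<in>E. free_component i e u)" using free_component_decomp by blast
  have "\<forall>e. \<exists>w. w \<in> free_graded i' c' e \<and> free_component i e u = F w" using comp[OF u] im by blast
  then obtain w where w: "\<And>e. w e \<in> free_graded i' c' e \<and> free_component i e u = F (w e)" by metis
  have "(\<Sum>e\<in>E. w e) \<in> free_mod c'"
    using w by (intro free_space.subspace_sum[OF free_mod_subspace]) (simp add: free_graded_free_mod)
  moreover have "u = F (\<Sum>e\<in>E. w e)" using E(2) w by (simp add: F.sum)
  ultimately show "u \<in> F ` free_mod c'" by blast
next
  interpret F: module_hom smul smul F by fact
  fix u assume "u \<in> F ` free_mod c'"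
  then obtain w where w: "w \<in> free_mod c'" "u = F w" by blast
  obtain E where E: "finite E" "w = (\<Sum>e\<in>E. free_component i' e w)" using free_component_decomp by blast
  have "F (free_component i' e w) \<in> K" for e using Z im free_component_free_graded[OF w(1)] by blast
  then have "(\<Sum>e\<in>E. F (free_component i' e w)) \<in> K" by (intro free_space.subspace_sum[OF K(1)])
  moreover have "u = (\<Sum>e\<in>E. F (free_component i' e w))" unfolding F.sum[symmetric] E(2)[symmetric] by (rule w(2))
  ultimately show "u \<in> K" by simp
qed

text \<open>Start with \<open>R \<longrightarrow> R / ann f\<close>, or with the zero module if \<open>f = 0\<close>, and cover the kernel minimally again and
again.\<close>
theorem minimal_free_resolution_exists:
  fixes f :: "('v::finite, 'k::field) div_pow"
  assumes "f \<in> homog d"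
  shows "\<exists>b \<phi> \<epsilon>. minimal_free_resolution (ann f) b \<phi> \<epsilon>"
proof -
  have f: "f \<in> homog_int (int d)" using assms by (simp add: homog_eq_homog_int)
  \<comment> \<open>A basis element of the first free module would violate minimality if \<open>f = 0\<close>.\<close>
  define c0 where "c0 j = (if j = 0 \<and> f \<noteq> 0 then 1 else (0::nat))" for j :: nat
  define \<epsilon> where "\<epsilon> u = lookup u (0, 0)" for u :: "('v, 'k) fmod"
  have eps: "module_hom smul (*) \<epsilon>"
    unfolding \<epsilon>_def by unfold_locales (auto simp: algebra_simps lookup_add)
  interpret eps: module_hom smul "(*)" \<epsilon> by (rule eps)
  have eps_homog_int: "\<epsilon> u \<in> homog_int e" if "u \<in> free_graded 0 c0 e" for u e
    using free_gradedD(1)[OF that, of "(0, 0)"] by (simp add: \<epsilon>_def)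
  have zero: "lookup u x = 0" if "u \<in> free_mod c0" "x \<noteq> (0, 0) \<or> f = 0" for u :: "('v, 'k) fmod" and x
  proof (rule ccontr)
    assume "lookup u x \<noteq> 0"
    then have "snd x < c0 (fst x)" using that(1) by (simp add: free_mod_iff)
    then show False using that(2) by (cases x) (auto simp: c0_def split: if_splits)
  qed
  define Z0 where "Z0 e = {u \<in> free_graded 0 c0 e. contract (\<epsilon> u) f = 0}" for e
  have Z0: "graded_submodule 0 c0 Z0"
    unfolding graded_submodule_def
  proof (intro conjI allI impI)
    fix e
    show "Z0 e \<subseteq> free_graded 0 c0 e" by (auto simp: Z0_def)
    show "free_space.subspace (Z0 e)"
      using free_graded_subspace[of 0 c0 e]
      by (auto simp: Z0_def free_space.subspace_def eps.zero eps.add eps.scale field_scale_def contract_add_left contract_mult contract_left.zero contract_right.zero)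
    fix a and p :: "('v, 'k) poly_ring" and u assume "p \<in> homog_int a" "u \<in> Z0 e"
    then show "smul p u \<in> Z0 (a + e)" using free_graded_smul by (auto simp: Z0_def eps.scale contract_mult contract_right.zero)
  next
    fix e u and x :: "nat \<times> nat" assume u: "u \<in> Z0 e"
    then have ufg: "u \<in> free_graded 0 c0 e" by (simp add: Z0_def)
    then have uf: "u \<in> free_mod c0" by (simp add: free_graded_free_mod)
    show "lookup (lookup u x) 0 = 0"
    proof (rule ccontr)
      assume nz: "lookup (lookup u x) 0 \<noteq> 0"
      then have "lookup u x \<noteq> 0" by auto
      then have x: "x = (0, 0)" "f \<noteq> 0" using zero[OF uf, of x] by blast+
      have deg: "lookup u x \<in> homog_int e" using free_gradedD(1)[OF ufg, of x] x by simp
      then have "e = 0" using nz by (force simp: homog_int_iff)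
      have "lookup u x = single 0 (lookup (lookup u x) 0)"
      proof (rule poly_mapping_eqI)
        fix \<alpha>
        show "lookup (lookup u x) \<alpha> = lookup (single 0 (lookup (lookup u x) 0)) \<alpha>"
          using deg \<open>e = 0\<close> by (cases "\<alpha> = 0") (auto simp: homog_int_iff lookup_single mdeg_eq_0_iff)
      qed
      then have "contract (\<epsilon> u) f = smul (lookup (lookup u x) 0) f"
        using contract_smul_left[of "lookup (lookup u x) 0" 1 f] x by (simp add: \<epsilon>_def contract_one smul_eq_mult)
      then show False using u nz x poly_space.scale_eq_0_iff by (auto simp: Z0_def)
    qed
  qed
  have "\<exists>st. \<forall>n. graded_submodule n (fst (st n)) (snd (st n)) \<and> (n = 0 \<longrightarrow> st n = (c0, Z0)) \<and>
      (\<exists>F. module_hom smul smul F \<and> (\<forall>e. F ` free_graded (Suc n) (fst (st (Suc n))) e = snd (st n) e) \<and>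
        snd (st (Suc n)) = (\<lambda>e. {u \<in> free_graded (Suc n) (fst (st (Suc n))) e. F u = 0}))"
  proof -
    define P where "P n st \<longleftrightarrow> graded_submodule n (fst st) (snd st) \<and> (n = 0 \<longrightarrow> st = (c0, Z0))"
      for n and st :: "(nat \<Rightarrow> nat) \<times> (int \<Rightarrow> ('v, 'k) fmod set)"
    define Q where "Q n st st' \<longleftrightarrow> (\<exists>F. module_hom smul smul F \<and>
        (\<forall>e. F ` free_graded (Suc n) (fst st') e = snd st e) \<and>
        snd st' = (\<lambda>e. {u \<in> free_graded (Suc n) (fst st') e. F u = 0}))"
      for n and st st' :: "(nat \<Rightarrow> nat) \<times> (int \<Rightarrow> ('v, 'k) fmod set)"
    have "\<exists>st. \<forall>n. P n (st n) \<and> Q n (st n) (st (Suc n))"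
    proof (rule dependent_nat_choice)
      show "\<exists>x. P 0 x" by (rule exI[of _ "(c0, Z0)"]) (simp add: P_def Z0)
    next
      fix x n assume "P n x"
      then obtain c' F where F: "module_hom smul smul F" "\<forall>e. F ` free_graded (Suc n) c' e = snd x e"
        "graded_submodule (Suc n) c' (\<lambda>e. {u \<in> free_graded (Suc n) c' e. F u = 0})"
        using minimal_cover[of n "fst x" "snd x"] unfolding P_def by blast
      let ?y = "(c', \<lambda>e. {u \<in> free_graded (Suc n) c' e. F u = 0})"
      have "P (Suc n) ?y" using F(3) by (simp add: P_def)
      moreover have "Q n x ?y" unfolding Q_def using F(1,2) by (intro exI[of _ F]) simp
      ultimately show "\<exists>y. P (Suc n) y \<and> Q n x y" by blast
    qed
    then show ?thesis unfolding P_def Q_def by simp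
  qed
  then obtain st where st: "\<forall>n. graded_submodule n (fst (st n)) (snd (st n)) \<and> (n = 0 \<longrightarrow> st n = (c0, Z0)) \<and>
      (\<exists>F. module_hom smul smul F \<and> (\<forall>e. F ` free_graded (Suc n) (fst (st (Suc n))) e = snd (st n) e) \<and>
        snd (st (Suc n)) = (\<lambda>e. {u \<in> free_graded (Suc n) (fst (st (Suc n))) e. F u = 0}))" ..
  define b where "b n = fst (st n)" for n
  define Z where "Z n = snd (st n)" for n
  have Zg: "graded_submodule n (b n) (Z n)" for n using st by (simp add: b_def Z_def)
  have bZ0: "b 0 = c0" "Z 0 = Z0" using st by (simp_all add: b_def Z_def)
  have "\<forall>n. \<exists>F. module_hom smul smul F \<and> (\<forall>e. F ` free_graded (Suc n) (b (Suc n)) e = Z n e) \<and>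
        Z (Suc n) = (\<lambda>e. {u \<in> free_graded (Suc n) (b (Suc n)) e. F u = 0})"
    using st by (simp add: b_def Z_def)
  from choice[OF this] obtain \<phi> where \<phi>: "\<forall>n. module_hom smul smul (\<phi> n) \<and>
      (\<forall>e. \<phi> n ` free_graded (Suc n) (b (Suc n)) e = Z n e) \<and>
        Z (Suc n) = (\<lambda>e. {u \<in> free_graded (Suc n) (b (Suc n)) e. \<phi> n u = 0})" ..
  have hom: "module_hom smul smul (\<phi> n)" for n using \<phi> by blast
  have im: "\<phi> n ` free_graded (Suc n) (b (Suc n)) e = Z n e" for n e using \<phi> by blast
  have ZSuc: "Z (Suc n) e = {u \<in> free_graded (Suc n) (b (Suc n)) e. \<phi> n u = 0}" for n e using \<phi> by metis
  have free_graded_im: "\<phi> n u \<in> free_graded n (b n) e" if "u \<in> free_graded (Suc n) (b (Suc n)) e" for n e u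
    using im[of n e] that graded_submoduleD(1)[OF Zg] by blast
  have min: "lookup (lookup (\<phi> n u) x) 0 = 0" if u: "u \<in> free_mod (b (Suc n))" for n u x
  proof -
    interpret F: module_hom smul smul "\<phi> n" by (rule hom)
    obtain E where E: "finite E" "u = (\<Sum>e\<in>E. free_component (Suc n) e u)" using free_component_decomp by blast
    have "\<phi> n (free_component (Suc n) e u) \<in> Z n e" for e using im[of n e] free_component_free_graded[OF u] by blast
    then have "lookup (lookup (\<phi> n (free_component (Suc n) e u)) x) 0 = 0" for e by (rule graded_submoduleD(4)[OF Zg])
    then have "lookup (lookup (\<Sum>e\<in>E. \<phi> n (free_component (Suc n) e u)) x) 0 = 0" by (simp add: lookup_sum)
    then show ?thesis unfolding F.sum[symmetric] E(2)[symmetric] .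
  qed
  have ex0: "{u\<in>free_mod (b 0). \<epsilon> u \<in> ann f} = \<phi> 0 ` free_mod (b (Suc 0))"
  proof (rule kernel_eq_image[OF hom im, where i = 0 and c = c0])
    show "\<And>e u. u \<in> Z 0 e \<Longrightarrow> u \<in> free_graded 0 c0 e \<and> u \<in> {u \<in> free_mod (b 0). \<epsilon> u \<in> ann f}"
      by (auto simp: bZ0 Z0_def free_graded_free_mod ann_def)
    show "free_space.subspace {u \<in> free_mod (b 0). \<epsilon> u \<in> ann f}"
      using free_mod_subspace[of "b 0"]
      by (auto simp: ann_def free_space.subspace_def eps.zero eps.add eps.scale field_scale_def contract_add_left contract_mult contract_left.zero contract_right.zero)
    show "{u \<in> free_mod (b 0). \<epsilon> u \<in> ann f} \<subseteq> free_mod c0" by (auto simp: bZ0)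
    fix e u assume "u \<in> {u \<in> free_mod (b 0). \<epsilon> u \<in> ann f}"
    then have u: "u \<in> free_mod c0" "contract (\<epsilon> u) f = 0" by (auto simp: bZ0 ann_def)
    have "contract (\<epsilon> (free_component 0 e u)) f = 0"
      using contract_component[OF eps eps_homog_int u(1) f, where e = e] u(2) by simp
    then show "free_component 0 e u \<in> Z 0 e" using free_component_free_graded[OF u(1)] by (simp add: bZ0 Z0_def)
  qed
  have ex: "{u\<in>free_mod (b (Suc n)). \<phi> n u = 0} = \<phi> (Suc n) ` free_mod (b (Suc (Suc n)))" for n
  proof (rule kernel_eq_image[OF hom im, where i = "Suc n" and c = "b (Suc n)"])
    interpret F: module_hom smul smul "\<phi> n" by (rule hom)
    show "\<And>e u. u \<in> Z (Suc n) e \<Longrightarrow> u \<in> free_graded (Suc n) (b (Suc n)) e \<and> u \<in> {u \<in> free_mod (b (Suc n)). \<phi> n u = 0}"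
      by (auto simp: ZSuc free_graded_free_mod)
    show "free_space.subspace {u \<in> free_mod (b (Suc n)). \<phi> n u = 0}"
      using free_mod_subspace[of "b (Suc n)"] by (auto simp: free_space.subspace_def F.zero F.add F.scale field_scale_def)
    show "{u \<in> free_mod (b (Suc n)). \<phi> n u = 0} \<subseteq> free_mod (b (Suc n))" by auto
    fix e u assume u: "u \<in> {u \<in> free_mod (b (Suc n)). \<phi> n u = 0}"
    then have uf: "u \<in> free_mod (b (Suc n))" by simp
    have "free_component n e (0 :: ('v, 'k) fmod) = 0" by (rule poly_mapping_eqI) (simp add: lookup_free_component)
    moreover have "free_component n e (\<phi> n u) = \<phi> n (free_component (Suc n) e u)"
      by (rule hom_component[OF hom free_graded_im uf])
    ultimately have "\<phi> n (free_component (Suc n) e u) = 0" using u by simp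
    then show "free_component (Suc n) e u \<in> Z (Suc n) e" using free_component_free_graded[OF uf] by (simp add: ZSuc)
  qed
  have surj: "\<exists>u\<in>free_mod (b 0). p - \<epsilon> u \<in> ann f" for p
  proof (cases "f = 0")
    case True
    then show ?thesis
      using free_space.subspace_0[OF free_mod_subspace] by (intro bexI[of _ 0]) (auto simp: ann_def contract_right.zero)
  next
    case False
    then have "single (0, 0) p \<in> free_mod (b 0)"
      by (auto simp: free_mod_iff bZ0 c0_def lookup_single when_def split: if_splits)
    moreover have "p - \<epsilon> (single (0, 0) p) \<in> ann f" by (simp add: \<epsilon>_def ann_def contract_left.zero)
    ultimately show ?thesis by blast
  qed
  have "minimal_free_resolution (ann f) b \<phi> \<epsilon>"
    unfolding minimal_free_resolution_def
  proof (intro conjI allI ballI)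
    show "module_hom smul (*) \<epsilon>" by (rule eps)
    show "\<epsilon> ` free_mod_deg 0 (b 0) e \<subseteq> homog e" for e
      using eps_homog_int by (auto simp: free_mod_deg_eq_free_graded homog_eq_homog_int bZ0)
    show "module_hom smul smul (\<phi> i)" for i by (rule hom)
    show "\<phi> i ` free_mod_deg (Suc i) (b (Suc i)) e \<subseteq> free_mod_deg i (b i) e" for i e
      using free_graded_im by (auto simp: free_mod_deg_eq_free_graded)
    show "\<exists>u\<in>free_mod (b 0). p - \<epsilon> u \<in> ann f" for p by (rule surj)
    show "{u \<in> free_mod (b 0). \<epsilon> u \<in> ann f} = \<phi> 0 ` free_mod (b 1)" using ex0 by simp
    show "{u \<in> free_mod (b (Suc i)). \<phi> i u = 0} = \<phi> (Suc i) ` free_mod (b (Suc (Suc i)))" for i by (rule ex)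
    show "u \<in> free_mod (b (Suc i)) \<Longrightarrow> lookup (lookup (\<phi> i u) x) 0 = 0" for i u x by (rule min)
  qed
  then show ?thesis by blast
qed

text \<open>Koszul homology is determined by \<open>f\<close>, so all minimal resolutions have the same ranks and the definite
description in \<open>shifted_betti\<close> denotes them.\<close>
theorem shifted_betti_eq_koszul_dim:
  fixes f :: "('v::finite, 'k::field) div_pow"
  assumes f: "f \<in> homog d" and l: "spanning_forms l"
  shows "shifted_betti (ann f) k j =
    (if k < 0 \<or> k > int CARD('v) then 0 else koszul_dim smul (contract_ops l) CARD('v) (nat k) (derivs_int f) (int j))"
proof -
  have b: "b = (\<lambda>p j. koszul_dim smul (contract_ops l') CARD('v) p (derivs_int f) (int j))"
    if "minimal_free_resolution (ann f) b \<phi> \<epsilon>" "spanning_forms l'" for b \<phi> \<epsilon> l'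
  proof -
    interpret resolution f d b \<phi> \<epsilon> by unfold_locales (rule f that(1))+
    show ?thesis using betti_eq_koszul_dim[OF that(2)] by (intro ext)
  qed
  obtain b \<phi> \<epsilon> where res: "minimal_free_resolution (ann f) b \<phi> \<epsilon>"
    using minimal_free_resolution_exists[OF f] by blast
  have "(THE b. \<exists>\<phi> \<epsilon>. minimal_free_resolution (ann f) b \<phi> \<epsilon>) = b"
  proof (rule the_equality)
    show "\<exists>\<phi> \<epsilon>. minimal_free_resolution (ann f) b \<phi> \<epsilon>" using res by blast
    fix b' assume "\<exists>\<phi> \<epsilon>. minimal_free_resolution (ann f) b' \<phi> \<epsilon>"
    then obtain \<phi>' \<epsilon>' where "minimal_free_resolution (ann f) b' \<phi>' \<epsilon>'" by blast
    from b[OF this l] b[OF res l] show "b' = b" by simp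
  qed
  then show ?thesis unfolding shifted_betti_def using b[OF res l] by simp
qed

section \<open>The contraction pairing and adapted linear forms\<close>

lemma homog_int_0_const: "y \<in> homog_int 0 \<Longrightarrow> y = single 0 (lookup y 0)"
proof (rule poly_mapping_eqI)
  fix \<alpha> assume "y \<in> homog_int 0"
  then show "lookup y \<alpha> = lookup (single 0 (lookup y 0)) \<alpha>"
    by (cases "\<alpha> = 0") (auto simp: homog_int_iff lookup_single mdeg_eq_0_iff)
qed

lemma one_homog_int: "(1 :: ('v::finite, 'k::field) poly_ring) \<in> homog_int 0"
  using homog_int_single[of 0 0 "1::'k"] by simp

lemma nondeg_step:
  fixes y :: "('v::finite, 'k::field) div_pow"
  assumes "y \<in> homog_int a" "a \<ge> 1" "\<And>i. i < CARD('v) \<Longrightarrow> contract (var i) y = 0"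
  shows "y = 0"
proof (rule poly_mapping_eqI)
  fix \<alpha>
  show "lookup y \<alpha> = lookup 0 \<alpha>"
  proof (rule ccontr)
    assume nz: "lookup y \<alpha> \<noteq> lookup 0 \<alpha>"
    then have "int (mdeg \<alpha>) = a" using assms(1) by (simp add: homog_int_iff)
    then have "\<alpha> \<noteq> 0" using assms(2) by auto
    then obtain v where v: "lookup \<alpha> v \<noteq> 0" by (auto simp: poly_mapping_eq_iff fun_eq_iff)
    obtain i where i: "i < CARD('v)" "var_enum i = v" using var_enum_surj by blast
    have \<alpha>: "single (var_enum i) (Suc 0) + (\<alpha> - single (var_enum i) (Suc 0)) = \<alpha>"
      by (rule poly_mapping_eqI) (use v i in \<open>auto simp: lookup_add lookup_minus lookup_single when_def\<close>)
    have "lookup (contract (var i) y) (\<alpha> - single (var_enum i) (Suc 0)) = lookup y \<alpha>"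
      unfolding var_def lookup_contract_single \<alpha> by simp
    then show False using assms(3)[OF i(1)] nz by simp
  qed
qed

text \<open>The contraction pairing in equal degrees is nondegenerate, since monomials pair with the dual monomials. For
smaller \<open>n\<close> apply the variables one at a time.\<close>
lemma nondeg:
  fixes y :: "('v::finite, 'k::field) div_pow"
  shows "y \<in> homog_int a \<Longrightarrow> int n \<le> a \<Longrightarrow> (\<And>D. D \<in> homog_int (int n) \<Longrightarrow> contract D y = 0) \<Longrightarrow> y = 0"
proof (induction n arbitrary: y a)
  case 0
  then show ?case using contract_one[of y] one_homog_int by fastforce
next
  case (Suc n)
  show ?case
  proof (rule nondeg_step[OF Suc.prems(1)])
    show "1 \<le> a" using Suc.prems(2) by simp
    fix i assume "i < CARD('v)"
    show "contract (var i) y = 0"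
    proof (rule Suc.IH)
      show "contract (var i) y \<in> homog_int (a - 1)" by (rule contract_homog_int[OF var_homog_int Suc.prems(1)])
      show "int n \<le> a - 1" using Suc.prems(2) by simp
      fix D :: "('v, 'k) poly_ring" assume "D \<in> homog_int (int n)"
      then have "D * var i \<in> homog_int (int (Suc n))" using homog_int_mult[OF _ var_homog_int, of D "int n" i] by (simp add: add.commute)
      from Suc.prems(3)[OF this] show "contract D (contract (var i) y) = 0" by (simp add: contract_mult)
    qed
  qed
qed

lemma single_Suc_0_eq_iff: "single a (Suc 0) = single b (Suc 0) \<longleftrightarrow> a = b"
proof
  assume "single a (Suc 0) = single b (Suc 0)"
  then have "lookup (single a (Suc 0)) a = lookup (single b (Suc 0)) a" by simp
  then show "a = b" by (auto simp: lookup_single when_def split: if_splits)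
qed simp

lemma linear_form_expansion:
  fixes y :: "('v::finite, 'k::field) div_pow"
  assumes "y \<in> homog_int 1"
  shows "y = (\<Sum>v<CARD('v). smul (lookup (contract (var v) y) 0) (var v))"
proof -
  have "lookup y 0 = 0" using assms by (force simp: homog_int_iff)
  from op_sum_var_no_constant[OF assms this]
  have "y \<in> mult_ops.op_sum var CARD('v) (homog_int 0)" by simp
  then obtain q where q: "y = (\<Sum>v<CARD('v). var v * q v)" "\<forall>v<CARD('v). q v \<in> homog_int 0" by (rule mult_ops.op_sumE)
  have y: "y = (\<Sum>v<CARD('v). smul (lookup (q v) 0) (var v))"
    unfolding q(1)
  proof (rule sum.cong[OF refl])
    fix v assume "v \<in> {..<CARD('v)}"
    then have "q v = single 0 (lookup (q v) 0)" using q(2) homog_int_0_const by blast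
    then show "var v * q v = smul (lookup (q v) 0) (var v)" by (metis smul_eq_mult mult.commute)
  qed
  have "lookup (contract (var w) y) 0 = lookup (q w) 0" if w: "w < CARD('v)" for w
  proof -
    have d: "lookup (contract (var w) (var v :: ('v, 'k) div_pow)) 0 = (if v = w then 1 else (0 :: 'k))" if "v < CARD('v)" for v
      using var_enum_inj[OF w that]
      by (auto simp: var_def lookup_contract_single lookup_single when_def single_Suc_0_eq_iff)
    have "lookup (contract (var w) y) 0 = (\<Sum>v<CARD('v). lookup (q v) 0 * lookup (contract (var w) (var v :: ('v, 'k) div_pow)) 0)"
      unfolding y by (simp add: contract_right.sum contract_right.scale lookup_sum)
    also have "\<dots> = (\<Sum>v<CARD('v). if v = w then lookup (q v) 0 else 0)"
      using d by (intro sum.cong) auto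
    finally show ?thesis using w by (simp add: sum.delta)
  qed
  then have "(\<Sum>v<CARD('v). smul (lookup (contract (var v) y) 0) (var v)) =
      (\<Sum>v<CARD('v). smul (lookup (q v) 0) (var v :: ('v, 'k) div_pow))"
    by (intro sum.cong) auto
  then show ?thesis using y by (simp only:)
qed

text \<open>The linear operators are the dual space of the divided powers of degree one.\<close>
lemma functional_form:
  fixes \<psi> :: "('v::finite, 'k::field) div_pow \<Rightarrow> 'k"
  assumes "Vector_Spaces.linear smul (*) \<psi>"
  shows "\<exists>D\<in>homog_int 1. \<forall>y\<in>homog_int 1. lookup (contract D y) 0 = \<psi> y"
proof (intro bexI ballI)
  interpret \<psi>: Vector_Spaces.linear smul "(*)" \<psi> by fact
  let ?D = "\<Sum>v<CARD('v). smul (\<psi> (var v)) (var v) :: ('v, 'k) poly_ring"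
  show "?D \<in> homog_int 1" by (intro poly_space.subspace_sum[OF homog_int_subspace] poly_space.subspace_scale[OF homog_int_subspace] var_homog_int)
  fix y :: "('v, 'k) div_pow" assume y: "y \<in> homog_int 1"
  have "\<psi> y = \<psi> (\<Sum>v<CARD('v). smul (lookup (contract (var v) y) 0) (var v))"
    by (rule arg_cong[OF linear_form_expansion[OF y]])
  then show "lookup (contract ?D y) 0 = \<psi> y"
    by (simp add: \<psi>.sum \<psi>.scale contract_left.sum contract_left.scale lookup_sum mult.commute)
qed

lemma form_eqI:
  fixes D :: "('v::finite, 'k::field) poly_ring"
  assumes D: "D \<in> homog_int 1" and z: "\<And>y. y \<in> homog_int 1 \<Longrightarrow> lookup (contract D y) 0 = 0"
  shows "D = 0"
proof -
  have "lookup (contract (var v :: ('v, 'k) poly_ring) D) 0 = 0" for v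
  proof -
    have "lookup (contract (var v :: ('v, 'k) poly_ring) D) 0 = lookup D (single (var_enum v) (Suc 0))"
      by (simp add: var_def lookup_contract_single)
    also have "\<dots> = lookup (contract D (var v)) 0"
    proof -
      have "lookup (contract D (var v)) 0 = (\<Sum>\<beta>\<in>keys D. lookup D \<beta> * lookup (var v) \<beta>)"
        by (simp add: lookup_contract linear_extension_def)
      also have "\<dots> = (\<Sum>\<beta>\<in>keys D. if \<beta> = single (var_enum v) (Suc 0) then lookup D \<beta> else 0)"
        by (intro sum.cong) (auto simp: var_def lookup_single when_def)
      finally show ?thesis by (simp add: sum.delta in_keys_iff)
    qed
    also have "\<dots> = 0" by (rule z[OF var_homog_int])
    finally show ?thesis .
  qed
  then show ?thesis using linear_form_expansion[OF D] by simp
qed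

lemma dim_homog_int_1: "poly_space.dim (homog_int 1 :: ('v::finite, 'k::field) poly_ring set) = CARD('v)"
proof -
  let ?x = "var :: nat \<Rightarrow> ('v, 'k) poly_ring"
  have inj: "inj_on ?x {..<CARD('v)}"
    using var_enum_inj[where 'v = 'v] by (intro inj_onI) (drule arg_cong[of _ _ keys], simp add: var_def single_Suc_0_eq_iff)
  have key: "c v = 0" if "(\<Sum>v<CARD('v). smul (c v) (?x v)) = 0" "v < CARD('v)" for c v
  proof -
    have "lookup (\<Sum>w<CARD('v). smul (c w) (?x w)) (single (var_enum v) (Suc 0)) = (\<Sum>w<CARD('v). if w = v then c w else 0)"
      unfolding lookup_sum
    proof (rule sum.cong[OF refl])
      fix w assume "w \<in> {..<CARD('v)}"
      then have "(var_enum w :: 'v) = var_enum v \<longleftrightarrow> w = v" using var_enum_inj[of w v, where 'v = 'v] that(2) by simp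
      then show "lookup (smul (c w) (?x w)) (single (var_enum v) (Suc 0)) = (if w = v then c w else 0)"
        by (auto simp: var_def lookup_single when_def single_Suc_0_eq_iff)
    qed
    then show ?thesis using that by simp
  qed
  have "poly_space.independent (?x ` {..<CARD('v)})"
  proof (rule poly_space.independent_if_scalars_zero)
    fix c x assume "(\<Sum>x\<in>?x ` {..<CARD('v)}. smul (c x) x) = 0" "x \<in> ?x ` {..<CARD('v)}"
    then show "c x = 0" using key[of "\<lambda>v. c (?x v)"] by (auto simp: sum.reindex[OF inj])
  qed simp
  moreover have "homog_int 1 \<subseteq> poly_space.span (?x ` {..<CARD('v)})"
  proof
    fix y :: "('v, 'k) poly_ring" assume "y \<in> homog_int 1"
    then have "y = (\<Sum>v<CARD('v). smul (lookup (contract (var v) y) 0) (var v))" by (rule linear_form_expansion)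
    also have "\<dots> \<in> poly_space.span (?x ` {..<CARD('v)})" by (intro poly_space.span_sum poly_space.span_scale poly_space.span_base) auto
    finally show "y \<in> poly_space.span (?x ` {..<CARD('v)})" .
  qed
  moreover have "?x ` {..<CARD('v)} \<subseteq> homog_int 1" using var_homog_int by auto
  ultimately have "poly_space.dim (homog_int 1 :: ('v, 'k) poly_ring set) = card (?x ` {..<CARD('v)})"
    using poly_space.basis_card_eq_dim by metis
  then show ?thesis by (simp add: card_image[OF inj])
qed

text \<open>Extend a basis of \<open>U\<close> to a basis \<open>c\<close> of the elements of degree one and let \<open>l\<close> be the dual basis. The set
\<open>B\<close> indexes the basis elements in \<open>U\<close>, so the forms outside \<open>B\<close> vanish on \<open>U\<close>.\<close>
lemma adapted_forms:
  fixes U :: "('v::finite, 'k::field) div_pow set"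
  assumes U: "poly_space.subspace U" "U \<subseteq> homog_int 1"
  shows "\<exists>l c B. spanning_forms l \<and> B \<subseteq> {..<CARD('v)} \<and> card B = poly_space.dim U \<and>
    (\<forall>v\<in>B. c v \<in> U) \<and>
    (\<forall>v<CARD('v). \<forall>w<CARD('v). lookup (contract (l v) (c w)) 0 = (if v = w then 1 else 0)) \<and>
    (\<forall>v<CARD('v). v \<notin> B \<longrightarrow> (\<forall>y\<in>U. lookup (contract (l v) y) 0 = 0))"
proof -
  let ?r = "CARD('v)"
  interpret P: vector_space_pair "smul :: 'k \<Rightarrow> ('v, 'k) div_pow \<Rightarrow> _" "(*) :: 'k \<Rightarrow> 'k \<Rightarrow> 'k"
    using vec_space_field vec_space_smul by (intro vector_space_pair.intro) (simp_all add: vec_space_def)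
  have Uf: "poly_space.fin_dim U" by (rule poly_space.fin_dim_subset[OF homog_int_fin_dim U(2)])
  obtain A where A: "finite A" "poly_space.independent A" "A \<subseteq> U" "poly_space.span A = U" "card A = poly_space.dim U"
    by (rule poly_space.fin_dim_basis[OF Uf U(1)])
  obtain C where C: "A \<subseteq> C" "C \<subseteq> homog_int 1" "poly_space.independent C" "homog_int 1 \<subseteq> poly_space.span C"
    by (rule poly_space.maximal_independent_subset_extend[OF order_trans[OF A(3) U(2)] A(2)])
  have fC: "finite C" by (rule poly_space.fin_dim_independent_finite[OF homog_int_fin_dim C(3,2)])
  have "card C = ?r" using poly_space.basis_card_eq_dim[OF C(2,4,3)] dim_homog_int_1[where 'v = 'v and 'k = 'k] by simp
  then obtain c where c: "bij_betw c {..<?r} C"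
    using ex_bij_betw_nat_finite[OF fC] by (auto simp: atLeast0LessThan)
  have c1: "c v \<in> homog_int 1" if "v < ?r" for v using c that C(2) unfolding bij_betw_def by blast
  define B where "B = {v. v < ?r \<and> c v \<in> A}"
  have "bij_betw c B A"
  proof (rule bij_betw_imageI)
    show "inj_on c B" using c unfolding bij_betw_def B_def by (auto intro: inj_on_subset)
    show "c ` B = A"
    proof
      show "A \<subseteq> c ` B"
      proof
        fix a assume a: "a \<in> A"
        then have "a \<in> c ` {..<?r}" using c C(1) unfolding bij_betw_def by blast
        then show "a \<in> c ` B" using a unfolding B_def by blast
      qed
    qed (auto simp: B_def)
  qed
  then have cB: "card B = poly_space.dim U" using bij_betw_same_card A(5) by metis
  have "\<exists>D\<in>homog_int 1. \<forall>w<?r. lookup (contract D (c w)) 0 = (if v = w then 1 else 0)" if v: "v < ?r" for v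
  proof -
    obtain \<psi> where \<psi>: "Vector_Spaces.linear smul (*) \<psi>" "\<forall>x\<in>C. \<psi> x = (if x = c v then 1 else 0)"
      using P.linear_independent_extend[OF C(3), of "\<lambda>x. if x = c v then 1 else 0"] by (elim exE conjE)
    obtain D where D: "D \<in> homog_int 1" "\<forall>y\<in>homog_int 1. lookup (contract D y) 0 = \<psi> y" using functional_form[OF \<psi>(1)] by blast
    have "lookup (contract D (c w)) 0 = (if v = w then 1 else 0)" if w: "w < ?r" for w
    proof -
      have "c w \<in> C" using c w unfolding bij_betw_def by blast
      moreover have "c w = c v \<longleftrightarrow> v = w" using c v w unfolding bij_betw_def inj_on_def by auto
      ultimately show ?thesis using D(2) c1[OF w] \<psi>(2) by simp
    qed
    then show ?thesis using D(1) by blast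
  qed
  then have "\<forall>v. \<exists>D. v < ?r \<longrightarrow> D \<in> homog_int 1 \<and> (\<forall>w<?r. lookup (contract D (c w)) 0 = (if v = w then 1 else 0))"
    by blast
  from choice[OF this] obtain l where
    l: "\<forall>v. v < ?r \<longrightarrow> l v \<in> homog_int 1 \<and> (\<forall>w<?r. lookup (contract (l v) (c w)) 0 = (if v = w then 1 else 0))" ..
  have exp: "\<exists>a. y = (\<Sum>w<?r. smul (a w) (c w))" if "y \<in> homog_int 1" for y
  proof -
    have "y \<in> poly_space.span C" using that C(4) by blast
    then obtain u where "y = (\<Sum>x\<in>C. smul (u x) x)" unfolding poly_space.span_finite[OF fC] by blast
    also have "\<dots> = (\<Sum>w<?r. smul (u (c w)) (c w))" by (rule sum.reindex_bij_betw[OF c, symmetric])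
    finally have "y = (\<Sum>w<?r. smul (u (c w)) (c w))" .
    then show ?thesis by (intro exI[of _ "\<lambda>w. u (c w)"])
  qed
  have "spanning_forms l"
    unfolding spanning_forms_def
  proof (intro conjI allI impI)
    show "i < ?r \<Longrightarrow> l i \<in> homog_int 1" for i using l by blast
    fix i assume "i < ?r"
    define a where "a j = lookup (contract (var i) (c j)) 0" for j
    have "var i - (\<Sum>j<?r. smul (a j) (l j)) = 0"
    proof (rule form_eqI)
      show "var i - (\<Sum>j<?r. smul (a j) (l j)) \<in> homog_int 1"
        using l by (intro poly_space.subspace_diff[OF homog_int_subspace] poly_space.subspace_sum[OF homog_int_subspace]
            poly_space.subspace_scale[OF homog_int_subspace] var_homog_int) auto
      fix y :: "('v, 'k) div_pow" assume "y \<in> homog_int 1"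
      then obtain b where b: "y = (\<Sum>w<?r. smul (b w) (c w))" using exp by blast
      have "lookup (contract (var i - (\<Sum>j<?r. smul (a j) (l j))) (c w)) 0 = 0" if w: "w < ?r" for w
      proof -
        have "lookup (contract (\<Sum>j<?r. smul (a j) (l j)) (c w)) 0 = (\<Sum>j<?r. a j * lookup (contract (l j) (c w)) 0)"
          by (simp add: contract_left.sum contract_left.scale lookup_sum)
        also have "\<dots> = (\<Sum>j<?r. if j = w then a j else 0)" using l w by (intro sum.cong) auto
        also have "\<dots> = a w" using w by (simp add: sum.delta)
        finally show ?thesis by (simp add: contract_left.diff lookup_minus a_def)
      qed
      then show "lookup (contract (var i - (\<Sum>j<?r. smul (a j) (l j))) y) 0 = 0"
        unfolding b by (simp add: contract_right.sum contract_right.scale lookup_sum)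
    qed
    then have "var i = (\<Sum>j<?r. smul (a j) (l j))" by simp
    then show "\<exists>a. var i = (\<Sum>j<?r. smul (a j) (l j))" by (intro exI[of _ a])
  qed
  moreover have "lookup (contract (l v) y) 0 = 0" if v: "v < ?r" "v \<notin> B" and y: "y \<in> U" for v y
  proof -
    have "y \<in> poly_space.span A" using y A(4) by simp
    then obtain u where u: "y = (\<Sum>x\<in>A. smul (u x) x)" unfolding poly_space.span_finite[OF A(1)] by blast
    have "lookup (contract (l v) x) 0 = 0" if x: "x \<in> A" for x
    proof -
      have "x \<in> c ` {..<?r}" using x c C(1) unfolding bij_betw_def by blast
      then obtain w where w: "w < ?r" "x = c w" by blast
      then have "w \<noteq> v" using v x by (auto simp: B_def)
      then show ?thesis using l w v(1) by simp
    qed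
    then show ?thesis unfolding u by (simp add: contract_right.sum contract_right.scale lookup_sum)
  qed
  moreover have "B \<subseteq> {..<?r}" "\<forall>v\<in>B. c v \<in> U" using A(3) by (auto simp: B_def)
  ultimately show ?thesis using cB l by (intro exI[of _ l] exI[of _ c] exI[of _ B]) simp
qed

section \<open>The two ends of the Koszul complex\<close>

interpretation chain_space: vec_space "pointwise_scale smul :: 'k::field \<Rightarrow> ('i \<Rightarrow> 'b \<Rightarrow>\<^sub>0 'k) \<Rightarrow> _"
  by (rule vec_space_pointwise_scale[OF vec_space_smul])

lemma derivs_int_subspace: "poly_space.subspace (derivs_int h e)"
  unfolding derivs_int_def by (rule contract_left.subspace_image[OF homog_int_subspace])

lemma derivs_int_homog_int: "h \<in> homog_int d \<Longrightarrow> y \<in> derivs_int h e \<Longrightarrow> y \<in> homog_int (d - e)"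
  unfolding derivs_int_def using contract_homog_int by blast

lemma derivs_int_fin_dim: "poly_space.fin_dim (derivs_int (h :: ('v::finite, 'k::field) div_pow) e)"
proof -
  interpret P: vec_space_pair "smul :: 'k \<Rightarrow> ('v, 'k) poly_ring \<Rightarrow> _" "smul :: 'k \<Rightarrow> ('v, 'k) div_pow \<Rightarrow> _" ..
  show ?thesis unfolding derivs_int_def by (rule P.fin_dim_image[OF contract_linear_left homog_int_fin_dim])
qed

lemma derivs_int_contract: "D \<in> homog_int a \<Longrightarrow> y \<in> derivs_int h e \<Longrightarrow> contract D y \<in> derivs_int h (e + a)"
  unfolding derivs_int_def using homog_int_mult[of D a] by (fastforce simp: contract_mult[symmetric] add.commute)

lemma derivs_int_graded_module:
  assumes "\<And>i. i < m \<Longrightarrow> l i \<in> homog_int 1"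
  shows "contract_ops.graded_module l m (derivs_int h)"
  unfolding contract_ops.graded_module_def using derivs_int_subspace derivs_int_fin_dim derivs_int_contract[OF assms] by blast

lemma derivs_int_neg: "e < 0 \<Longrightarrow> derivs_int h e = {0}"
  by (simp add: derivs_int_def homog_int_neg contract_left.zero)

lemma derivs_int_high:
  assumes "h \<in> homog_int d" "e > d"
  shows "derivs_int h e = {0}"
proof -
  have "derivs_int h e \<subseteq> {0}" using derivs_int_homog_int[OF assms(1)] homog_int_neg[of "d - e"] assms(2) by fastforce
  then show ?thesis using poly_space.subspace_0[OF derivs_int_subspace] by blast
qed

lemma derivs_int_0: "derivs_int h 0 = poly_space.span {h}"
proof -
  have "derivs_int h 0 = range (\<lambda>c. smul c h)"
  proof (intro equalityI subsetI)
    fix y assume "y \<in> derivs_int h 0"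
    then obtain D where "D \<in> homog_int 0" "y = contract D h" unfolding derivs_int_def by blast
    then have "y = smul (lookup D 0) h" using homog_int_0_const contract_const by metis
    then show "y \<in> range (\<lambda>c. smul c h)" by blast
  next
    fix y assume "y \<in> range (\<lambda>c. smul c h)"
    then obtain c where "y = contract (single 0 c) h" by (auto simp: contract_const)
    moreover have "single 0 c \<in> homog_int 0" by (rule homog_int_single) simp
    ultimately show "y \<in> derivs_int h 0" unfolding derivs_int_def by blast
  qed
  then show ?thesis by (simp add: poly_space.span_singleton)
qed

lemma homog_int_0: "(homog_int 0 :: ('v::finite, 'k::field) div_pow set) = poly_space.span {1}"
proof (intro equalityI subsetI)
  fix y :: "('v, 'k) div_pow" assume "y \<in> homog_int 0"
  then have "y = smul (lookup y 0) 1" using homog_int_0_const by (simp add: smul_eq_mult)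
  then show "y \<in> poly_space.span {1}" by (auto simp: poly_space.span_singleton)
next
  fix y :: "('v, 'k) div_pow" assume "y \<in> poly_space.span {1}"
  then show "y \<in> homog_int 0" using poly_space.subspace_scale[OF homog_int_subspace one_homog_int] by (auto simp: poly_space.span_singleton)
qed

text \<open>The pairing of operators and divided powers of the same degree is nondegenerate.\<close>
lemma derivs_int_top:
  fixes h :: "('v::finite, 'k::field) div_pow"
  assumes "h \<in> homog_int (int d)" "h \<noteq> 0"
  shows "derivs_int h (int d) = poly_space.span {1}"
proof
  show "derivs_int h (int d) \<subseteq> poly_space.span {1}" using derivs_int_homog_int[OF assms(1), of _ "int d"] homog_int_0 by auto
  obtain D where D: "D \<in> homog_int (int d)" "contract D h \<noteq> 0" using nondeg[OF assms(1), of d] assms(2) by blast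
  have Dm: "contract D h \<in> derivs_int h (int d)" using D(1) unfolding derivs_int_def by blast
  then have "contract D h \<in> homog_int 0" using derivs_int_homog_int[OF assms(1), of _ "int d"] by simp
  then have e: "contract D h = single 0 (lookup (contract D h) 0)" by (rule homog_int_0_const)
  define a where "a = lookup (contract D h) 0"
  have a: "a \<noteq> 0" using e D(2) by (auto simp: a_def)
  have "smul (1 / a) (contract D h) \<in> derivs_int h (int d)" by (rule poly_space.subspace_scale[OF derivs_int_subspace Dm])
  also have "smul (1 / a) (contract D h) = 1" using e a unfolding a_def[symmetric] by simp
  finally show "poly_space.span {1} \<subseteq> derivs_int h (int d)" using derivs_int_subspace by (intro poly_space.span_minimal) auto
qed

lemma card_supersets:
  assumes "B \<subseteq> {..<r::nat}" "p \<le> r"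
  shows "card {T. T \<subseteq> {..<r} \<and> card T = p \<and> B \<subseteq> T} = (r - card B) choose (r - p)"
proof -
  let ?f = "\<lambda>T. {..<r} - T"
  have "bij_betw ?f {T. T \<subseteq> {..<r} \<and> card T = p \<and> B \<subseteq> T} {S. S \<subseteq> {..<r} - B \<and> card S = r - p}"
  proof (rule bij_betw_byWitness[where f' = ?f])
    have c: "card ({..<r} - T) = r - card T" if "T \<subseteq> {..<r}" for T
      using card_Diff_subset[OF finite_subset[OF that finite_lessThan] that] by simp
    show "?f ` {T. T \<subseteq> {..<r} \<and> card T = p \<and> B \<subseteq> T} \<subseteq> {S. S \<subseteq> {..<r} - B \<and> card S = r - p}"
      using c by auto
    show "?f ` {S. S \<subseteq> {..<r} - B \<and> card S = r - p} \<subseteq> {T. T \<subseteq> {..<r} \<and> card T = p \<and> B \<subseteq> T}"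
    proof
      fix T assume "T \<in> ?f ` {S. S \<subseteq> {..<r} - B \<and> card S = r - p}"
      then obtain S where S: "S \<subseteq> {..<r} - B" "card S = r - p" "T = {..<r} - S" by blast
      have "S \<subseteq> {..<r}" using S(1) by blast
      from c[OF this] have "card T = p" using S(2,3) assms(2) by simp
      then show "T \<in> {T. T \<subseteq> {..<r} \<and> card T = p \<and> B \<subseteq> T}" using S assms(1) by blast
    qed
  qed auto
  then have "card {T. T \<subseteq> {..<r} \<and> card T = p \<and> B \<subseteq> T} = card {S. S \<subseteq> {..<r} - B \<and> card S = r - p}"
    by (rule bij_betw_same_card)
  also have "\<dots> = card ({..<r} - B) choose (r - p)" by (rule n_subsets) simp
  also have "card ({..<r} - B) = r - card B"
    using card_Diff_subset[OF finite_subset[OF assms(1) finite_lessThan] assms(1)] by simp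
  finally show ?thesis .
qed

context commuting_ops
begin

lemma dim_koszul_chains_line:
  assumes "y \<noteq> 0"
  shows "chain.dim (koszul_chains m p (span {y})) = m choose p"
proof -
  have "koszul_chains m p (span {y}) = {u. \<forall>T. u T \<in> span {y} \<and> (u T \<noteq> 0 \<longrightarrow> T \<in> {T. T \<subseteq> {..<m} \<and> card T = p})}"
    unfolding koszul_chains_def by simp
  moreover have "finite {T. T \<subseteq> {..<m} \<and> card T = p}" by (rule finite_subset[of _ "Pow {..<m}"]) auto
  ultimately have "chain.dim (koszul_chains m p (span {y})) = card {T. T \<subseteq> {..<m} \<and> card T = p}"
    by (simp only: dim_line_functions[OF assms])
  then show ?thesis using n_subsets[of "{..<m}" p] by simp
qed

lemma dim_koszul_boundaries_zero: "chain.dim (koszul_boundaries X m p {0}) = 0"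
proof -
  have "koszul_boundaries X m p {0} \<subseteq> chain.span {}"
  proof
    fix u assume "u \<in> koszul_boundaries X m p {0}"
    then obtain w where w: "w \<in> koszul_chains m (Suc p) {0}" "u = koszul_d X m w" unfolding koszul_boundaries_def by blast
    have "w = 0" using koszul_chainsD(1)[OF w(1)] by (auto simp: fun_eq_iff)
    then show "u \<in> chain.span {}" using w(2) by simp
  qed
  then have "chain.dim (koszul_boundaries X m p {0}) \<le> card ({} :: (nat set \<Rightarrow> 'a) set)" by (rule chain.dim_le_card) simp
  then show ?thesis by simp
qed

end

lemma koszul_cycles_top:
  fixes h :: "('v::finite, 'k::field) div_pow"
  assumes l: "\<And>v. v < m \<Longrightarrow> l v \<in> homog_int 1" and h: "h \<in> homog_int (int d)"
  shows "koszul_cycles (contract_ops l) m p (derivs_int h (int d)) = koszul_chains m p (derivs_int h (int d))"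
proof -
  have "koszul_d (contract_ops l) m u = 0" if u: "u \<in> koszul_chains m p (derivs_int h (int d))" for u
  proof (rule contract_ops.koszul_d_eq_0)
    fix T v assume v: "v < m"
    have "contract (l v) (u (insert v T)) \<in> derivs_int h (int d + 1)"
      by (rule derivs_int_contract[OF l[OF v] contract_ops.koszul_chainsD(1)[OF u]])
    also have "derivs_int h (int d + 1) = {0}" by (rule derivs_int_high[OF h]) simp
    finally show "contract (l v) (u (insert v T)) = 0" by simp
  qed
  then show ?thesis by (auto simp: koszul_cycles_def)
qed

text \<open>Let \<open>l\<close> be adapted to the space \<open>U\<close> of linear derivatives of \<open>h\<close>, with the dual elements \<open>c\<close> and the index
set \<open>B\<close>. For \<open>v \<notin> B\<close> the form \<open>l v\<close> kills \<open>h\<close> by nondegeneracy, because it kills all of \<open>U\<close>. For \<open>v \<in> B\<close> the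
element \<open>c v = E h\<close> lies in \<open>U\<close>, so applying \<open>E\<close> separates \<open>l v\<close> from the other forms in degree \<open>0\<close>, and
\<open>c v\<close> itself is a preimage of \<open>1\<close> under \<open>l v\<close> alone in degree \<open>d\<close>.\<close>
lemma koszul_ends:
  fixes h :: "('v::finite, 'k::field) div_pow"
  assumes h: "h \<in> homog_int (int d)" "h \<noteq> 0" and d: "d \<ge> 1"
  defines "s \<equiv> poly_space.dim (derivs_int h (int d - 1))"
  shows "\<exists>l. spanning_forms l \<and> s \<le> CARD('v) \<and>
    (\<forall>p. koszul_dim smul (contract_ops l) CARD('v) p (derivs_int h) 0 = (CARD('v) - s) choose p) \<and>
    (\<forall>p\<le>CARD('v). koszul_dim smul (contract_ops l) CARD('v) p (derivs_int h) (int d) = (CARD('v) - s) choose (CARD('v) - p))"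
proof -
  let ?r = "CARD('v)"
  let ?U = "derivs_int h (int d - 1)"
  have U1: "?U \<subseteq> homog_int 1" using derivs_int_homog_int[OF h(1), of _ "int d - 1"] by auto
  obtain l c B where l: "spanning_forms l" and B: "B \<subseteq> {..<?r}" "card B = s"
    and cU: "\<forall>v\<in>B. c v \<in> ?U"
    and lc: "\<forall>v<?r. \<forall>w<?r. lookup (contract (l v) (c w)) 0 = (if v = w then 1 else 0)"
    and lU: "\<forall>v<?r. v \<notin> B \<longrightarrow> (\<forall>y\<in>?U. lookup (contract (l v) y) 0 = 0)"
    using adapted_forms[OF derivs_int_subspace U1] unfolding s_def by (elim exE conjE)
  have l1: "l v \<in> homog_int 1" if "v < ?r" for v using l that by (simp add: spanning_forms_def)
  have s: "s \<le> ?r" using card_mono[OF finite_lessThan B(1)] B(2) by simp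
  have lU0: "contract (l v) y = 0" if "v < ?r" "v \<notin> B" "y \<in> ?U" for v y
  proof -
    have "contract (l v) y \<in> homog_int (1 - 1)" by (rule contract_homog_int[OF l1[OF that(1)]]) (use U1 that(3) in blast)
    then have "contract (l v) y = single 0 (lookup (contract (l v) y) 0)" by (intro homog_int_0_const) simp
    then show ?thesis using lU that by simp
  qed
  have lcd: "contract (l v) (c w) = (if v = w then 1 else 0)" if "v < ?r" "w \<in> B" for v w
  proof -
    have "contract (l v) (c w) \<in> homog_int (1 - 1)"
      by (rule contract_homog_int[OF l1[OF that(1)]]) (use U1 cU that(2) in blast)
    then have "contract (l v) (c w) = single 0 (lookup (contract (l v) (c w)) 0)" by (intro homog_int_0_const) simp
    moreover have "w < ?r" using B(1) that(2) by blast
    ultimately show ?thesis using lc that(1) by simp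
  qed
  have lh: "contract (l v) h = 0" if v: "v < ?r" "v \<notin> B" for v
  proof (rule nondeg[of _ "int d - 1" "d - 1"])
    show "contract (l v) h \<in> homog_int (int d - 1)" by (rule contract_homog_int[OF l1[OF v(1)] h(1)])
    show "int (d - 1) \<le> int d - 1" using d by simp
    fix D :: "('v, 'k) poly_ring" assume "D \<in> homog_int (int (d - 1))"
    then have "contract D h \<in> ?U" using d unfolding derivs_int_def by (auto simp: of_nat_diff)
    then have "contract (l v) (contract D h) = 0" by (rule lU0[OF v])
    then show "contract D (contract (l v) h) = 0" by (simp only: contract_mult[symmetric] mult.commute)
  qed
  note g = derivs_int_graded_module[of ?r l h, OF l1]
  have fT: "finite {T. T \<subseteq> {..<?r} \<and> P T}" for P by (rule finite_subset[of _ "Pow {..<?r}"]) auto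

  have bottom: "koszul_dim smul (contract_ops l) ?r p (derivs_int h) 0 = (?r - s) choose p" for p
  proof -
    let ?T = "{T. T \<subseteq> {..<?r} - B \<and> card T = p}"
    have "koszul_cycles (contract_ops l) ?r p (derivs_int h 0) = {u. \<forall>T. u T \<in> poly_space.span {h} \<and> (u T \<noteq> 0 \<longrightarrow> T \<in> ?T)}" (is "_ = ?S")
    proof (intro equalityI subsetI)
      fix u assume "u \<in> koszul_cycles (contract_ops l) ?r p (derivs_int h 0)"
      then have u: "u \<in> koszul_chains ?r p (derivs_int h 0)" "koszul_d (contract_ops l) ?r u = 0" by (auto simp: koszul_cycles_def)
      have uh: "u T \<in> poly_space.span {h}" for T using contract_ops.koszul_chainsD(1)[OF u(1)] by (simp add: derivs_int_0)
      have "\<forall>T. \<exists>a. u T = smul a h" using uh by (auto simp: poly_space.span_singleton)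
      from choice[OF this] obtain a where a: "\<forall>T. u T = smul (a T) h" ..
      have "T \<in> ?T" if nz: "u T \<noteq> 0" for T
      proof -
        have T: "T \<subseteq> {..<?r}" "card T = p" using contract_ops.koszul_chainsD(2)[OF u(1) nz] by blast+
        have "T \<inter> B = {}"
        proof (rule ccontr)
          assume "T \<inter> B \<noteq> {}"
          then obtain v where v: "v \<in> T" "v \<in> B" by blast
          then have vr: "v < ?r" using B(1) by blast
          obtain E where E: "c v = contract E h" using cU v(2) unfolding derivs_int_def by blast
          define \<Lambda> where "\<Lambda> y = lookup (contract E y) 0" for y
          have \<Lambda>: "\<Lambda> (contract (l w) (u T')) = (if w = v then a T' else 0)" if "w < ?r" for w T'
          proof -
            have "contract E (contract (l w) h) = contract (l w) (c v)"
              unfolding E by (simp only: contract_mult[symmetric] mult.commute)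
            then show ?thesis using a lcd[OF that v(2)] by (simp add: \<Lambda>_def contract_right.scale)
          qed
          have \<Lambda>m: "\<Lambda> (- y) = - \<Lambda> y" "\<Lambda> 0 = 0" for y by (simp_all add: \<Lambda>_def contract_right.neg contract_right.zero)
          have \<Lambda>s: "\<Lambda> (\<Sum>w\<in>I. y w) = (\<Sum>w\<in>I. \<Lambda> (y w))" for y and I :: "nat set"
            by (simp add: \<Lambda>_def contract_right.sum lookup_sum)
          \<comment> \<open>The value of the differential at \<open>?T0\<close> is \<open>\<Sum>\<^sub>w \<plusminus> l\<^sub>w u(T0 \<union> {w})\<close>, and \<open>\<Lambda>\<close> extracts the term for \<open>w = v\<close>.\<close>
          let ?T0 = "T - {v}"
          let ?single = "even (card (?T0 \<inter> {..<v}))"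
          have "0 = \<Lambda> (koszul_d (contract_ops l) ?r u ?T0)" using u(2) by (simp add: \<Lambda>_def contract_right.zero)
          also have "\<dots> = (\<Sum>w<?r. if w = v then (if ?single then a T else - a T) else 0)"
            unfolding contract_ops.koszul_d_sum \<Lambda>s
          proof (rule sum.cong[OF refl])
            fix w assume "w \<in> {..<?r}"
            moreover have "insert v T = T" using v(1) by blast
            ultimately show "\<Lambda> (if w \<in> ?T0 then 0 else if even (card (?T0 \<inter> {..<w}))
                then contract (l w) (u (insert w ?T0)) else - contract (l w) (u (insert w ?T0))) =
              (if w = v then (if ?single then a T else - a T) else 0)"
              using v(1) by (simp add: \<Lambda> \<Lambda>m insert_Diff_if)
          qed
          also have "\<dots> = (if ?single then a T else - a T)" using vr by (simp add: sum.delta)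
          finally have "a T = 0" by (simp split: if_splits)
          then show False using a nz by simp
        qed
        then show "T \<in> ?T" using T by blast
      qed
      then show "u \<in> ?S" using uh by simp
    next
      fix u assume u: "u \<in> ?S"
      then have "u \<in> koszul_chains ?r p (derivs_int h 0)" by (intro contract_ops.koszul_chainsI) (auto simp: derivs_int_0)
      moreover have "koszul_d (contract_ops l) ?r u = 0"
      proof (rule contract_ops.koszul_d_eq_0)
        fix T v assume v: "v < ?r"
        show "contract (l v) (u (insert v T)) = 0"
        proof (cases "v \<in> B")
          case True
          then have "insert v T \<notin> ?T" by blast
          then have "u (insert v T) = 0" using u by blast
          then show ?thesis by (simp add: contract_right.zero)
        next
          case False
          have "u (insert v T) \<in> poly_space.span {h}" using u by blast
          then show ?thesis using lh[OF v False] by (auto simp: poly_space.span_singleton contract_right.scale)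
        qed
      qed
      ultimately show "u \<in> koszul_cycles (contract_ops l) ?r p (derivs_int h 0)" by (simp add: koszul_cycles_def)
    qed
    moreover have "finite ?T" by (rule finite_subset[of _ "Pow {..<?r}"]) auto
    ultimately have "chain_space.dim (koszul_cycles (contract_ops l) ?r p (derivs_int h 0)) = card ?T"
      by (simp only: poly_space.dim_line_functions[OF h(2)])
    also have "card ?T = card ({..<?r} - B) choose p" by (rule n_subsets) simp
    also have "card ({..<?r} - B) = ?r - s"
      using card_Diff_subset[OF finite_subset[OF B(1) finite_lessThan] B(1)] B(2) by simp
    finally have "chain_space.dim (koszul_cycles (contract_ops l) ?r p (derivs_int h 0)) = (?r - s) choose p" .
    moreover have "derivs_int h (0 - 1) = {0}" by (rule derivs_int_neg) simp
    ultimately show ?thesis unfolding koszul_dim_def by (simp add: contract_ops.dim_koszul_boundaries_zero)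
  qed

  have top: "koszul_dim smul (contract_ops l) ?r p (derivs_int h) (int d) = (?r - s) choose (?r - p)" if p: "p \<le> ?r" for p
  proof -
    let ?A = "{T. T \<subseteq> {..<?r} \<and> card T = p}"
    let ?A1 = "{T. T \<subseteq> {..<?r} \<and> card T = p \<and> B \<subseteq> T}"
    let ?A2 = "{T. T \<subseteq> {..<?r} \<and> card T = p \<and> \<not> B \<subseteq> T}"
    have cyc: "koszul_cycles (contract_ops l) ?r p (derivs_int h (int d)) = koszul_chains ?r p (derivs_int h (int d))"
      by (rule koszul_cycles_top[OF _ h(1)]) (rule l1)
    have dimc: "chain_space.dim (koszul_cycles (contract_ops l) ?r p (derivs_int h (int d))) = ?r choose p"
      unfolding cyc unfolding derivs_int_top[OF h] by (rule contract_ops.dim_koszul_chains_line) simp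
    have "koszul_boundaries (contract_ops l) ?r p ?U = {u. \<forall>T. u T \<in> poly_space.span {1} \<and> (u T \<noteq> 0 \<longrightarrow> T \<in> ?A2)}" (is "_ = ?S")
    proof (intro equalityI subsetI)
      fix u assume "u \<in> koszul_boundaries (contract_ops l) ?r p ?U"
      then obtain w where w: "w \<in> koszul_chains ?r (Suc p) ?U" "u = koszul_d (contract_ops l) ?r w" unfolding koszul_boundaries_def by blast
      have u: "u \<in> koszul_chains ?r p (derivs_int h (int d))" unfolding w(2)
      proof (rule contract_ops.koszul_d_chains[OF w(1) order_refl derivs_int_subspace])
        fix v x assume "v < ?r" "x \<in> ?U"
        from derivs_int_contract[OF l1[OF this(1)] this(2)] show "contract (l v) x \<in> derivs_int h (int d)" by simp
      qed
      have "u T = 0" if "B \<subseteq> T" for T unfolding w(2)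
      proof (rule contract_ops.koszul_d_eq_0_at)
        fix v assume "v < ?r" "v \<notin> T"
        then show "contract (l v) (w (insert v T)) = 0"
          using that by (intro lU0 contract_ops.koszul_chainsD(1)[OF w(1)]) auto
      qed
      then show "u \<in> ?S" using contract_ops.koszul_chainsD[OF u] derivs_int_top[OF h] by blast
    next
      fix u assume u: "u \<in> ?S"
      have delta: "(\<lambda>T'. if T' = T then smul a 1 else 0) \<in> koszul_boundaries (contract_ops l) ?r p ?U" if T: "T \<in> ?A2" for T a
      proof -
        obtain v where v: "v \<in> B" "v \<notin> T" using T by blast
        have vr: "v < ?r" using v(1) B(1) by blast
        \<comment> \<open>The sign with which \<open>l v\<close> enters the differential at \<open>T\<close>.\<close>
        define b where "b = (if even (card (T \<inter> {..<v})) then a else - a)"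
        define w where "w T' = (if T' = insert v T then smul b (c v) else 0)" for T'
        have "finite T" using T finite_subset[of T "{..<?r}"] by auto
        then have "w \<in> koszul_chains ?r (Suc p) ?U"
          using T v vr cU by (intro contract_ops.koszul_chainsI)
            (auto simp: w_def poly_space.subspace_0[OF derivs_int_subspace] intro!: poly_space.subspace_scale[OF derivs_int_subspace] split: if_splits)
        moreover have "koszul_d (contract_ops l) ?r w = (\<lambda>T'. if T' = T then smul a 1 else 0)"
        proof (rule ext)
          fix T'
          show "koszul_d (contract_ops l) ?r w T' = (if T' = T then smul a 1 else 0)"
          proof (cases "T' = T")
            case False
            have "koszul_d (contract_ops l) ?r w T' = 0"
            proof (rule contract_ops.koszul_d_eq_0_at)
              fix v' assume v': "v' < ?r" "v' \<notin> T'"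
              show "contract (l v') (w (insert v' T')) = 0"
              proof (cases "v' = v")
                case True
                then have "insert v' T' \<noteq> insert v T" using False v' v by (metis insert_ident)
                then show ?thesis by (simp add: w_def contract_right.zero)
              next
                case False
                then show ?thesis using lcd[OF v'(1) v(1)] by (simp add: w_def contract_right.scale contract_right.zero)
              qed
            qed
            then show ?thesis using False by simp
          next
            case True
            have "koszul_d (contract_ops l) ?r w T = (\<Sum>w'<?r. if w' = v then smul a 1 else 0)"
              unfolding contract_ops.koszul_d_sum
            proof (rule sum.cong[OF refl])
              fix w' assume w': "w' \<in> {..<?r}"
              show "(if w' \<in> T then 0 else if even (card (T \<inter> {..<w'})) then contract (l w') (w (insert w' T))
                  else - contract (l w') (w (insert w' T))) = (if w' = v then smul a 1 else 0)"
              proof (cases "w' = v")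
                case True
                then show ?thesis using v lcd[OF vr v(1)]
                  by (auto simp: w_def contract_right.scale contract_right.neg b_def poly_space.scale_minus_left)
              next
                case False
                then have "w' \<notin> T \<Longrightarrow> insert w' T \<noteq> insert v T" by blast
                then show ?thesis using False by (auto simp: w_def contract_right.zero)
              qed
            qed
            then show ?thesis using True vr by (simp add: sum.delta)
          qed
        qed
        ultimately show ?thesis unfolding koszul_boundaries_def by (metis imageI)
      qed
      have "u = (\<Sum>T\<in>?A2. (\<lambda>T'. if T' = T then u T else 0))"
      proof (rule ext)
        fix T'
        have "(\<Sum>T\<in>?A2. (\<lambda>T'. if T' = T then u T else 0)) T' = (\<Sum>T\<in>?A2. if T = T' then u T else 0)"
          unfolding sum_fun_apply by (intro sum.cong) auto
        also have "\<dots> = (if T' \<in> ?A2 then u T' else 0)" using fT by (simp add: sum.delta)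
        also have "\<dots> = u T'" using u by auto
        finally show "u T' = (\<Sum>T\<in>?A2. (\<lambda>T'. if T' = T then u T else 0)) T'" by simp
      qed
      also have "\<dots> \<in> koszul_boundaries (contract_ops l) ?r p ?U"
      proof (rule chain_space.subspace_sum[OF contract_ops.koszul_boundaries_subspace[OF derivs_int_subspace]])
        fix T assume T: "T \<in> ?A2"
        have "u T \<in> poly_space.span {1}" using u by blast
        then obtain a where a: "u T = smul a (1 :: ('v, 'k) div_pow)" by (auto simp: poly_space.span_singleton)
        show "(\<lambda>T'. if T' = T then u T else 0) \<in> koszul_boundaries (contract_ops l) ?r p ?U"
          unfolding a by (rule delta[OF T])
      qed
      finally show "u \<in> koszul_boundaries (contract_ops l) ?r p ?U" .
    qed
    moreover have "finite ?A2" by (rule fT)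
    ultimately have dimb: "chain_space.dim (koszul_boundaries (contract_ops l) ?r p ?U) = card ?A2"
      by (simp only: poly_space.dim_line_functions[OF one_neq_zero])
    have "card ?A = card ?A1 + card ?A2"
    proof -
      have "?A = ?A1 \<union> ?A2" "?A1 \<inter> ?A2 = {}" by auto
      then show ?thesis using card_Un_disjoint[of ?A1 ?A2] fT by metis
    qed
    moreover have "card ?A = ?r choose p" using n_subsets[of "{..<?r}" p] by simp
    moreover have "card ?A1 = (?r - s) choose (?r - p)" using card_supersets[OF B(1) p] B(2) by simp
    ultimately show ?thesis unfolding koszul_dim_def dimc dimb by simp
  qed

  show ?thesis using l s bottom top by blast
qed

section \<open>Direct sums in the Koszul complex\<close>

context commuting_ops
begin

lemma koszul_chains_sum_family:
  assumes I: "finite I" and N: "\<And>i. i \<in> I \<Longrightarrow> subspace (N i)" "\<And>i. i \<in> I \<Longrightarrow> fin_dim (N i)"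
  shows "koszul_chains m p (sum_family I N) = chain.sum_family I (\<lambda>i. koszul_chains m p (N i))"
proof
  have sub: "subspace (sum_family I N)" by (rule sum_family_subspace[OF I N])
  show "chain.sum_family I (\<lambda>i. koszul_chains m p (N i)) \<subseteq> koszul_chains m p (sum_family I N)"
    by (intro chain.sum_family_least koszul_chains_subspace[OF sub] koszul_chains_mono sum_family_superset[OF I N(1)])
  show "koszul_chains m p (sum_family I N) \<subseteq> chain.sum_family I (\<lambda>i. koszul_chains m p (N i))"
  proof
    fix u assume u: "u \<in> koszul_chains m p (sum_family I N)"
    have "\<exists>y. (\<forall>i\<in>I. y i \<in> N i) \<and> u T = (\<Sum>i\<in>I. y i) \<and> (u T = 0 \<longrightarrow> (\<forall>i. y i = 0))" for T
    proof (cases "u T = 0")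
      case True
      then show ?thesis using N(1) by (intro exI[of _ "\<lambda>_. 0"]) (simp add: subspace_0)
    next
      case False
      obtain y where "u T = (\<Sum>i\<in>I. y i)" "\<forall>i\<in>I. y i \<in> N i"
        using koszul_chainsD(1)[OF u] by (rule sum_familyE)
      then show ?thesis using False by (intro exI[of _ y]) simp
    qed
    then have "\<forall>T. \<exists>y. (\<forall>i\<in>I. y i \<in> N i) \<and> u T = (\<Sum>i\<in>I. y i) \<and> (u T = 0 \<longrightarrow> (\<forall>i. y i = 0))" ..
    from choice[OF this] obtain Y where
      Y: "\<forall>T. (\<forall>i\<in>I. Y T i \<in> N i) \<and> u T = (\<Sum>i\<in>I. Y T i) \<and> (u T = 0 \<longrightarrow> (\<forall>i. Y T i = 0))" ..
    show "u \<in> chain.sum_family I (\<lambda>i. koszul_chains m p (N i))"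
    proof (rule chain.sum_familyI)
      fix i assume i: "i \<in> I"
      show "(\<lambda>T. Y T i) \<in> koszul_chains m p (N i)"
      proof (rule koszul_chainsI)
        show "Y T i \<in> N i" for T using Y i by blast
        fix T assume "Y T i \<noteq> 0"
        then have "u T \<noteq> 0" using Y by blast
        then show "T \<subseteq> {..<m} \<and> card T = p" using koszul_chainsD(2)[OF u] by blast
      qed
    next
      show "u = (\<Sum>i\<in>I. (\<lambda>T. Y T i))" using Y by (simp add: fun_eq_iff sum_fun_apply)
    qed
  qed
qed

lemma koszul_chains_indep_family:
  assumes "indep_family I N"
  shows "chain.indep_family I (\<lambda>i. koszul_chains m p (N i))"
proof (rule chain.indep_familyI)
  fix y i assume y: "\<forall>i\<in>I. y i \<in> koszul_chains m p (N i)" "(\<Sum>i\<in>I. y i) = 0" "i \<in> I"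
  show "y i = 0"
  proof (rule ext)
    fix T
    have "(\<Sum>i\<in>I. y i T) = 0" using fun_cong[OF y(2), of T] by (simp add: sum_fun_apply)
    then have "y i T = 0"
      by (rule indep_familyD[OF assms _ _ y(3), rotated]) (use y(1) koszul_chainsD(1) in blast)
    then show "y i T = 0 T" by simp
  qed
qed

text \<open>The differential maps chains in \<open>N i\<close> to chains in \<open>N' i\<close>, and these are independent.\<close>
lemma koszul_d_image_indep_family:
  assumes "indep_family I N'" "\<And>i. i \<in> I \<Longrightarrow> subspace (N' i)"
    and "\<And>i v x. i \<in> I \<Longrightarrow> v < m \<Longrightarrow> x \<in> N i \<Longrightarrow> X v x \<in> N' i"
  shows "chain.indep_family I (\<lambda>i. koszul_d X m ` koszul_chains m p (N i))"
proof (cases p)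
  case 0
  show ?thesis
  proof (rule chain.indep_familyI)
    fix y i assume "\<forall>i\<in>I. y i \<in> koszul_d X m ` koszul_chains m p (N i)" "i \<in> I"
    then show "y i = 0" using koszul_d_chains_0[of _ m "N i" m] 0 by auto
  qed
next
  case (Suc q)
  show ?thesis
  proof (rule chain.indep_family_mono[OF koszul_chains_indep_family[OF assms(1), of m q]])
    fix i assume i: "i \<in> I"
    show "koszul_d X m ` koszul_chains m p (N i) \<subseteq> koszul_chains m q (N' i)"
      using koszul_d_chains[of _ m q "N i" m "N' i"] assms(2,3)[OF i] Suc by auto
  qed
qed

context
  fixes I :: "'i set" and N N' :: "'i \<Rightarrow> 'a set" and m :: nat
  assumes I: "finite I" and N: "\<And>i. i \<in> I \<Longrightarrow> subspace (N i)" "\<And>i. i \<in> I \<Longrightarrow> fin_dim (N i)"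
    and N_indep: "indep_family I N"
    and N': "\<And>i. i \<in> I \<Longrightarrow> subspace (N' i)"
begin

lemma koszul_chains_sum: "koszul_chains m p (sum_family I N) = chain.sum_family I (\<lambda>i. koszul_chains m p (N i))"
  by (rule koszul_chains_sum_family[OF I]) (rule N, assumption)+

lemma chains_summand: "i \<in> I \<Longrightarrow> koszul_chains m p (N i) \<subseteq> koszul_chains m p (sum_family I N)"
  by (intro koszul_chains_mono sum_family_superset[OF I]) (auto simp: N)

lemma sum_subspace: "subspace (sum_family I N)"
  by (rule sum_family_subspace[OF I]) (auto simp: N)

lemma dim_koszul_chains_sum_family:
  "chain.dim (koszul_chains m p (sum_family I N)) = (\<Sum>i\<in>I. chain.dim (koszul_chains m p (N i)))"
  unfolding koszul_chains_sum
  by (rule chain.dim_sum_family[OF I koszul_chains_subspace[OF N(1)] koszul_chains_fin_dim[OF N(2)]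
      koszul_chains_indep_family[OF N_indep]])

context
  assumes N'_indep: "indep_family I N'"
    and NX: "\<And>i v x. i \<in> I \<Longrightarrow> v < m \<Longrightarrow> x \<in> N i \<Longrightarrow> X v x \<in> N' i"
begin

lemma koszul_d_indep: "chain.indep_family I (\<lambda>i. koszul_d X m ` koszul_chains m p (N i))"
  by (rule koszul_d_image_indep_family[OF N'_indep N' NX])

lemma dim_koszul_boundaries_sum_family:
  "chain.dim (koszul_boundaries X m p (sum_family I N)) = (\<Sum>i\<in>I. chain.dim (koszul_boundaries X m p (N i)))"
proof -
  interpret P: vec_space_pair "pointwise_scale scale :: 'k \<Rightarrow> (nat set \<Rightarrow> 'a) \<Rightarrow> _" "pointwise_scale scale :: 'k \<Rightarrow> (nat set \<Rightarrow> 'a) \<Rightarrow> _" ..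
  interpret koszul_d: Vector_Spaces.linear "pointwise_scale scale" "pointwise_scale scale" "koszul_d X m" by (rule koszul_d_linear)
  have "koszul_boundaries X m p (sum_family I N) = chain.sum_family I (\<lambda>i. koszul_boundaries X m p (N i))"
  proof (intro equalityI subsetI)
    fix u assume "u \<in> koszul_boundaries X m p (sum_family I N)"
    then obtain w where w: "w \<in> chain.sum_family I (\<lambda>i. koszul_chains m (Suc p) (N i))" "u = koszul_d X m w"
      unfolding koszul_boundaries_def koszul_chains_sum by blast
    from w(1) obtain y where y: "w = (\<Sum>i\<in>I. y i)" "\<forall>i\<in>I. y i \<in> koszul_chains m (Suc p) (N i)"
      by (rule chain.sum_familyE)
    show "u \<in> chain.sum_family I (\<lambda>i. koszul_boundaries X m p (N i))"
      by (rule chain.sum_familyI[where y = "\<lambda>i. koszul_d X m (y i)"])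
        (use y(2) in \<open>simp_all add: koszul_boundaries_def w(2) y(1) koszul_d.sum\<close>)
  next
    fix u assume "u \<in> chain.sum_family I (\<lambda>i. koszul_boundaries X m p (N i))"
    moreover have "chain.sum_family I (\<lambda>i. koszul_boundaries X m p (N i)) \<subseteq> koszul_boundaries X m p (sum_family I N)"
    proof (rule chain.sum_family_least)
      show "chain.subspace (koszul_boundaries X m p (sum_family I N))"
        by (rule koszul_boundaries_subspace[OF sum_subspace])
      fix i assume "i \<in> I"
      from chains_summand[OF this]
      show "koszul_boundaries X m p (N i) \<subseteq> koszul_boundaries X m p (sum_family I N)"
        unfolding koszul_boundaries_def by blast
    qed
    ultimately show "u \<in> koszul_boundaries X m p (sum_family I N)" by blast
  qed
  then have "chain.dim (koszul_boundaries X m p (sum_family I N)) = chain.dim (chain.sum_family I (\<lambda>i. koszul_boundaries X m p (N i)))"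
    by simp
  also have "\<dots> = (\<Sum>i\<in>I. chain.dim (koszul_boundaries X m p (N i)))"
  proof (rule chain.dim_sum_family[OF I])
    fix i assume i: "i \<in> I"
    show "chain.subspace (koszul_boundaries X m p (N i))" by (rule koszul_boundaries_subspace[OF N(1)[OF i]])
    show "chain.fin_dim (koszul_boundaries X m p (N i))"
      unfolding koszul_boundaries_def by (rule P.fin_dim_image[OF koszul_d_linear koszul_chains_fin_dim[OF N(2)[OF i]]])
  next
    show "chain.indep_family I (\<lambda>i. koszul_boundaries X m p (N i))"
      unfolding koszul_boundaries_def by (rule koszul_d_indep)
  qed
  finally show ?thesis .
qed

text \<open>If the differentials of the components of a chain add up to zero, each of them is zero, because they lie in
independent subspaces. So the components of a cycle are cycles.\<close>
lemma dim_koszul_cycles_sum_family: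
  "chain.dim (koszul_cycles X m p (sum_family I N)) = (\<Sum>i\<in>I. chain.dim (koszul_cycles X m p (N i)))"
proof -
  interpret koszul_d: Vector_Spaces.linear "pointwise_scale scale" "pointwise_scale scale" "koszul_d X m" by (rule koszul_d_linear)
  have "koszul_cycles X m p (sum_family I N) = chain.sum_family I (\<lambda>i. koszul_cycles X m p (N i))"
  proof (intro equalityI subsetI)
    fix u assume "u \<in> koszul_cycles X m p (sum_family I N)"
    then have u: "u \<in> chain.sum_family I (\<lambda>i. koszul_chains m p (N i))" "koszul_d X m u = 0"
      unfolding koszul_cycles_def koszul_chains_sum by auto
    from u(1) obtain y where y: "u = (\<Sum>i\<in>I. y i)" "\<forall>i\<in>I. y i \<in> koszul_chains m p (N i)"
      by (rule chain.sum_familyE)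
    have s0: "(\<Sum>i\<in>I. koszul_d X m (y i)) = 0" using u(2) unfolding y(1) koszul_d.sum .
    have "koszul_d X m (y i) = 0" if "i \<in> I" for i
      by (rule chain.indep_familyD[OF koszul_d_indep[of p] _ s0 that])
        (use y(2) in auto)
    then show "u \<in> chain.sum_family I (\<lambda>i. koszul_cycles X m p (N i))"
      using y by (intro chain.sum_familyI[where y = y]) (auto simp: koszul_cycles_def)
  next
    fix u assume "u \<in> chain.sum_family I (\<lambda>i. koszul_cycles X m p (N i))"
    moreover have "chain.sum_family I (\<lambda>i. koszul_cycles X m p (N i)) \<subseteq> koszul_cycles X m p (sum_family I N)"
    proof (rule chain.sum_family_least)
      show "chain.subspace (koszul_cycles X m p (sum_family I N))"
        by (rule koszul_cycles_subspace[OF sum_subspace])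
      fix i assume "i \<in> I"
      from chains_summand[OF this]
      show "koszul_cycles X m p (N i) \<subseteq> koszul_cycles X m p (sum_family I N)"
        unfolding koszul_cycles_def by blast
    qed
    ultimately show "u \<in> koszul_cycles X m p (sum_family I N)" by blast
  qed
  then have "chain.dim (koszul_cycles X m p (sum_family I N)) = chain.dim (chain.sum_family I (\<lambda>i. koszul_cycles X m p (N i)))"
    by simp
  also have "\<dots> = (\<Sum>i\<in>I. chain.dim (koszul_cycles X m p (N i)))"
  proof (rule chain.dim_sum_family[OF I])
    fix i assume i: "i \<in> I"
    show "chain.subspace (koszul_cycles X m p (N i))" by (rule koszul_cycles_subspace[OF N(1)[OF i]])
    show "chain.fin_dim (koszul_cycles X m p (N i))"
      by (rule chain.fin_dim_subset[OF koszul_chains_fin_dim[OF N(2)[OF i]]]) (auto simp: koszul_cycles_def)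
  next
    show "chain.indep_family I (\<lambda>i. koszul_cycles X m p (N i))"
      by (rule chain.indep_family_mono[OF koszul_chains_indep_family[OF N_indep]]) (auto simp: koszul_cycles_def)
  qed
  finally show ?thesis .
qed

end

end

lemma dim_koszul_chains_rank:
  assumes "subspace N" "fin_dim N"
  shows "chain.dim (koszul_chains m (Suc p) N) = chain.dim (koszul_boundaries X m p N) + chain.dim (koszul_cycles X m (Suc p) N)"
proof -
  interpret P: vec_space_pair "pointwise_scale scale :: 'k \<Rightarrow> (nat set \<Rightarrow> 'a) \<Rightarrow> _" "pointwise_scale scale :: 'k \<Rightarrow> (nat set \<Rightarrow> 'a) \<Rightarrow> _" ..
  show ?thesis unfolding koszul_boundaries_def koszul_cycles_def
    by (rule P.rank_nullity[OF koszul_d_linear koszul_chains_subspace[OF assms(1)] koszul_chains_fin_dim[OF assms(2)]])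
qed

lemma int_koszul_dim:
  assumes "graded_module m M"
  shows "int (koszul_dim scale X m p M e) = int (chain.dim (koszul_cycles X m p (M e))) - int (chain.dim (koszul_boundaries X m p (M (e - 1))))"
proof -
  have "koszul_boundaries X m p (M (e - 1)) \<subseteq> koszul_cycles X m p (M e)"
  proof
    fix u assume "u \<in> koszul_boundaries X m p (M (e - 1))"
    then obtain w where w: "w \<in> koszul_chains m (Suc p) (M (e - 1))" "u = koszul_d X m w" unfolding koszul_boundaries_def by blast
    have "u \<in> koszul_chains m p (M e)" unfolding w(2)
      by (rule koszul_d_chains[OF w(1) order_refl graded_moduleD(1)[OF assms] graded_moduleD(4)[OF assms]])
    then show "u \<in> koszul_cycles X m p (M e)" unfolding koszul_cycles_def using w(2) koszul_d_koszul_d by simp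
  qed
  moreover have "chain.fin_dim (koszul_cycles X m p (M e))"
    by (rule chain.fin_dim_subset[OF koszul_chains_fin_dim[OF graded_moduleD(2)[OF assms]]]) (auto simp: koszul_cycles_def)
  ultimately have "chain.dim (koszul_boundaries X m p (M (e - 1))) \<le> chain.dim (koszul_cycles X m p (M e))"
    by (intro chain.dim_mono_fin_dim koszul_cycles_subspace[OF graded_moduleD(1)[OF assms]])
  then show ?thesis unfolding koszul_dim_def by simp
qed

end

text \<open>Both sides are the same Betti number.\<close>
lemma koszul_dim_forms_indep:
  fixes f :: "('v::finite, 'k::field) div_pow"
  assumes f: "f \<in> homog d" and l: "spanning_forms l" "spanning_forms l'"
  shows "koszul_dim smul (contract_ops l) CARD('v) p (derivs_int f) (int j) = koszul_dim smul (contract_ops l') CARD('v) p (derivs_int f) (int j)"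
proof -
  obtain b \<phi> \<epsilon> where res: "minimal_free_resolution (ann f) b \<phi> \<epsilon>"
    using minimal_free_resolution_exists[OF f] by blast
  interpret resolution f d b \<phi> \<epsilon> by unfold_locales (rule f res)+
  show ?thesis using betti_eq_koszul_dim[OF l(1), of p j] betti_eq_koszul_dim[OF l(2), of p j] by simp
qed

text \<open>The ranks are those of the differential for the variables, while adapted forms depend on \<open>h\<close>. The passage from
one to the other is possible because the rank is determined by the Koszul homology at degree \<open>0\<close>,
respectively \<open>d\<close>, which is the same for all choices of coordinates.\<close>
lemma rank_at_ends:
  fixes h :: "('v::finite, 'k::field) div_pow"
  assumes h: "h \<in> homog_int (int d)" "h \<noteq> 0" and d: "d \<ge> 1"
  defines "s \<equiv> poly_space.dim (derivs_int h (int d - 1))"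
  shows "s \<le> CARD('v)"
    and "chain_space.dim (koszul_boundaries (contract_ops var) CARD('v) p (derivs_int h 0)) + ((CARD('v) - s) choose Suc p) = CARD('v) choose Suc p"
    and "p \<le> CARD('v) \<Longrightarrow> chain_space.dim (koszul_boundaries (contract_ops var) CARD('v) p (derivs_int h (int d - 1))) +
      ((CARD('v) - s) choose (CARD('v) - p)) = CARD('v) choose p"
proof -
  let ?r = "CARD('v)"
  obtain l where l: "spanning_forms l" and s: "s \<le> ?r" and
    bot: "\<forall>p. koszul_dim smul (contract_ops l) ?r p (derivs_int h) 0 = (?r - s) choose p" and
    top: "\<forall>p\<le>?r. koszul_dim smul (contract_ops l) ?r p (derivs_int h) (int d) = (?r - s) choose (?r - p)"
    using koszul_ends[OF h d] unfolding s_def by blast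
  have hh: "h \<in> homog d" using h(1) by (simp add: homog_eq_homog_int)
  have indep: "koszul_dim smul (contract_ops l) ?r p (derivs_int h) (int j) = koszul_dim smul (contract_ops var) ?r p (derivs_int h) (int j)" for p j
    by (rule koszul_dim_forms_indep[OF hh l spanning_var])
  have g: "contract_ops.graded_module var ?r (derivs_int h)" by (rule derivs_int_graded_module) (rule var_homog_int)
  show "s \<le> ?r" by (rule s)
  show "chain_space.dim (koszul_boundaries (contract_ops var) ?r p (derivs_int h 0)) + ((?r - s) choose Suc p) = ?r choose Suc p"
  proof -
    have "chain_space.dim (koszul_cycles (contract_ops var) ?r (Suc p) (derivs_int h 0)) = (?r - s) choose Suc p"
    proof -
      have "derivs_int h (0 - 1) = {0}" by (rule derivs_int_neg) simp
      then have "koszul_dim smul (contract_ops var) ?r (Suc p) (derivs_int h) 0 = chain_space.dim (koszul_cycles (contract_ops var) ?r (Suc p) (derivs_int h 0))"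
        unfolding koszul_dim_def by (simp add: contract_ops.dim_koszul_boundaries_zero)
      then show ?thesis using bot indep[of "Suc p" 0] by simp
    qed
    moreover have "chain_space.dim (koszul_chains ?r (Suc p) (derivs_int h 0)) = ?r choose Suc p"
      unfolding derivs_int_0 by (rule contract_ops.dim_koszul_chains_line[OF h(2)])
    ultimately show ?thesis using contract_ops.dim_koszul_chains_rank[OF derivs_int_subspace derivs_int_fin_dim, of ?r p h 0 var] by simp
  qed
  assume p: "p \<le> ?r"
  have "chain_space.dim (koszul_cycles (contract_ops var) ?r p (derivs_int h (int d))) = ?r choose p"
    unfolding koszul_cycles_top[where l = var and m = ?r and p = p, OF var_homog_int h(1)]
    unfolding derivs_int_top[OF h] by (rule contract_ops.dim_koszul_chains_line) simp
  then have "int ((?r - s) choose (?r - p)) = int (?r choose p) - int (chain_space.dim (koszul_boundaries (contract_ops var) ?r p (derivs_int h (int d - 1))))"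
    using contract_ops.int_koszul_dim[OF g, of p "int d"] top indep[of p d] p by simp
  then show "chain_space.dim (koszul_boundaries (contract_ops var) ?r p (derivs_int h (int d - 1))) + ((?r - s) choose (?r - p)) = ?r choose p"
    by linarith
qed

section \<open>Regular splittings\<close>

locale splitting =
  fixes d n :: nat and f :: "('v::finite, 'k::field) div_pow" and g :: "nat \<Rightarrow> ('v, 'k) div_pow"
  assumes d: "d \<ge> 2" and reg: "regular_splitting d n f g"
begin

abbreviation "U i \<equiv> derivs_int (g i) (int d - 1)"

lemma derivs_eq: "derivs (d - 1) h = derivs_int h (int d - 1)"
  using d by (simp add: derivs_def derivs_int_def homog_eq_homog_int of_nat_diff)

lemma f_homog_int: "f \<in> homog_int (int d)" and f_eq: "f = (\<Sum>i=1..n. g i)"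
  and g_homog_int: "i \<in> {1..n} \<Longrightarrow> g i \<in> homog_int (int d)" and g_nz: "i \<in> {1..n} \<Longrightarrow> g i \<noteq> 0"
  using reg unfolding regular_splitting_def homog_eq_homog_int by blast+

lemma U_homog_int: "i \<in> {1..n} \<Longrightarrow> y \<in> U i \<Longrightarrow> y \<in> homog_int 1"
  using derivs_int_homog_int[OF g_homog_int, of i y "int d - 1"] by simp

lemma U_Int: 
  assumes "i \<in> {1..n}"
  shows "U i \<inter> poly_space.sum_family ({1..n} - {i}) U = {0}"
proof -
  have "(\<Sum>j\<in>{1..n} - {i}. derivs (d - 1) (g j)) = poly_space.sum_family ({1..n} - {i}) U"
    unfolding poly_space.sum_family_def derivs_eq by (rule set_sum_alt) simp
  moreover have "derivs (d - 1) (g i) \<inter> (\<Sum>j\<in>{1..n} - {i}. derivs (d - 1) (g j)) = {0}"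
    using reg assms unfolding regular_splitting_def by blast
  ultimately show ?thesis by (simp only: derivs_eq)
qed

lemma sumU_subspace: "poly_space.subspace (poly_space.sum_family ({1..n} - {i}) U)"
  by (rule poly_space.sum_family_subspace) (auto intro: derivs_int_subspace derivs_int_fin_dim)

lemma sumU_fin_dim: "poly_space.fin_dim (poly_space.sum_family ({1..n} - {i}) U)"
proof -
  have "poly_space.subspace (poly_space.sum_family ({1..n} - {i}) U) \<and> poly_space.fin_dim (poly_space.sum_family ({1..n} - {i}) U)"
    by (rule poly_space.sum_family_subspace_fin_dim) (auto intro: derivs_int_subspace derivs_int_fin_dim)
  then show ?thesis ..
qed

lemma U_indep: "poly_space.indep_family {1..n} U"
proof (rule poly_space.indep_familyI)
  fix y i assume y: "\<forall>i\<in>{1..n}. y i \<in> U i" "(\<Sum>i\<in>{1..n}. y i) = 0" and i: "i \<in> {1..n}"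
  have "y i + (\<Sum>j\<in>{1..n} - {i}. y j) = 0" using y(2) i by (simp add: sum.remove)
  then have e: "y i = - (\<Sum>j\<in>{1..n} - {i}. y j)" by (simp add: eq_neg_iff_add_eq_0)
  have "(\<Sum>j\<in>{1..n} - {i}. y j) \<in> poly_space.sum_family ({1..n} - {i}) U"
    using y(1) by (intro poly_space.sum_familyI[where y = y]) auto
  then have "y i \<in> poly_space.sum_family ({1..n} - {i}) U" unfolding e by (rule poly_space.subspace_neg[OF sumU_subspace])
  then show "y i = 0" using U_Int[OF i] y(1) i by blast
qed

text \<open>A linear form is a functional on elements of degree one. Keep its values on \<open>U i\<close>, replace them by zero on the
other \<open>U j\<close>, which is possible by independence, and extend. By nondegeneracy, the action of a linear form on
\<open>g j\<close> is determined by its values on \<open>U j\<close>.\<close>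
lemma separating_form:
  assumes i: "i \<in> {1..n}" and E: "E \<in> homog_int 1"
  shows "\<exists>D\<in>homog_int 1. contract D (g i) = contract E (g i) \<and> (\<forall>j\<in>{1..n} - {i}. contract D (g j) = 0)"
proof -
  interpret P: vec_space_pair "smul :: 'k \<Rightarrow> ('v, 'k) div_pow \<Rightarrow> _" "(*) :: 'k \<Rightarrow> 'k \<Rightarrow> 'k"
    by (intro vec_space_pair.intro vec_space_smul vec_space_field)
  have lin: "Vector_Spaces.linear smul (*) (\<lambda>y :: ('v, 'k) div_pow. lookup (contract E y) 0)"
    by unfold_locales (auto simp: contract_right.add contract_right.scale lookup_add algebra_simps)
  obtain \<psi> where \<psi>: "Vector_Spaces.linear smul (*) \<psi>" "\<forall>y\<in>U i. \<psi> y = lookup (contract E y) 0"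
    "\<forall>y\<in>poly_space.sum_family ({1..n} - {i}) U. \<psi> y = 0"
    using P.linear_extend_by_zero[OF lin derivs_int_subspace derivs_int_fin_dim sumU_subspace sumU_fin_dim
        equalityD1[OF U_Int[OF i]]]
    by (elim exE conjE)
  obtain D where D: "D \<in> homog_int 1" "\<forall>y\<in>homog_int 1. lookup (contract D y) 0 = \<psi> y" using functional_form[OF \<psi>(1)] by blast
  have const: "contract F y = single 0 (lookup (contract F y) 0)" if "F \<in> homog_int 1" "y \<in> homog_int 1" for F and y :: "('v, 'k) div_pow"
    using contract_homog_int[OF that] by (intro homog_int_0_const) simp
  have sep: "contract F h = 0" if F: "F \<in> homog_int 1" and h: "h \<in> homog_int (int d)"
    and z: "\<And>y. y \<in> derivs_int h (int d - 1) \<Longrightarrow> contract F y = 0" for F and h :: "('v, 'k) div_pow"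
  proof (rule nondeg[of _ "int d - 1" "d - 1"])
    show "contract F h \<in> homog_int (int d - 1)" by (rule contract_homog_int[OF F h])
    show "int (d - 1) \<le> int d - 1" using d by simp
    fix G :: "('v, 'k) poly_ring" assume "G \<in> homog_int (int (d - 1))"
    then have "contract G h \<in> derivs_int h (int d - 1)" using d unfolding derivs_int_def by (auto simp: of_nat_diff)
    from z[OF this] show "contract G (contract F h) = 0"
      by (simp only: contract_mult[symmetric] mult.commute)
  qed
  have "contract (D - E) (g i) = 0"
  proof (rule sep[OF poly_space.subspace_diff[OF homog_int_subspace D(1) E] g_homog_int[OF i]])
    fix y assume y: "y \<in> U i"
    have "lookup (contract D y) 0 = lookup (contract E y) 0" using D(2) \<psi>(2) y U_homog_int[OF i y] by simp
    then have "contract D y = contract E y"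
      using const[OF D(1) U_homog_int[OF i y]] const[OF E U_homog_int[OF i y]] by simp
    then show "contract (D - E) y = 0" by (simp add: contract_left.diff)
  qed
  then have "contract D (g i) = contract E (g i)" by (simp add: contract_left.diff)
  moreover have "contract D (g j) = 0" if j: "j \<in> {1..n} - {i}" for j
  proof (rule sep[OF D(1) g_homog_int])
    show "j \<in> {1..n}" using j by blast
    fix y assume y: "y \<in> U j"
    have "U j \<subseteq> poly_space.sum_family ({1..n} - {i}) U"
      by (rule poly_space.sum_family_superset[OF _ derivs_int_subspace j]) simp
    then have "\<psi> y = 0" using \<psi>(3) y by blast
    moreover have y1: "y \<in> homog_int 1" using U_homog_int[of j y] j y by blast
    ultimately have "lookup (contract D y) 0 = 0" using D(2) by simp
    then show "contract D y = 0" using const[OF D(1) y1] by simp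
  qed
  ultimately show ?thesis using D(1) by blast
qed

lemma contract_f: "contract D f = (\<Sum>i=1..n. contract D (g i))"
  unfolding f_eq by (rule contract_right.sum)

text \<open>An operator of positive degree is a sum of products \<open>q\<^sub>v x\<^sub>v\<close>. Replacing each variable \<open>x\<^sub>v\<close> by a form that
separates \<open>g i\<close> gives an operator that acts on \<open>f\<close> as the given one acts on \<open>g i\<close>.\<close>
lemma derivs_int_g_sub:
  assumes i: "i \<in> {1..n}" and e: "e \<ge> 1"
  shows "derivs_int (g i) e \<subseteq> derivs_int f e"
proof
  fix y assume "y \<in> derivs_int (g i) e"
  then obtain D where D: "D \<in> homog_int e" "y = contract D (g i)" unfolding derivs_int_def by blast
  have "lookup D 0 = 0" using D(1) e by (force simp: homog_int_iff)
  from op_sum_var_no_constant[OF D(1) this]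
  obtain q where q: "D = (\<Sum>v<CARD('v). var v * q v)" "\<forall>v<CARD('v). q v \<in> homog_int (e - 1)" by (rule mult_ops.op_sumE)
  have "\<forall>v. \<exists>E. E \<in> homog_int 1 \<and> contract E (g i) = contract (var v) (g i) \<and> (\<forall>j\<in>{1..n} - {i}. contract E (g j) = 0)"
    using separating_form[OF i var_homog_int] by blast
  from choice[OF this] obtain E where
    E: "\<forall>v. E v \<in> homog_int 1 \<and> contract (E v) (g i) = contract (var v) (g i) \<and> (\<forall>j\<in>{1..n} - {i}. contract (E v) (g j) = 0)" ..
  have Ef: "contract (E v) f = contract (var v) (g i)" for v
  proof -
    have "contract (E v) f = contract (E v) (g i) + (\<Sum>j\<in>{1..n} - {i}. contract (E v) (g j))"
      unfolding contract_f by (rule sum.remove) (use i in auto)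
    then show ?thesis using E by simp
  qed
  let ?D = "\<Sum>v<CARD('v). q v * E v"
  have "contract ?D f = (\<Sum>v<CARD('v). contract (q v) (contract (var v) (g i)))"
    by (simp add: contract_left.sum contract_mult Ef)
  also have "\<dots> = y" unfolding D(2) q(1) by (simp add: contract_left.sum contract_mult[symmetric] mult.commute)
  finally have "y = contract ?D f" by simp
  moreover have "?D \<in> homog_int e"
  proof (rule poly_space.subspace_sum[OF homog_int_subspace])
    fix v assume "v \<in> {..<CARD('v)}"
    then show "q v * E v \<in> homog_int e" using homog_int_mult[of "q v" "e - 1" "E v" 1] q(2) E by simp
  qed
  ultimately show "y \<in> derivs_int f e" unfolding derivs_int_def by blast
qed

lemma derivs_int_f:
  assumes e: "e \<ge> 1"
  shows "derivs_int f e = poly_space.sum_family {1..n} (\<lambda>i. derivs_int (g i) e)"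
proof
  show "derivs_int f e \<subseteq> poly_space.sum_family {1..n} (\<lambda>i. derivs_int (g i) e)"
  proof
    fix y assume "y \<in> derivs_int f e"
    then obtain D where D: "D \<in> homog_int e" "y = contract D f" unfolding derivs_int_def by blast
    show "y \<in> poly_space.sum_family {1..n} (\<lambda>i. derivs_int (g i) e)"
      by (rule poly_space.sum_familyI[where y = "\<lambda>i. contract D (g i)"]) (use D in \<open>auto simp: derivs_int_def contract_f\<close>)
  qed
  show "poly_space.sum_family {1..n} (\<lambda>i. derivs_int (g i) e) \<subseteq> derivs_int f e"
    by (rule poly_space.sum_family_least[OF derivs_int_subspace derivs_int_g_sub[OF _ e]])
qed

text \<open>Operators of degree \<open>d - 1 - e\<close> map a relation between the \<open>R\<^sub>e g\<^sub>i\<close> to relations between the \<open>U i\<close>, which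
are trivial.\<close>
lemma derivs_int_indep:
  assumes e: "e \<le> int d - 1"
  shows "poly_space.indep_family {1..n} (\<lambda>i. derivs_int (g i) e)"
proof (rule poly_space.indep_familyI)
  fix y i assume y: "\<forall>i\<in>{1..n}. y i \<in> derivs_int (g i) e" "(\<Sum>i\<in>{1..n}. y i) = 0" and i: "i \<in> {1..n}"
  show "y i = 0"
  proof (rule nondeg)
    show "y i \<in> homog_int (int d - e)" using derivs_int_homog_int[OF g_homog_int[OF i]] y(1) i by blast
    show "int (nat (int d - 1 - e)) \<le> int d - e" using e by simp
    fix D :: "('v, 'k) poly_ring" assume "D \<in> homog_int (int (nat (int d - 1 - e)))"
    then have D: "D \<in> homog_int (int d - 1 - e)" using e by simp
    have "contract D (y j) \<in> U j" if "j \<in> {1..n}" for j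
      using derivs_int_contract[OF D, of "y j" "g j" e] y(1) that by simp
    moreover have "(\<Sum>j\<in>{1..n}. contract D (y j)) = 0" using y(2) by (simp add: contract_right.sum[symmetric] contract_right.zero)
    ultimately show "contract D (y i) = 0" by (rule poly_space.indep_familyD[OF U_indep _ _ i])
  qed
qed

lemma f_nz:
  assumes "n \<ge> 1"
  shows "f \<noteq> 0"
proof
  assume "f = 0"
  have i: "1 \<in> {1..n}" using assms by simp
  have "derivs_int f 1 = {0}" using \<open>f = 0\<close> poly_space.subspace_0[OF homog_int_subspace] by (auto simp: derivs_int_def contract_right.zero)
  then have "contract (var v) (g 1) = 0" for v
    using derivs_int_g_sub[OF i, of 1] var_homog_int unfolding derivs_int_def by blast
  then have "g 1 = 0" using d by (intro nondeg_step[OF g_homog_int[OF i]]) auto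
  then show False using g_nz[OF i] by simp
qed

lemma dim_sum: "poly_space.dim (derivs_int f (int d - 1)) = (\<Sum>i=1..n. poly_space.dim (U i))"
proof -
  have "1 \<le> int d - 1" using d by simp
  then show ?thesis unfolding derivs_int_f[OF \<open>1 \<le> int d - 1\<close>]
    by (intro poly_space.dim_sum_family[OF finite_atLeastAtMost derivs_int_subspace derivs_int_fin_dim U_indep])
qed

end

section \<open>Betti numbers of a regular splitting\<close>

lemma binom_nat: "binom (int a) (int b) = int (a choose b)"
  by (auto simp: binom_def binomial_eq_0)

lemma binom_eq_0: "b < 0 \<or> b > a \<Longrightarrow> binom a b = 0"
  by (simp add: binom_def)

lemma nu_nat:
  assumes "(\<Sum>i=1..n. s i) \<le> r" "\<And>i. i \<in> {1..n} \<Longrightarrow> s i \<le> r"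
  shows "nu r n s (int q - 1) = (int n - 1) * int (r choose q) + int ((r - (\<Sum>i=1..n. s i)) choose q)
    - (\<Sum>i=1..n. int ((r - s i) choose q))"
proof -
  have 1: "int r - (\<Sum>i=1..n. int (s i)) = int (r - (\<Sum>i=1..n. s i))"
    using assms(1) by (simp add: of_nat_diff)
  have 2: "(\<Sum>i=1..n. binom (int r - int (s i)) (int q)) = (\<Sum>i=1..n. int ((r - s i) choose q))"
  proof (rule sum.cong[OF refl])
    fix i assume "i \<in> {1..n}"
    then have "int r - int (s i) = int (r - s i)" using assms(2) by (simp add: of_nat_diff)
    then show "binom (int r - int (s i)) (int q) = int ((r - s i) choose q)" by (simp only: binom_nat)
  qed
  have 3: "int q - 1 + 1 = int q" by simp
  show ?thesis unfolding nu_def 1 3 2 binom_nat ..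
qed

text \<open>For \<open>k = -1\<close> each binomial coefficient is \<open>1\<close> and the sum is \<open>(n - 1) + 1 - n\<close>; otherwise all of them vanish.\<close>
lemma nu_outside:
  assumes "(\<Sum>i=1..n. s i) \<le> r" "\<And>i. i \<in> {1..n} \<Longrightarrow> s i \<le> r" "k < 0 \<or> k \<ge> int r"
  shows "nu r n s k = 0"
proof (cases "k = - 1")
  case True
  then show ?thesis using nu_nat[OF assms(1,2), of 0] by simp
next
  case False
  have "binom (int a) (k + 1) = 0" if "a \<le> r" for a
    using that assms(3) False by (intro binom_eq_0) linarith
  note z = this
  have 1: "int r - (\<Sum>i=1..n. int (s i)) = int (r - (\<Sum>i=1..n. s i))"
    using assms(1) by (simp add: of_nat_diff)
  have 2: "(\<Sum>i=1..n. binom (int r - int (s i)) (k + 1)) = 0"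
  proof (rule sum.neutral, rule ballI)
    fix i assume "i \<in> {1..n}"
    then have "int r - int (s i) = int (r - s i)" using assms(2) by (simp add: of_nat_diff)
    then show "binom (int r - int (s i)) (k + 1) = 0" by (simp only: z[OF diff_le_self])
  qed
  show ?thesis unfolding nu_def 1 2 z[OF diff_le_self] z[OF order_refl] by simp
qed

context splitting
begin

abbreviation cyc :: "('v, 'k) div_pow \<Rightarrow> nat \<Rightarrow> int \<Rightarrow> int" where
  "cyc h p j \<equiv> int (chain_space.dim (koszul_cycles (contract_ops var) CARD('v) p (derivs_int h j)))"
abbreviation bnd :: "('v, 'k) div_pow \<Rightarrow> nat \<Rightarrow> int \<Rightarrow> int" where
  "bnd h p j \<equiv> int (chain_space.dim (koszul_boundaries (contract_ops var) CARD('v) p (derivs_int h j)))"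

lemma koszul_dim_cyc_bnd: "int (koszul_dim smul (contract_ops var) CARD('v) p (derivs_int h) j) = cyc h p j - bnd h p (j - 1)"
  by (rule contract_ops.int_koszul_dim[OF derivs_int_graded_module]) (rule var_homog_int)

lemma derivs_int_var: "v < m \<Longrightarrow> x \<in> derivs_int h e \<Longrightarrow> contract (var v) x \<in> derivs_int h (e + 1)"
  by (rule derivs_int_contract[OF var_homog_int])

lemma bnd_sum:
  assumes "1 \<le> e" "e \<le> int d - 2"
  shows "bnd f p e = (\<Sum>i=1..n. bnd (g i) p e)"
proof -
  have i1: "poly_space.indep_family {1..n} (\<lambda>i. derivs_int (g i) e)" using assms by (intro derivs_int_indep) simp
  have i2: "poly_space.indep_family {1..n} (\<lambda>i. derivs_int (g i) (e + 1))" using assms by (intro derivs_int_indep) simp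
  have "chain_space.dim (koszul_boundaries (contract_ops var) CARD('v) p (poly_space.sum_family {1..n} (\<lambda>i. derivs_int (g i) e))) =
      (\<Sum>i=1..n. chain_space.dim (koszul_boundaries (contract_ops var) CARD('v) p (derivs_int (g i) e)))"
    by (rule contract_ops.dim_koszul_boundaries_sum_family[OF finite_atLeastAtMost derivs_int_subspace derivs_int_fin_dim i1 derivs_int_subspace i2 derivs_int_var])
  then show ?thesis by (simp add: derivs_int_f[OF assms(1)])
qed

lemma cyc_sum:
  assumes "1 \<le> e" "e \<le> int d - 2"
  shows "cyc f p e = (\<Sum>i=1..n. cyc (g i) p e)"
proof -
  have i1: "poly_space.indep_family {1..n} (\<lambda>i. derivs_int (g i) e)" using assms by (intro derivs_int_indep) simp
  have i2: "poly_space.indep_family {1..n} (\<lambda>i. derivs_int (g i) (e + 1))" using assms by (intro derivs_int_indep) simp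
  have "chain_space.dim (koszul_cycles (contract_ops var) CARD('v) p (poly_space.sum_family {1..n} (\<lambda>i. derivs_int (g i) e))) =
      (\<Sum>i=1..n. chain_space.dim (koszul_cycles (contract_ops var) CARD('v) p (derivs_int (g i) e)))"
    by (rule contract_ops.dim_koszul_cycles_sum_family[OF finite_atLeastAtMost derivs_int_subspace derivs_int_fin_dim i1 derivs_int_subspace i2 derivs_int_var])
  then show ?thesis by (simp add: derivs_int_f[OF assms(1)])
qed

lemma chains_sum:
  "int (chain_space.dim (koszul_chains m p (derivs_int f (int d - 1)))) = (\<Sum>i=1..n. int (chain_space.dim (koszul_chains m p (U i))))"
proof -
  have e: "1 \<le> int d - 1" using d by simp
  have "chain_space.dim (koszul_chains m p (poly_space.sum_family {1..n} U)) = (\<Sum>i=1..n. chain_space.dim (koszul_chains m p (U i)))"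
    by (rule contract_ops.dim_koszul_chains_sum_family[OF finite_atLeastAtMost derivs_int_subspace derivs_int_fin_dim U_indep derivs_int_subspace])
  then show ?thesis by (simp add: derivs_int_f[OF e])
qed

end

text \<open>For \<open>n = 0\<close> the form \<open>f\<close> is zero, and the rank formulas for nonzero forms do not apply to it.\<close>
locale nonempty_splitting = splitting d n f g
  for d n and f :: "('v::finite, 'k::field) div_pow" and g +
  assumes n: "n \<ge> 1"
begin

definition sdim :: "nat \<Rightarrow> nat" where "sdim i = poly_space.dim (U i)"

lemma s_sum: "poly_space.dim (derivs_int f (int d - 1)) = (\<Sum>i=1..n. sdim i)"
  unfolding sdim_def by (rule dim_sum)

lemma d1: "d \<ge> 1" using d by simp

lemmas ends_f = rank_at_ends[OF f_homog_int f_nz[OF n] d1, unfolded s_sum]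
lemmas ends_g = rank_at_ends[OF g_homog_int g_nz d1, folded sdim_def]

lemma nu_sdim:
  "nu CARD('v) n sdim (int q - 1) = (int n - 1) * int (CARD('v) choose q)
    + int ((CARD('v) - (\<Sum>i=1..n. sdim i)) choose q) - (\<Sum>i=1..n. int ((CARD('v) - sdim i) choose q))"
  by (rule nu_nat[OF ends_f(1)]) (rule ends_g(1))

lemma nu_sdim_outside: "k < 0 \<or> k \<ge> int CARD('v) \<Longrightarrow> nu CARD('v) n sdim k = 0"
  by (rule nu_outside[OF ends_f(1)]) (rule ends_g(1))

text \<open>The difference of the ranks of the differentials out of degree \<open>0\<close>.\<close>
lemma nu_bottom: "(\<Sum>i=1..n. bnd (g i) p 0) - bnd f p 0 = nu CARD('v) n sdim (int p)"
proof -
  let ?r = "CARD('v)"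
  have "bnd (g i) p 0 = int (?r choose Suc p) - int ((?r - sdim i) choose Suc p)" if "i \<in> {1..n}" for i
    using ends_g(2)[OF that that, of p] by linarith
  then have 1: "(\<Sum>i=1..n. bnd (g i) p 0) = (\<Sum>i=1..n. int (?r choose Suc p) - int ((?r - sdim i) choose Suc p))"
    by (intro sum.cong) auto
  have 2: "bnd f p 0 = int (?r choose Suc p) - int ((?r - (\<Sum>i=1..n. sdim i)) choose Suc p)"
    using ends_f(2)[of p] by linarith
  have "nu ?r n sdim (int (Suc p) - 1) = (\<Sum>i=1..n. bnd (g i) p 0) - bnd f p 0"
    unfolding 1 2 nu_sdim by (simp add: sum_subtractf algebra_simps)
  then show ?thesis by simp
qed

text \<open>The difference of the ranks of the differentials into degree \<open>d\<close>.\<close>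
lemma nu_top:
  assumes "q < CARD('v)"
  shows "(\<Sum>i=1..n. bnd (g i) q (int d - 1)) - bnd f q (int d - 1) = nu CARD('v) n sdim (int CARD('v) - int (Suc q))"
proof -
  let ?r = "CARD('v)"
  have q: "q \<le> ?r" using assms by simp
  have "bnd (g i) q (int d - 1) = int (?r choose q) - int ((?r - sdim i) choose (?r - q))" if "i \<in> {1..n}" for i
    using ends_g(3)[OF that that q] by linarith
  then have 1: "(\<Sum>i=1..n. bnd (g i) q (int d - 1)) = (\<Sum>i=1..n. int (?r choose q) - int ((?r - sdim i) choose (?r - q)))"
    by (intro sum.cong) auto
  have 2: "bnd f q (int d - 1) = int (?r choose q) - int ((?r - (\<Sum>i=1..n. sdim i)) choose (?r - q))"
    using ends_f(3)[OF q] by linarith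
  have 3: "int ?r - int (Suc q) = int (?r - q) - 1" using assms by (simp add: of_nat_diff)
  show ?thesis
    unfolding 1 2 3 nu_sdim binomial_symmetric[OF q, symmetric]
    by (simp add: sum_subtractf algebra_simps)
qed

text \<open>In degree \<open>d - 1\<close> the chains still form a direct sum, so the cycles differ by the ranks of the differentials
into degree \<open>d\<close>.\<close>
lemma cyc_top:
  assumes "p \<le> CARD('v)"
  shows "cyc f p (int d - 1) = (\<Sum>i=1..n. cyc (g i) p (int d - 1)) + nu CARD('v) n sdim (int CARD('v) - int p)"
proof (cases p)
  case 0
  have "koszul_cycles (contract_ops var) CARD('v) 0 N = koszul_chains CARD('v) 0 N" for N :: "('v, 'k) div_pow set"
    using contract_ops.koszul_d_chains_0[of _ "CARD('v)" N "CARD('v)" var] by (auto simp: koszul_cycles_def)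
  moreover have "nu CARD('v) n sdim (int CARD('v) - int p) = 0"
    by (rule nu_sdim_outside) (use 0 in auto)
  ultimately show ?thesis using chains_sum 0 by simp
next
  case (Suc q)
  have c: "cyc h (Suc q) (int d - 1) = int (chain_space.dim (koszul_chains CARD('v) (Suc q) (derivs_int h (int d - 1)))) - bnd h q (int d - 1)" for h
    using contract_ops.dim_koszul_chains_rank[OF derivs_int_subspace derivs_int_fin_dim, of "CARD('v)" q h "int d - 1" var] by linarith
  have "q < CARD('v)" using assms Suc by simp
  from nu_top[OF this] show ?thesis
    unfolding Suc c sum_subtractf using chains_sum[of "CARD('v)" "Suc q"] by linarith
qed

end

theorem theorem3p35:
  fixes f :: "('v::finite, 'k::field) div_pow"
    and g :: "nat \<Rightarrow> ('v, 'k) div_pow"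
    and d n r :: nat
    and s :: "nat \<Rightarrow> nat"
    and j :: nat and k :: int
  assumes "r = CARD('v)"
    and "d \<ge> 2"
    and "regular_splitting d n f g"
    and "\<And>i. i \<in> {1..n} \<Longrightarrow> s i = vector_space.dim smul (derivs (d - 1) (g i))"
    and "0 < j" and "j < d"
  shows "int (shifted_betti (ann f) k j) =
           (\<Sum>i=1..n. int (shifted_betti (ann (g i)) k j))
           + nu r n s k * of_bool (j = 1)
           + nu r n s (int r - k) * of_bool (j = d - 1)"
proof -
  interpret splitting d n f g by unfold_locales (rule assms)+
  have betti: "int (shifted_betti (ann h) k j) =
      (if k < 0 \<or> k > int r then 0 else cyc h (nat k) (int j) - bnd h (nat k) (int j - 1))"
    if "h \<in> homog d" for h
    using shifted_betti_eq_koszul_dim[OF that spanning_var, of k j] koszul_dim_cyc_bnd[of "nat k" h "int j"]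
    by (simp add: assms(1))
  have fh: "f \<in> homog d" and gh: "\<And>i. i \<in> {1..n} \<Longrightarrow> g i \<in> homog d"
    using assms(3) unfolding regular_splitting_def by blast+
  show ?thesis
  proof (cases "n = 0")
    case True
    then have "f = 0" using f_eq by simp
    then have mf0: "derivs_int f e = {0}" for e using poly_space.subspace_0[OF homog_int_subspace] by (auto simp: derivs_int_def contract_right.zero)
    have "cyc f p e = 0" "bnd f p e = 0" for p e
    proof -
      have "koszul_chains CARD('v) q (derivs_int f e) \<subseteq> chain_space.span {}" for q
        by (auto simp: mf0 koszul_chains_def fun_eq_iff)
      then have "koszul_cycles (contract_ops var) CARD('v) p (derivs_int f e) \<subseteq> chain_space.span {}" unfolding koszul_cycles_def by blast
      then have "chain_space.dim (koszul_cycles (contract_ops var) CARD('v) p (derivs_int f e)) \<le> card ({} :: (nat set \<Rightarrow> ('v, 'k) div_pow) set)"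
        by (rule chain_space.dim_le_card) simp
      then show "cyc f p e = 0" by simp
      show "bnd f p e = 0" unfolding mf0 by (simp add: contract_ops.dim_koszul_boundaries_zero)
    qed
    then have "int (shifted_betti (ann f) k j) = 0" using betti[OF fh] by simp
    then show ?thesis using True by (simp add: nu_def)
  next
    case False
    interpret nonempty_splitting d n f g by unfold_locales (use False in simp)
    have s: "nu r n s k' = nu CARD('v) n sdim k'" for k'
    proof -
      have "s i = sdim i" if "i \<in> {1..n}" for i using assms(4)[OF that] by (simp only: derivs_eq sdim_def)
      then show ?thesis by (simp add: nu_def assms(1))
    qed
    show ?thesis
    proof (cases "k < 0 \<or> k > int r")
      case True
      then have "nu CARD('v) n sdim k = 0" "nu CARD('v) n sdim (int r - k) = 0"
        using assms(1) by (auto intro!: nu_sdim_outside)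
      moreover have "(\<Sum>i=1..n. int (shifted_betti (ann (g i)) k j)) = 0"
        using True betti gh by (intro sum.neutral) auto
      ultimately show ?thesis using True betti[OF fh] s by simp
    next
      case k: False
      define p where "p = nat k"
      have p: "k = int p" "p \<le> CARD('v)" using k assms(1) by (auto simp: p_def)
      have "int (shifted_betti (ann (g i)) k j) = cyc (g i) p (int j) - bnd (g i) p (int j - 1)" if "i \<in> {1..n}" for i
        using betti[OF gh[OF that]] k by (auto simp: p_def)
      then have bg: "(\<Sum>i=1..n. int (shifted_betti (ann (g i)) k j)) =
          (\<Sum>i=1..n. cyc (g i) p (int j)) - (\<Sum>i=1..n. bnd (g i) p (int j - 1))"
        by (simp add: sum_subtractf)
      have bf: "int (shifted_betti (ann f) k j) = cyc f p (int j) - bnd f p (int j - 1)"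
        using betti[OF fh] k by (auto simp: p_def)
      have B: "(\<Sum>i=1..n. bnd (g i) p (int j - 1)) - bnd f p (int j - 1) = nu r n s k * of_bool (j = 1)"
      proof (cases "j = 1")
        case True
        then show ?thesis using nu_bottom[of p] s[of k] p(1) by simp
      next
        case False
        then show ?thesis using bnd_sum[of "int j - 1" p] assms(5,6) by simp
      qed
      have C: "cyc f p (int j) = (\<Sum>i=1..n. cyc (g i) p (int j)) + nu r n s (int r - k) * of_bool (j = d - 1)"
      proof (cases "j = d - 1")
        case True
        then have "int j = int d - 1" using assms(2) by simp
        then show ?thesis using True cyc_top[OF p(2)] s[of "int r - k"] p(1) assms(1) by simp
      next
        case False
        then show ?thesis using cyc_sum[of "int j" p] assms(5,6) by simp
      qed
      show ?thesis using bf bg B C by linarith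
    qed
  qed
qed

end
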